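(* Let $\Omega\subset\mathbb{R}^2$ be a bounded connected open set which is piecewise $C^2$ without concave corners, with corner set $\mathcal C=\{y_1,\dots,y_m\}$, and starshaped with respect to the origin (i.e. $\langle y,\nu(y)\rangle>0$ for every $y\in\partial\Omega\setminus\mathcal C$). Assume that one of the following holds: (i) $\Omega$ is of class $C^1$ and there exists $y_0\in\partial\Omega\setminus\mathcal C$ with $\kappa(y_0)=\max_{y\in\partial\Omega\setminus\mathcal C}\kappa(y)$ and $\varphi(y_0)\ge |\Omega|/|\partial\Omega|$; (ii) $\varphi$ is constant on $\partial\Omega\setminus\mathcal C$. Then $\Omega$ is a ball (disk).
   Context: A bounded connected open set $\Omega\subset\mathbb{R}^2$ is piecewise $C^2$ without concave corners if it satisfies a uniform exterior sphere condition and $\partial\Omega=\bigcup_{i=1}^m\Gamma_i$, where each $\Gamma_i$ is a simple $C^2$ arc up to its endpoints $y_{i-1},y_i$ (with $y_0=y_m$), and $\Gamma_i\cap\Gamma_{i+1}=\{y_i\}$ for $1\le i\le m-1$, $\Gamma_m\cap\Gamma_1=\{y_m\}$, and $\Gamma_i\cap\Gamma_j=\emptyset$ if $i-j\ne\pm1$ (mod $m$). The corner set is $\mathcal C=\{y_1,\dots,y_m\}$. For $y\in\partial\Omega\setminus\mathcal C$, $\nu(y)$ is the outward unit normal and $\kappa(y)$ the curvature of $\partial\Omega$ at $y$ (a disk of radius $r$ has curvature $1/r$). $d_\Omega(x)=\min_{z\in\partial\Omega}|x-z|$; the cut value is $\lambda(y)=\sup\{t\ge0:\ d_\Omega(y-t\nu(y))=t\}$,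 and $\varphi(y)=\int_0^{\lambda(y)}(1-t\kappa(y))\,dt=\lambda(y)-\tfrac12\lambda(y)^2\kappa(y)$ for $y\in\partial\Omega\setminus\mathcal C$. $|\Omega|$ denotes area and $|\partial\Omega|$ perimeter. *)

theory Defs
  imports "HOL-Analysis.Analysis"
begin

definition C2_arc :: "(real \<Rightarrow> real^2) \<Rightarrow> bool" where
  "C2_arc g \<longleftrightarrow> inj_on g {0..1} \<and>
     (\<exists>g1 g2. (\<forall>t\<in>{0..1}. (g has_vector_derivative g1 t) (at t within {0..1}) \<and>
                            (g1 has_vector_derivative g2 t) (at t within {0..1}) \<and>
                            g1 t \<noteq> 0) \<and>
              continuous_on {0..1} g2)"

definition uniform_exterior_sphere :: "(real^2) set \<Rightarrow> bool" where
  "uniform_exterior_sphere \<Omega> \<longleftrightarrow>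
     (\<exists>r>0. \<forall>z\<in>frontier \<Omega>. \<exists>c. dist c z = r \<and> ball c r \<inter> \<Omega> = {})"

definition csuc :: "nat \<Rightarrow> nat \<Rightarrow> nat" where
  "csuc m i = (if i = m then 1 else Suc i)"

definition piecewise_C2_no_concave ::
  "(real^2) set \<Rightarrow> nat \<Rightarrow> (nat \<Rightarrow> real \<Rightarrow> real^2) \<Rightarrow> (nat \<Rightarrow> real^2) \<Rightarrow> bool" where
  "piecewise_C2_no_concave \<Omega> m \<gamma> y \<longleftrightarrow>
     uniform_exterior_sphere \<Omega> \<and> m \<ge> 1 \<and>
     frontier \<Omega> = (\<Union>i\<in>{1..m}. \<gamma> i ` {0..1}) \<and>
     y 0 = y m \<and>
     (\<forall>i\<in>{1..m}. C2_arc (\<gamma> i) \<and> \<gamma> i 0 = y (i - 1) \<and> \<gamma> i 1 = y i) \<and>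
     (\<forall>i\<in>{1..<m}. \<gamma> i ` {0..1} \<inter> \<gamma> (Suc i) ` {0..1} = {y i}) \<and>
     \<gamma> m ` {0..1} \<inter> \<gamma> 1 ` {0..1} = {y m} \<and>
     (\<forall>i\<in>{1..m}. \<forall>j\<in>{1..m}. i \<noteq> j \<and> j \<noteq> csuc m i \<and> i \<noteq> csuc m j \<longrightarrow>
          \<gamma> i ` {0..1} \<inter> \<gamma> j ` {0..1} = {})"

definition corners :: "nat \<Rightarrow> (nat \<Rightarrow> real^2) \<Rightarrow> (real^2) set" where
  "corners m y = y ` {1..m}"

definition outward_normal ::
  "(real^2) set \<Rightarrow> nat \<Rightarrow> (nat \<Rightarrow> real \<Rightarrow> real^2) \<Rightarrow> real^2 \<Rightarrow> real^2" where
  "outward_normal \<Omega> m \<gamma> z = (SOME n. \<exists>i\<in>{1..m}. \<exists>t\<in>{0<..<1}. \<gamma> i t = z \<and>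
       norm n = 1 \<and> n \<bullet> vector_derivative (\<gamma> i) (at t) = 0 \<and>
       (\<forall>\<^sub>F s in at_right 0. z - s *\<^sub>R n \<in> \<Omega>))"

text \<open>Curvature, signed so that a disk of radius r has curvature 1/r:
  kappa = - <gamma'', nu> / |gamma'|^2.\<close>
definition curvature ::
  "(real^2) set \<Rightarrow> nat \<Rightarrow> (nat \<Rightarrow> real \<Rightarrow> real^2) \<Rightarrow> real^2 \<Rightarrow> real" where
  "curvature \<Omega> m \<gamma> z = (SOME k. \<exists>i\<in>{1..m}. \<exists>t\<in>{0<..<1}. \<gamma> i t = z \<and>
       k = - (vector_derivative (\<lambda>s. vector_derivative (\<gamma> i) (at s)) (at t)
                 \<bullet> outward_normal \<Omega> m \<gamma> z)
             / (norm (vector_derivative (\<gamma> i) (at t)))\<^sup>2)"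

definition dist_bd :: "(real^2) set \<Rightarrow> real^2 \<Rightarrow> real" where
  "dist_bd \<Omega> x = infdist x (frontier \<Omega>)"

definition cut_value ::
  "(real^2) set \<Rightarrow> nat \<Rightarrow> (nat \<Rightarrow> real \<Rightarrow> real^2) \<Rightarrow> real^2 \<Rightarrow> real" where
  "cut_value \<Omega> m \<gamma> z =
     Sup {t. t \<ge> 0 \<and> dist_bd \<Omega> (z - t *\<^sub>R outward_normal \<Omega> m \<gamma> z) = t}"

definition phi ::
  "(real^2) set \<Rightarrow> nat \<Rightarrow> (nat \<Rightarrow> real \<Rightarrow> real^2) \<Rightarrow> real^2 \<Rightarrow> real" where
  "phi \<Omega> m \<gamma> z = cut_value \<Omega> m \<gamma> z - (cut_value \<Omega> m \<gamma> z)\<^sup>2 * curvature \<Omega> m \<gamma> z / 2"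

definition perimeter :: "nat \<Rightarrow> (nat \<Rightarrow> real \<Rightarrow> real^2) \<Rightarrow> real" where
  "perimeter m \<gamma> = (\<Sum>i=1..m. integral {0..1} (\<lambda>t. norm (vector_derivative (\<gamma> i) (at t))))"

definition C1_boundary :: "nat \<Rightarrow> (nat \<Rightarrow> real \<Rightarrow> real^2) \<Rightarrow> bool" where
  "C1_boundary m \<gamma> \<longleftrightarrow> (\<forall>i\<in>{1..m}.
      sgn (vector_derivative (\<gamma> i) (at 1 within {0..1})) =
      sgn (vector_derivative (\<gamma> (csuc m i)) (at 0 within {0..1})))"

end

theory Submission
  imports Defs
begin

text \<open>Write \<open>P\<close> for the perimeter and \<open>A\<close> for the area. For a boundary of class \<open>C\<^sup>1\<close>,
  integrating \<open>d\<langle>\<gamma>, T\<rangle>/ds = 1 - \<kappa>\<langle>\<gamma>, \<nu>\<rangle>\<close> along the boundary gives \<open>\<integral>\<kappa>\<langle>\<gamma>, \<nu>\<rangle> = P\<close>, while the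
  region swept by the segments from the origin to the boundary gives \<open>\<integral>\<langle>\<gamma>, \<nu>\<rangle> \<le> 2A\<close>. Hence a bound
  \<open>\<kappa> \<le> k\<close> with \<open>2kA \<le> P\<close> forces \<open>\<kappa> = k\<close>, so that the centers \<open>\<gamma> - \<nu>/k\<close> of curvature agree.
  Such a bound comes from \<open>\<kappa>\<phi> = \<lambda>\<kappa> - (\<lambda>\<kappa>)\<^sup>2/2 \<le> 1/2\<close>, in case (i) applied at the point of maximal
  curvature. In case (ii), the inner normals up to the cut value cover almost all of \<open>\<Omega>\<close>, whence
  \<open>A \<le> \<integral>\<phi> = cP\<close>; in particular \<open>c > 0\<close>, the cut value is bounded below, and every corner is
  touched by an interior and an exterior ball, so there are no genuine corners.\<close>

text \<open>The given \<open>outward_normal\<close> and \<open>curvature\<close> are choices that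
  are determined only inside the arcs, so nothing is known at the corners, and it is not known on
  which side of its boundary \<Omega> lies. The exterior sphere condition settles the side: it rules
  out that \<Omega> lies on both sides of an arc. At a corner, equal tangents do not yet give equal
  normals, and equal normals determine the tangents only up to sign; both gaps need a separate
  argument. The one-sided estimate of the swept area suffices. Write W for the integral of
  \<langle>\<gamma>, \<nu>\<rangle>. The curvature bound and the integral formula give k W \<ge> P >
  0, so k is positive, and then k W \<le> 2kA \<le> P reverses the inequality. In case (i), k is the
  maximal curvature, and 2kA \<le> P is the bound k \<phi> \<le> 1/2 combined with \<phi> \<ge> A/P.
  In case (ii), k = 1/(2c), and 2kA \<le> P is A \<le> cP. The regularity that (i) assumes has to be
  derived in (ii), before the integral formula can be applied.\<close>

definition rot :: "real^2 \<Rightarrow> real^2" where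
  "rot v = vector [- v$2, v$1]"

lemma rot_nth [simp]: "rot v $ 1 = - v$2" "rot v $ 2 = v$1"
  by (simp_all add: rot_def)

lemma rot_linear: "linear rot"
  by (intro linearI) (simp_all add: vec_eq_iff forall_2)

lemma rot_bounded_linear: "bounded_linear rot"
  using rot_linear linear_linear by blast

lemmas rot_scaleR = linear_scale[OF rot_linear]

lemma inner_2: "(x::real^2) \<bullet> y = x$1 * y$1 + x$2 * y$2"
  by (simp add: inner_vec_def sum_2)

lemma rot_rot [simp]: "rot (rot v) = - v"
  by (simp add: vec_eq_iff forall_2)

lemma rot_inner_rot [simp]: "rot u \<bullet> rot v = u \<bullet> v"
  by (simp add: inner_2)

lemma norm_rot [simp]: "norm (rot v) = norm v"
  by (simp add: norm_eq_sqrt_inner)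

lemma rot_orth [simp]: "v \<bullet> rot v = 0" "rot v \<bullet> v = 0"
  by (simp_all add: inner_2)

lemma inner_rot_swap: "u \<bullet> rot v = - (rot u \<bullet> v)"
  by (simp add: inner_2)

lemma continuous_on_rot [continuous_intros]:
  "continuous_on S f \<Longrightarrow> continuous_on S (\<lambda>x. rot (f x))"
  by (rule bounded_linear.continuous_on[OF rot_bounded_linear])

lemma rot_decomp:
  assumes "norm T = 1"
  shows "v = (v \<bullet> T) *\<^sub>R T + (v \<bullet> rot T) *\<^sub>R rot T"
proof -
  have T: "T$1 * T$1 + T$2 * T$2 = 1"
    using assms by (simp add: norm_eq_sqrt_inner inner_2)
  have "(v \<bullet> T) * T$1 + (v \<bullet> rot T) * rot T $ 1 = v$1 * (T$1 * T$1 + T$2 * T$2)"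
       "(v \<bullet> T) * T$2 + (v \<bullet> rot T) * rot T $ 2 = v$2 * (T$1 * T$1 + T$2 * T$2)"
    by (simp_all add: inner_2 algebra_simps)
  then show ?thesis
    using T by (simp add: vec_eq_iff forall_2)
qed

lemma unit_orth_cases:
  assumes "norm T = 1" "norm x = 1" "x \<bullet> T = 0"
  shows "x = rot T \<or> x = - rot T"
proof -
  have x: "x = (x \<bullet> rot T) *\<^sub>R rot T"
    using rot_decomp[OF assms(1), of x] assms(3) by simp
  have "norm x = \<bar>x \<bullet> rot T\<bar>"
    by (subst x) (simp add: assms(1))
  then have "x \<bullet> rot T = 1 \<or> x \<bullet> rot T = -1"
    using assms(2) by auto
  then show ?thesis using x by (metis scaleR_minus1_left scaleR_one)
qed

text \<open>Near \<open>t0\<close> the curve stays in an arbitrarily thin double cone about its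
  tangent line. The bound does not mention the parameter, so it survives the joining of two arcs
  with different speeds at a corner.\<close>

lemma tangency:
  fixes c :: "real \<Rightarrow> real^2"
  assumes der: "(c has_vector_derivative \<alpha> *\<^sub>R T) (at t0 within S)"
    and "\<alpha> \<noteq> 0" "norm T = 1" "e > 0"
  shows "\<exists>d>0. \<forall>t\<in>S. \<bar>t - t0\<bar> < d \<longrightarrow> \<bar>(c t - c t0) \<bullet> rot T\<bar> \<le> e * \<bar>(c t - c t0) \<bullet> T\<bar>"
proof -
  \<comment> \<open>This solves \<open>\<eta> = e * (\<bar>\<alpha>\<bar> - \<eta>)\<close>: the
    normal component is at most \<open>\<eta> * \<bar>t - t0\<bar>\<close>, the tangential one at
    least \<open>(\<bar>\<alpha>\<bar> - \<eta>) * \<bar>t - t0\<bar>\<close>.\<close>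
  define \<eta> where "\<eta> = e * \<bar>\<alpha>\<bar> / (1 + e)"
  have \<eta>: "\<eta> > 0" "\<eta> \<le> e * (\<bar>\<alpha>\<bar> - \<eta>)"
    using assms by (auto simp: \<eta>_def field_simps)
  from der[unfolded has_vector_derivative_def has_derivative_within_alt, THEN conjunct2, rule_format, OF \<eta>(1)]
  obtain d where d: "d > 0" and
    *: "\<And>t. t \<in> S \<Longrightarrow> \<bar>t - t0\<bar> < d \<Longrightarrow> norm (c t - c t0 - (t - t0) *\<^sub>R \<alpha> *\<^sub>R T) \<le> \<eta> * \<bar>t - t0\<bar>"
    by auto
  have "\<bar>(c t - c t0) \<bullet> rot T\<bar> \<le> e * \<bar>(c t - c t0) \<bullet> T\<bar>" if t: "t \<in> S" "\<bar>t - t0\<bar> < d" for t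
  proof -
    define w where "w = c t - c t0 - (t - t0) *\<^sub>R \<alpha> *\<^sub>R T"
    have w: "norm w \<le> \<eta> * \<bar>t - t0\<bar>" using *[OF t] by (simp add: w_def)
    have eq: "c t - c t0 = w + ((t - t0) * \<alpha>) *\<^sub>R T" by (simp add: w_def)
    have "(c t - c t0) \<bullet> rot T = w \<bullet> rot T" by (simp add: eq inner_add_left)
    also have "\<bar>\<dots>\<bar> \<le> norm w" using Cauchy_Schwarz_ineq2[of w "rot T"] assms by simp
    finally have 1: "\<bar>(c t - c t0) \<bullet> rot T\<bar> \<le> \<eta> * \<bar>t - t0\<bar>" using w by linarith
    have TT: "T \<bullet> T = 1" using assms by (simp add: norm_eq_1)
    have "(c t - c t0) \<bullet> T = w \<bullet> T + (t - t0) * \<alpha>" by (simp add: eq inner_add_left TT)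
    moreover have "\<bar>w \<bullet> T\<bar> \<le> norm w" using Cauchy_Schwarz_ineq2[of w T] assms by simp
    ultimately have "\<bar>(c t - c t0) \<bullet> T\<bar> \<ge> \<bar>t - t0\<bar> * \<bar>\<alpha>\<bar> - \<eta> * \<bar>t - t0\<bar>"
      using w by (simp add: abs_mult[symmetric])
    then have "(\<bar>\<alpha>\<bar> - \<eta>) * \<bar>t - t0\<bar> \<le> \<bar>(c t - c t0) \<bullet> T\<bar>" by (simp add: algebra_simps)
    then have "e * ((\<bar>\<alpha>\<bar> - \<eta>) * \<bar>t - t0\<bar>) \<le> e * \<bar>(c t - c t0) \<bullet> T\<bar>" using assms by simp
    moreover have "\<eta> * \<bar>t - t0\<bar> \<le> e * (\<bar>\<alpha>\<bar> - \<eta>) * \<bar>t - t0\<bar>"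
      using \<eta>(2) by (simp add: mult_right_mono)
    ultimately show ?thesis using 1 by (simp add: mult.assoc)
  qed
  with d show ?thesis by blast
qed

text \<open>A ray from a point of the sphere at an acute angle to the inward radius runs along a
  chord of the ball; \<open>b\<close> in the proof is the parameter at the far end of that
  chord.\<close>

lemma eventually_in_ball_direction:
  fixes p z v :: "'a::real_inner"
  assumes "dist p z = r" "v \<bullet> (p - z) > 0"
  shows "\<forall>\<^sub>F s in at_right 0. z + s *\<^sub>R v \<in> ball p r"
proof -
  have v0: "v \<noteq> 0" using assms by auto
  define b where "b = 2 * (v \<bullet> (p - z)) / (v \<bullet> v)"
  have b: "b > 0" using assms v0 by (simp add: b_def)
  have "z + s *\<^sub>R v \<in> ball p r" if s: "0 < s" "s < b" for s
  proof -
    have "s * (v \<bullet> v) < 2 * (v \<bullet> (p - z))"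
      using s v0 by (simp add: b_def field_simps)
    then have "s * (s * (v \<bullet> v)) < s * (2 * (v \<bullet> (p - z)))" using s by simp
    then have "(norm ((p - z) - s *\<^sub>R v))\<^sup>2 < (norm (p - z))\<^sup>2"
      unfolding power2_norm_eq_inner by (simp add: inner_diff_left inner_diff_right inner_commute algebra_simps)
    then have "norm ((p - z) - s *\<^sub>R v) < norm (p - z)"
      using norm_ge_zero power_less_imp_less_base by blast
    then show ?thesis using assms(1) by (simp add: dist_norm algebra_simps)
  qed
  then show ?thesis using b unfolding eventually_at_right_field by blast
qed

section \<open>The side of a boundary curve on which a domain lies\<close>

lemma connected_frontier_free:
  assumes "connected S" "S \<inter> frontier \<Omega> = {}"
  shows "S \<subseteq> \<Omega> \<or> S \<inter> \<Omega> = {}"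
  using connected_Int_frontier[OF assms(1), of \<Omega>] assms(2) by blast

text \<open>Near a point where the frontier is a curve \<open>c\<close> tangent to \<open>T\<close> and a graph over the line
  spanned by \<open>T\<close>, translating the curve in the two normal directions sweeps out two connected
  strips which miss the frontier. Together with the curve they cover a neighbourhood, so at least
  one of them lies in \<open>\<Omega>\<close>, and the exterior ball excludes that both do.\<close>

lemma local_side:
  fixes c :: "real \<Rightarrow> real^2" and z T p :: "real^2"
  assumes z: "z \<in> frontier \<Omega>" and \<Omega>: "open \<Omega>" and T: "norm T = 1" and a: "a > 0"
    and cont: "continuous_on {-a..a} c" and c0: "c 0 = z"
    and mono: "\<And>s t. -a \<le> s \<Longrightarrow> s < t \<Longrightarrow> t \<le> a \<Longrightarrow> c s \<bullet> T < c t \<bullet> T"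
    and sub: "c ` {-a..a} \<subseteq> frontier \<Omega>"
    and rho: "\<rho> > 0" "frontier \<Omega> \<inter> ball z \<rho> \<subseteq> c ` {-a..a}"
    and tang: "\<And>e. e > 0 \<Longrightarrow> \<exists>d>0. \<forall>t. \<bar>t\<bar> < d \<longrightarrow> \<bar>t\<bar> \<le> a \<longrightarrow>
                 \<bar>(c t - z) \<bullet> rot T\<bar> \<le> e * \<bar>(c t - z) \<bullet> T\<bar>"
    and ext: "dist p z = r" "r > 0" "ball p r \<inter> \<Omega> = {}"
  obtains N b where "N = rot T \<or> N = - rot T" "b > 0"
    "\<And>v. v \<bullet> N < 0 \<Longrightarrow> \<forall>\<^sub>F s in at_right 0. z + s *\<^sub>R v \<in> \<Omega>"
    "\<And>v. v \<bullet> N > 0 \<Longrightarrow> \<forall>\<^sub>F s in at_right 0. z + s *\<^sub>R v \<notin> \<Omega>"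
    "\<And>t. \<bar>t\<bar> < b \<Longrightarrow> \<forall>\<^sub>F s in at_right 0. c t - s *\<^sub>R N \<in> \<Omega>"
proof -
  define n where "n = rot T"
  have nu: "norm n = 1" "n \<bullet> n = 1" "n \<bullet> T = 0" "T \<bullet> n = 0"
    using T by (auto simp: n_def norm_eq_1)
  have "\<exists>d>0. \<forall>t\<in>{-a..a}. dist t 0 < d \<longrightarrow> dist (c t) (c 0) < \<rho>/4"
    using cont a rho(1) unfolding continuous_on_iff by (metis atLeastAtMost_iff divide_pos_pos
        less_eq_real_def neg_0_le_iff_le neg_le_0_iff_le zero_less_numeral)
  then obtain d where d: "d > 0" "\<And>t. t\<in>{-a..a} \<Longrightarrow> dist t 0 < d \<Longrightarrow> dist (c t) (c 0) < \<rho>/4"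
    by blast
  \<comment> \<open>Parameters up to \<open>b\<close> keep the curve within \<rho>/4 of
    \<open>z\<close>. With strips of height \<rho>/2 everything stays in the ball where the frontier
    is known to be the curve.\<close>
  define b where "b = min (a/2) (d/2)"
  have b: "b > 0" "b < a" using a d by (auto simp: b_def)
  have near: "dist (c t) z < \<rho>/4" if "\<bar>t\<bar> \<le> b" for t
  proof -
    have "\<bar>t\<bar> \<le> a/2" "\<bar>t\<bar> \<le> d/2" using that by (auto simp: b_def)
    then have "t \<in> {-a..a}" "dist t 0 < d" using a d(1) unfolding atLeastAtMost_iff by auto
    then show ?thesis using d(2) c0 by auto
  qed
  define strip where "strip \<sigma> = (\<lambda>(t,s). c t + (\<sigma> * s) *\<^sub>R n) ` ({-b<..<b} \<times> {0<..<\<rho>/2})"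
    for \<sigma> :: real
  have conn: "connected (strip \<sigma>)" for \<sigma>
  proof -
    have "continuous_on ({-b<..<b} \<times> {0<..<\<rho>/2}) (\<lambda>x. c (fst x))"
      by (rule continuous_on_compose2[OF cont]) (use b in \<open>auto intro!: continuous_intros\<close>)
    then have "continuous_on ({-b<..<b} \<times> {0<..<\<rho>/2}) (\<lambda>(t,s). c t + (\<sigma> * s) *\<^sub>R n)"
      unfolding case_prod_beta by (intro continuous_intros)
    moreover have "connected ({-b<..<b} \<times> {0<..<\<rho>/2})"
      by (intro connected_Times) auto
    ultimately show ?thesis unfolding strip_def by (rule connected_continuous_image)
  qed
  have free: "strip \<sigma> \<inter> frontier \<Omega> = {}" if \<sigma>: "\<bar>\<sigma>\<bar> = 1" for \<sigma>
  proof -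
    have False if t: "\<bar>t\<bar> < b" and s: "0 < s" "s < \<rho>/2" and
      f: "c t + (\<sigma> * s) *\<^sub>R n \<in> frontier \<Omega>" for t s
    proof -
      have "dist (c t + (\<sigma> * s) *\<^sub>R n) z \<le> dist (c t) z + norm ((\<sigma> * s) *\<^sub>R n)"
        by (metis add.commute add_diff_cancel_left' diff_add_eq dist_norm norm_triangle_ineq)
      also have "\<dots> < \<rho>/4 + \<rho>/2"
        using near[of t] t s nu \<sigma> by (auto simp: abs_mult)
      also have "\<dots> < \<rho>" using rho by simp
      finally have "c t + (\<sigma> * s) *\<^sub>R n \<in> ball z \<rho>" by (simp add: dist_commute)
      with f rho obtain t' where t': "-a \<le> t'" "t' \<le> a" "c t + (\<sigma> * s) *\<^sub>R n = c t'" by force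
      \<comment> \<open>Moving along \<open>n\<close> preserves the \<open>T\<close>-coordinate,
        which determines the parameter on the curve. A frontier point in the strip would thus be its
        own foot point, although its height is positive.\<close>
      from arg_cong[OF this(3), of "\<lambda>x. x \<bullet> T"] have "c t \<bullet> T = c t' \<bullet> T"
        by (simp add: inner_add_left nu)
      moreover have "-a \<le> t" "t \<le> a" using t b by linarith+
      ultimately have "t = t'" using mono[of t t'] mono[of t' t] t' by (cases t t' rule: linorder_cases) auto
      with t'(3) have "(\<sigma> * s) *\<^sub>R n = 0" by simp
      then show False using s \<sigma> nu by auto
    qed
    then show ?thesis unfolding strip_def by (force simp: abs_less_iff)
  qed
  \<comment> \<open>The range \<delta> is left free: to cover a neighbourhood \<open>b\<close> is
    enough, but a ray has to be compared with the part of the curve inside a thin cone.\<close>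
  have ivt: "\<exists>g>0. \<forall>x. \<bar>(x - z) \<bullet> T\<bar> < g \<longrightarrow> (\<exists>t. \<bar>t\<bar> < \<delta> \<and> c t \<bullet> T = x \<bullet> T)"
    if \<delta>: "0 < \<delta>" "\<delta> \<le> b" for \<delta>
  proof -
    define g where "g = min (c (\<delta>/2) \<bullet> T - z \<bullet> T) (z \<bullet> T - c (-\<delta>/2) \<bullet> T)"
    have g: "g > 0"
      using mono[of 0 "\<delta>/2"] mono[of "-\<delta>/2" 0] \<delta> b c0 by (auto simp: g_def)
    have "\<exists>t. \<bar>t\<bar> < \<delta> \<and> c t \<bullet> T = x \<bullet> T" if x: "\<bar>(x - z) \<bullet> T\<bar> < g" for x
    proof -
      have "continuous_on {-\<delta>/2..\<delta>/2} (\<lambda>t. c t \<bullet> T)"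
        by (intro continuous_intros continuous_on_subset[OF cont]) (use \<delta> b in auto)
      moreover have "c (-\<delta>/2) \<bullet> T \<le> x \<bullet> T" "x \<bullet> T \<le> c (\<delta>/2) \<bullet> T"
        using x by (auto simp: g_def inner_diff_left abs_less_iff)
      ultimately obtain t where "-\<delta>/2 \<le> t" "t \<le> \<delta>/2" "c t \<bullet> T = x \<bullet> T"
        using IVT'[of "\<lambda>t. c t \<bullet> T" "-\<delta>/2" "x \<bullet> T" "\<delta>/2"] \<delta> by auto
      then show ?thesis using \<delta> by (intro exI[of _ t]) auto
    qed
    with g show ?thesis by blast
  qed
  have cover: "\<exists>g>0. \<forall>x\<in>ball z g. x \<in> frontier \<Omega> \<union> strip 1 \<union> strip (-1)"
  proof -
    obtain g where g: "g > 0" "\<And>x. \<bar>(x - z) \<bullet> T\<bar> < g \<Longrightarrow> \<exists>t. \<bar>t\<bar> < b \<and> c t \<bullet> T = x \<bullet> T"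
      using ivt[of b] b by blast
    have "x \<in> frontier \<Omega> \<union> strip 1 \<union> strip (-1)" if x: "x \<in> ball z (min g (\<rho>/4))" for x
    proof -
      have xz: "norm (x - z) < g" "norm (x - z) < \<rho>/4" using x by (auto simp: dist_norm norm_minus_commute)
      have "\<bar>(x - z) \<bullet> T\<bar> < g" using Cauchy_Schwarz_ineq2[of "x - z" T] T xz by simp
      then obtain t where t: "\<bar>t\<bar> < b" "c t \<bullet> T = x \<bullet> T" using g by blast
      define s where "s = (x - c t) \<bullet> n"
      have eq: "x = c t + s *\<^sub>R n"
        using rot_decomp[OF T, of "x - c t"] t by (simp add: s_def n_def inner_diff_left algebra_simps)
      have "\<bar>s\<bar> \<le> norm (x - c t)" using Cauchy_Schwarz_ineq2[of "x - c t" n] nu by (simp add: s_def)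
      also have "\<dots> \<le> norm (x - z) + dist (c t) z"
        by (metis dist_commute dist_norm dist_triangle)
      also have "\<dots> < \<rho>/2" using near[of t] t xz by auto
      finally have s: "\<bar>s\<bar> < \<rho>/2" .
      consider "s > 0" | "s < 0" | "s = 0" by linarith
      then show ?thesis
      proof cases
        case 1
        then have "x \<in> strip 1" unfolding strip_def using eq s t
          by (intro image_eqI[of _ _ "(t,s)"]) auto
        then show ?thesis by blast
      next
        case 2
        then have "x \<in> strip (-1)" unfolding strip_def using eq s t
          by (intro image_eqI[of _ _ "(t,-s)"]) auto
        then show ?thesis by blast
      next
        case 3
        moreover have "-a \<le> t" "t \<le> a" using t b by linarith+
        ultimately show ?thesis using eq sub by (simp add: image_subset_iff)
      qed
    qed
    moreover have "min g (\<rho>/4) > 0" using g rho by simp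
    ultimately show ?thesis by blast
  qed
  have disj: "strip \<sigma> \<subseteq> \<Omega> \<or> strip \<sigma> \<inter> \<Omega> = {}" if "\<bar>\<sigma>\<bar> = 1" for \<sigma>
    using connected_frontier_free[OF conn free[OF that]] .
  have one: "\<exists>\<sigma>. \<bar>\<sigma>\<bar> = 1 \<and> strip \<sigma> \<subseteq> \<Omega>"
  proof -
    obtain g where g: "g > 0" "\<And>x. x \<in> ball z g \<Longrightarrow> x \<in> frontier \<Omega> \<union> strip 1 \<union> strip (-1)"
      using cover by blast
    have "z \<in> closure \<Omega>" using z by (simp add: frontier_def)
    then obtain x where x: "x \<in> \<Omega>" "dist x z < g" using g by (meson closure_approachable)
    then have "x \<notin> frontier \<Omega>" using \<Omega> frontier_disjoint_eq by blast
    then have "x \<in> strip 1 \<or> x \<in> strip (-1)" using g(2)[of x] x by (auto simp: dist_commute)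
    then show ?thesis using disj[of 1] disj[of "-1"] x
      by (metis abs_1 abs_minus disjoint_iff)
  qed
  have ray: "\<forall>\<^sub>F s in at_right 0. z + s *\<^sub>R v \<in> strip \<sigma>" if \<sigma>: "\<bar>\<sigma>\<bar> = 1" and v: "\<sigma> * (v \<bullet> n) > 0" for v \<sigma>
  proof -
    \<comment> \<open>With this slope
      \<open>e * \<bar>v \<bullet> T\<bar> < \<bar>v \<bullet> n\<bar>\<close>: the curve inside the
      cone stays closer to the tangent line than the ray does, so the ray keeps to its side.\<close>
    define e where "e = \<bar>v \<bullet> n\<bar> / (2 * (\<bar>v \<bullet> T\<bar> + 1))"
    have vn: "\<bar>v \<bullet> n\<bar> > 0" using v by auto
    then have e: "e > 0" "e * \<bar>v \<bullet> T\<bar> < \<bar>v \<bullet> n\<bar>" unfolding e_def by (auto simp: field_simps add_pos_nonneg)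
    obtain d' where d': "d' > 0" "\<And>t. \<bar>t\<bar> < d' \<Longrightarrow> \<bar>t\<bar> \<le> a \<Longrightarrow>
                 \<bar>(c t - z) \<bullet> n\<bar> \<le> e * \<bar>(c t - z) \<bullet> T\<bar>"
      using tang[OF e(1)] unfolding n_def by blast
    obtain g where g: "g > 0" "\<And>x. \<bar>(x - z) \<bullet> T\<bar> < g \<Longrightarrow> \<exists>t. \<bar>t\<bar> < min d' b \<and> c t \<bullet> T = x \<bullet> T"
      using ivt[of "min d' b"] d' b by auto
    \<comment> \<open>The first bound keeps the ray over parameters near 0, the second keeps it
      below the height of the strip.\<close>
    define q where "q = min (g / (\<bar>v \<bullet> T\<bar> + 1)) (\<rho> / (4 * \<bar>v \<bullet> n\<bar>))"
    have q: "q > 0" using g rho vn by (auto simp: q_def add_nonneg_pos)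
    have "z + s *\<^sub>R v \<in> strip \<sigma>" if s: "0 < s" "s < q" for s
    proof -
      define x where "x = z + s *\<^sub>R v"
      have "s * (\<bar>v \<bullet> T\<bar> + 1) < g" using s by (simp add: q_def pos_less_divide_eq add_nonneg_pos)
      then have "\<bar>(x - z) \<bullet> T\<bar> < g" using s by (simp add: x_def abs_mult algebra_simps)
      then obtain t where t: "\<bar>t\<bar> < min d' b" "c t \<bullet> T = x \<bullet> T" using g by blast
      define u where "u = (x - c t) \<bullet> n"
      have eq: "x = c t + u *\<^sub>R n"
        using rot_decomp[OF T, of "x - c t"] t by (simp add: u_def n_def inner_diff_left algebra_simps)
      have u: "u = s * (v \<bullet> n) - (c t - z) \<bullet> n"
        by (simp add: u_def x_def inner_diff_left inner_add_left)
      have "\<bar>(c t - z) \<bullet> n\<bar> \<le> e * \<bar>(c t - z) \<bullet> T\<bar>" using d' t b by auto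
      also have "(c t - z) \<bullet> T = s * (v \<bullet> T)" using t by (simp add: x_def inner_diff_left inner_add_left)
      also have "e * \<bar>s * (v \<bullet> T)\<bar> = s * (e * \<bar>v \<bullet> T\<bar>)" using s by (simp add: abs_mult)
      also have "\<dots> < s * \<bar>v \<bullet> n\<bar>" using s e by simp
      finally have *: "\<bar>(c t - z) \<bullet> n\<bar> < s * \<bar>v \<bullet> n\<bar>" .
      have s2: "s * \<bar>v \<bullet> n\<bar> < \<rho>/4" using s vn by (simp add: q_def field_simps)
      have "0 < \<sigma> * u \<and> \<sigma> * u < \<rho>/2 \<and> \<sigma> * (\<sigma> * u) = u"
      proof (cases "\<sigma> = 1")
        case True
        then show ?thesis using * s2 v u by auto
      next
        case False
        then have \<sigma>1: "\<sigma> = -1" using \<sigma> by linarith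
        then have "\<bar>v \<bullet> n\<bar> = - (v \<bullet> n)" using v by auto
        then show ?thesis using * s2 u \<sigma>1 by (auto simp: abs_less_iff)
      qed
      then show ?thesis unfolding strip_def x_def[symmetric] using eq t
        by (intro image_eqI[of _ _ "(t,\<sigma> * u)"]) auto
    qed
    then show ?thesis using q unfolding eventually_at_right_field by blast
  qed
  obtain \<sigma> where \<sigma>: "\<bar>\<sigma>\<bar> = 1" "strip \<sigma> \<subseteq> \<Omega>" using one by blast
  have other: "strip (-\<sigma>) \<inter> \<Omega> = {}"
  proof -
    \<comment> \<open>A direction that enters the exterior ball and is not tangent to the curve; if
      the radius happens to be tangent, it is tilted by \<open>n\<close>. The strip on that side
      then meets the exterior ball and cannot lie in \<Omega>.\<close>
    have "\<exists>v. v \<bullet> (p - z) > 0 \<and> v \<bullet> n \<noteq> 0"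
    proof (cases "(p - z) \<bullet> n = 0")
      case False
      have "p \<noteq> z" using ext by auto
      then show ?thesis using False by (intro exI[of _ "p - z"]) auto
    next
      case True
      have "p \<noteq> z" using ext by auto
      moreover have "n \<bullet> (p - z) = 0" using True by (simp add: inner_commute)
      ultimately have "((p - z) + n) \<bullet> (p - z) > 0" "((p - z) + n) \<bullet> n \<noteq> 0"
        unfolding inner_add_left True nu by simp_all
      then show ?thesis by blast
    qed
    then obtain v where v: "v \<bullet> (p - z) > 0" "v \<bullet> n \<noteq> 0" by blast
    define \<tau> where "\<tau> = sgn (v \<bullet> n)"
    have \<tau>: "\<bar>\<tau>\<bar> = 1" "\<tau> * (v \<bullet> n) > 0" using v by (auto simp: \<tau>_def sgn_real_def)
    have "\<forall>\<^sub>F s in at_right 0. z + s *\<^sub>R v \<in> ball p r \<and> z + s *\<^sub>R v \<in> strip \<tau>"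
      using eventually_in_ball_direction[OF ext(1) v(1)] ray[OF \<tau>] by eventually_elim auto
    then obtain s where "z + s *\<^sub>R v \<in> ball p r" "z + s *\<^sub>R v \<in> strip \<tau>"
      using eventually_happens[of _ "at_right (0::real)"] trivial_limit_at_right_real by blast
    then have "\<not> strip \<tau> \<subseteq> \<Omega>" using ext by blast
    then have "\<tau> \<noteq> \<sigma>" "strip \<tau> \<inter> \<Omega> = {}" using \<sigma> disj \<tau> by auto
    moreover have "\<tau> = -\<sigma>" using \<sigma>(1) \<tau>(1) \<open>\<tau> \<noteq> \<sigma>\<close> by (auto simp: abs_if split: if_splits)
    ultimately show ?thesis by simp
  qed
  have \<sigma>1: "\<bar>-\<sigma>\<bar> = 1" using \<sigma> by simp
  show thesis
  proof (rule that[of "-\<sigma> *\<^sub>R n" b])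
    show "- \<sigma> *\<^sub>R n = rot T \<or> - \<sigma> *\<^sub>R n = - rot T"
      using \<sigma>(1) by (auto simp: n_def abs_if split: if_splits)
    show "b > 0" by fact
    show "\<forall>\<^sub>F s in at_right 0. z + s *\<^sub>R v \<in> \<Omega>" if "v \<bullet> (- \<sigma> *\<^sub>R n) < 0" for v
    proof -
      have "\<forall>\<^sub>F s in at_right 0. z + s *\<^sub>R v \<in> strip \<sigma>" by (rule ray) (use that \<sigma> in auto)
      then show ?thesis by eventually_elim (use \<sigma> in auto)
    qed
    show "\<forall>\<^sub>F s in at_right 0. z + s *\<^sub>R v \<notin> \<Omega>" if "v \<bullet> (- \<sigma> *\<^sub>R n) > 0" for v
    proof -
      have "\<forall>\<^sub>F s in at_right 0. z + s *\<^sub>R v \<in> strip (-\<sigma>)" by (rule ray) (use that \<sigma> in auto)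
      then show ?thesis by eventually_elim (use other in auto)
    qed
    show "\<forall>\<^sub>F s in at_right 0. c t - s *\<^sub>R (- \<sigma> *\<^sub>R n) \<in> \<Omega>" if "\<bar>t\<bar> < b" for t
    proof -
      have "c t - s *\<^sub>R (- \<sigma> *\<^sub>R n) \<in> strip \<sigma>" if "0 < s" "s < \<rho>/2" for s
        unfolding strip_def using that \<open>\<bar>t\<bar> < b\<close>
        by (intro image_eqI[of _ _ "(t,s)"]) (auto simp: mult.commute)
      moreover have "\<rho>/2 > 0" using rho by simp
      ultimately show ?thesis using \<sigma> unfolding eventually_at_right_field by blast
    qed
  qed
qed

section \<open>Piecewise C2 domains\<close>

text \<open>Continuity of \<open>D\<close> keeps \<open>D t \<bullet> T\<close> positive near
  \<open>t0\<close>, so the curve is locally a graph over the line spanned by \<open>T\<close>. The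
  closed unit interval is kept so that the result also serves at the ends of an arc.\<close>

lemma projection_strict_mono:
  fixes c D :: "real \<Rightarrow> real^2"
  assumes der: "\<And>t. t \<in> {0..1} \<Longrightarrow> (c has_vector_derivative D t) (at t within {0..1})"
    and cont: "continuous_on {0..1} D" and t0: "t0 \<in> {0..1}" and pos: "D t0 \<bullet> T > 0"
  shows "\<exists>d>0. \<forall>s\<in>{0..1}. \<forall>t\<in>{0..1}. \<bar>s - t0\<bar> \<le> d \<longrightarrow> \<bar>t - t0\<bar> \<le> d \<longrightarrow> s < t \<longrightarrow> c s \<bullet> T < c t \<bullet> T"
proof -
  have "continuous_on {0..1} (\<lambda>t. D t \<bullet> T)" by (intro continuous_intros cont)
  then obtain d where d: "d > 0" "\<And>t. t \<in> {0..1} \<Longrightarrow> dist t t0 < d \<Longrightarrow> dist (D t \<bullet> T) (D t0 \<bullet> T) < D t0 \<bullet> T"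
    using pos t0 unfolding continuous_on_iff by meson
  have P: "D t \<bullet> T > 0" if "t \<in> {0..1}" "\<bar>t - t0\<bar> < d" for t
    using d(2)[OF that(1)] that(2) by (auto simp: dist_real_def abs_less_iff)
  have C: "continuous_on {0..1} (\<lambda>t. c t \<bullet> T)"
  proof (intro continuous_on_inner continuous_on_const)
    show "continuous_on {0..1} c"
      by (rule continuous_on_vector_derivative) (rule der)
  qed
  have "c s \<bullet> T < c t \<bullet> T"
    if st: "s \<in> {0..1}" "t \<in> {0..1}" "\<bar>s - t0\<bar> \<le> d/2" "\<bar>t - t0\<bar> \<le> d/2" "s < t" for s t
  proof (rule DERIV_pos_imp_increasing_open[OF st(5)])
    show "continuous_on {s..t} (\<lambda>t. c t \<bullet> T)"
      by (rule continuous_on_subset[OF C]) (use st in auto)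
    fix x assume x: "s < x" "x < t"
    then have x01: "x \<in> {0<..<1}" using st by auto
    have "(c has_vector_derivative D x) (at x)"
      using der[of x] x01 by (auto simp: at_within_Icc_at)
    then have "((\<lambda>t. c t \<bullet> T) has_real_derivative D x \<bullet> T) (at x)"
      unfolding has_vector_derivative_def has_field_derivative_def
      by (auto intro!: derivative_eq_intros simp: fun_eq_iff)
    moreover have "\<bar>x - t0\<bar> < d" using x st(3,4) d(1) by linarith
    ultimately show "\<exists>y. ((\<lambda>t. c t \<bullet> T) has_real_derivative y) (at x) \<and> 0 < y"
      using P[of x] x01 by auto
  qed
  with d(1) show ?thesis by (intro exI[of _ "d/2"]) auto
qed

locale piecewise_domain =
  fixes \<Omega> :: "(real^2) set" and m :: nat
    and \<gamma> :: "nat \<Rightarrow> real \<Rightarrow> real^2" and y :: "nat \<Rightarrow> real^2"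
  assumes bdd: "bounded \<Omega>" and conn: "connected \<Omega>" and opn: "open \<Omega>"
    and pc: "piecewise_C2_no_concave \<Omega> m \<gamma> y"
begin

text \<open>Taken within the closed interval, so that it is meaningful at the ends of an arc; the
  given notions use the two-sided derivative, which is controlled only at interior
  parameters.\<close>

definition D :: "nat \<Rightarrow> real \<Rightarrow> real^2" where
  "D i t = vector_derivative (\<gamma> i) (at t within {0..1})"

definition DD :: "nat \<Rightarrow> real \<Rightarrow> real^2" where
  "DD i t = vector_derivative (D i) (at t within {0..1})"

definition T :: "nat \<Rightarrow> real \<Rightarrow> real^2" where
  "T i t = sgn (D i t)"

lemma arc: 
  assumes "i \<in> {1..m}"
  shows "C2_arc (\<gamma> i)" "\<gamma> i 0 = y (i - 1)" "\<gamma> i 1 = y i" "inj_on (\<gamma> i) {0..1}"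
  using pc assms unfolding piecewise_C2_no_concave_def C2_arc_def by auto

lemma frontier_eq: "frontier \<Omega> = (\<Union>i\<in>{1..m}. \<gamma> i ` {0..1})"
  using pc unfolding piecewise_C2_no_concave_def by auto

lemma in_frontier: "i \<in> {1..m} \<Longrightarrow> t \<in> {0..1} \<Longrightarrow> \<gamma> i t \<in> frontier \<Omega>"
  unfolding frontier_eq by blast

lemma y_0: "y 0 = y m"
  using pc unfolding piecewise_C2_no_concave_def by auto

text \<open>\<open>C2_arc\<close> merely asserts that some derivatives exist; uniqueness of
  derivatives within a nondegenerate interval identifies them with \<open>D\<close> and
  \<open>DD\<close>.\<close>

lemma derivs:
  assumes i: "i \<in> {1..m}"
  shows has_D: "t \<in> {0..1} \<Longrightarrow> (\<gamma> i has_vector_derivative D i t) (at t within {0..1})"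
    and has_DD: "t \<in> {0..1} \<Longrightarrow> (D i has_vector_derivative DD i t) (at t within {0..1})"
    and D_nz: "t \<in> {0..1} \<Longrightarrow> D i t \<noteq> 0"
    and cont_DD: "continuous_on {0..1} (DD i)"
proof -
  from arc(1)[OF i] obtain g1 g2 where
    g1: "\<And>t. t \<in> {0..1} \<Longrightarrow> (\<gamma> i has_vector_derivative g1 t) (at t within {0..1})" and
    g2: "\<And>t. t \<in> {0..1} \<Longrightarrow> (g1 has_vector_derivative g2 t) (at t within {0..1})" and
    nz: "\<And>t. t \<in> {0..1} \<Longrightarrow> g1 t \<noteq> 0" and c: "continuous_on {0..1} g2"
    unfolding C2_arc_def by blast
  have D: "D i t = g1 t" if "t \<in> {0..1}" for t
    unfolding D_def using g1[OF that] that
    by (intro vector_derivative_within_cbox[of 0 1, unfolded box_real]) auto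
  have Dd: "(D i has_vector_derivative g2 t) (at t within {0..1})" if "t \<in> {0..1}" for t
    by (rule has_vector_derivative_transform[OF that _ g2[OF that]]) (use D in auto)
  have DD: "DD i t = g2 t" if "t \<in> {0..1}" for t
    unfolding DD_def using Dd[OF that] that
    by (intro vector_derivative_within_cbox[of 0 1, unfolded box_real]) auto
  show "t \<in> {0..1} \<Longrightarrow> (\<gamma> i has_vector_derivative D i t) (at t within {0..1})"
    "t \<in> {0..1} \<Longrightarrow> (D i has_vector_derivative DD i t) (at t within {0..1})"
    "t \<in> {0..1} \<Longrightarrow> D i t \<noteq> 0" using g1 D Dd DD nz by auto
  show "continuous_on {0..1} (DD i)" by (rule continuous_on_eq[OF c]) (use DD in auto)
qed

lemma cont_\<gamma>: "i \<in> {1..m} \<Longrightarrow> continuous_on {0..1} (\<gamma> i)"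
  by (rule continuous_on_vector_derivative, rule has_D)

lemma cont_D: "i \<in> {1..m} \<Longrightarrow> continuous_on {0..1} (D i)"
  by (rule continuous_on_vector_derivative, rule has_DD)

lemma cont_T: "i \<in> {1..m} \<Longrightarrow> continuous_on {0..1} (T i)"
  unfolding T_def[abs_def] sgn_div_norm using D_nz by (intro continuous_intros cont_D) auto

lemma norm_T: "i \<in> {1..m} \<Longrightarrow> t \<in> {0..1} \<Longrightarrow> norm (T i t) = 1"
  using D_nz by (simp add: T_def norm_sgn)

lemma D_eq: "D i t = norm (D i t) *\<^sub>R T i t"
  by (cases "D i t = 0") (simp_all add: T_def sgn_div_norm)

lemma norm_D_pos: "i \<in> {1..m} \<Longrightarrow> t \<in> {0..1} \<Longrightarrow> norm (D i t) > 0"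
  using D_nz by simp

lemma D_inner_T: "D i t \<bullet> T i t = norm (D i t)"
  by (cases "D i t = 0") (simp_all add: T_def sgn_div_norm power2_norm_eq_inner[symmetric] power2_eq_square)

lemma has_D_at: "i \<in> {1..m} \<Longrightarrow> t \<in> {0<..<1} \<Longrightarrow> (\<gamma> i has_vector_derivative D i t) (at t)"
  using has_D[of i t] by (auto simp: at_within_Icc_at)

lemma has_DD_at: "i \<in> {1..m} \<Longrightarrow> t \<in> {0<..<1} \<Longrightarrow> (D i has_vector_derivative DD i t) (at t)"
  using has_DD[of i t] by (auto simp: at_within_Icc_at)

lemma vd1: "i \<in> {1..m} \<Longrightarrow> t \<in> {0<..<1} \<Longrightarrow> vector_derivative (\<gamma> i) (at t) = D i t"
  using has_D_at vector_derivative_at by blast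

lemma vd2:
  assumes "i \<in> {1..m}" "t \<in> {0<..<1}"
  shows "vector_derivative (\<lambda>s. vector_derivative (\<gamma> i) (at s)) (at t) = DD i t"
proof (rule vector_derivative_at)
  show "((\<lambda>s. vector_derivative (\<gamma> i) (at s)) has_vector_derivative DD i t) (at t)"
    by (rule has_vector_derivative_transform_within_open[OF has_DD_at[OF assms], of "{0<..<1}"])
       (use assms vd1 in auto)
qed

section \<open>Incidence of the arcs and the frontier near a boundary point\<close>

lemma m_ge_1: "m \<ge> 1"
  using pc unfolding piecewise_C2_no_concave_def by auto

text \<open>A single arc would have to close up, against injectivity. With two arcs both
  intersection conditions concern the same pair, so \<open>y 1 = y 2\<close> and the second arc
  closes up.\<close>

lemma m_ge_3: "m \<ge> 3"
proof -
  have "m \<noteq> 1"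
  proof
    assume m: "m = 1"
    then have "\<gamma> 1 0 = \<gamma> 1 1" using arc(2,3)[of 1] y_0 by auto
    then show False using arc(4)[of 1] m by (auto dest: inj_onD[of _ _ 0 1])
  qed
  moreover have "m \<noteq> 2"
  proof
    assume m: "m = 2"
    have "\<gamma> 1 ` {0..1} \<inter> \<gamma> (Suc 1) ` {0..1} = {y 1}" "\<gamma> m ` {0..1} \<inter> \<gamma> 1 ` {0..1} = {y m}"
      using pc m unfolding piecewise_C2_no_concave_def by auto
    then have "y 1 = y 2" using m by (auto simp: numeral_2_eq_2)
    then have "\<gamma> 2 0 = \<gamma> 2 1" using arc(2,3)[of 2] m by auto
    then show False using arc(4)[of 2] m by (auto dest: inj_onD[of _ _ 0 1])
  qed
  ultimately show ?thesis using m_ge_1 by linarith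
qed

lemma csuc: 
  assumes "i \<in> {1..m}"
  shows "csuc m i \<in> {1..m}" "csuc m i \<noteq> i" "\<gamma> (csuc m i) 0 = y i"
proof -
  show 1: "csuc m i \<in> {1..m}" "csuc m i \<noteq> i" using assms m_ge_3 by (auto simp: csuc_def)
  show "\<gamma> (csuc m i) 0 = y i" using arc(2)[OF 1(1)] y_0 assms by (auto simp: csuc_def)
qed

lemma csuc_inter: 
  assumes "i \<in> {1..m}"
  shows "\<gamma> i ` {0..1} \<inter> \<gamma> (csuc m i) ` {0..1} = {y i}"
  using pc assms unfolding piecewise_C2_no_concave_def csuc_def by (cases "i = m") auto

lemma csuc_meet:
  assumes i: "i \<in> {1..m}" and t: "t \<in> {0..1}" "u \<in> {0..1}" "\<gamma> i t = \<gamma> (csuc m i) u"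
  shows "t = 1" "u = 0"
proof -
  have "\<gamma> i t = y i" using csuc_inter[OF i] t by (metis IntI imageI singletonD)
  then have "\<gamma> i t = \<gamma> i 1" "\<gamma> (csuc m i) u = \<gamma> (csuc m i) 0"
    using arc(3)[OF i] csuc[OF i] t by auto
  then show "t = 1" "u = 0"
    using inj_onD[OF arc(4)[OF i], of t 1] inj_onD[OF arc(4)[OF csuc(1)[OF i]], of u 0] t by auto
qed

lemma meet:
  assumes i: "i \<in> {1..m}" and j: "j \<in> {1..m}" and "i \<noteq> j"
    and t: "t \<in> {0..1}" "u \<in> {0..1}" "\<gamma> i t = \<gamma> j u"
  shows "j = csuc m i \<and> t = 1 \<and> u = 0 \<or> i = csuc m j \<and> t = 0 \<and> u = 1"
proof -
  have "j = csuc m i \<or> i = csuc m j"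
  proof (rule ccontr)
    assume "\<not> ?thesis"
    then have "\<gamma> i ` {0..1} \<inter> \<gamma> j ` {0..1} = {}"
      using pc i j \<open>i \<noteq> j\<close> unfolding piecewise_C2_no_concave_def by blast
    then show False using t by (metis disjoint_iff imageI)
  qed
  then show ?thesis using csuc_meet[OF i, of t u] csuc_meet[OF j, of u t] t by auto
qed

text \<open>This makes the choices in \<open>outward_normal\<close> and \<open>curvature\<close>
  unambiguous: a point inside an arc determines the arc and the parameter.\<close>

lemma interior_unique:
  assumes "i \<in> {1..m}" "j \<in> {1..m}" "t \<in> {0<..<1}" "u \<in> {0..1}" "\<gamma> i t = \<gamma> j u"
  shows "j = i \<and> u = t"
proof (cases "i = j")
  case True
  then show ?thesis using assms arc(4)[of i] by (auto dest: inj_onD)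
next
  case False
  then show ?thesis using meet[OF assms(1,2) False, of t u] assms by auto
qed

lemma not_corner: 
  assumes "i \<in> {1..m}" "t \<in> {0<..<1}"
  shows "\<gamma> i t \<in> frontier \<Omega> - corners m y"
proof -
  have False if "j \<in> {1..m}" "\<gamma> i t = y j" for j
    using interior_unique[OF assms(1) that(1) assms(2), of 1] arc(3)[OF that(1)] that(2) assms(2) by auto
  moreover have "t \<in> {0..1}" using assms by auto
  ultimately show ?thesis using in_frontier[OF assms(1)] unfolding corners_def by blast
qed

lemma endpoints_corner: "i \<in> {1..m} \<Longrightarrow> \<gamma> i 0 \<in> corners m y" "i \<in> {1..m} \<Longrightarrow> \<gamma> i 1 \<in> corners m y"
proof -
  assume i: "i \<in> {1..m}"
  show "\<gamma> i 1 \<in> corners m y" using arc(3)[OF i] i by (auto simp: corners_def)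
  show "\<gamma> i 0 \<in> corners m y"
  proof (cases "i = 1")
    case True then show ?thesis using arc(2)[OF i] y_0 m_ge_1 by (auto simp: corners_def)
  next
    case False
    then have "i - 1 \<in> {1..m}" using i by auto
    then show ?thesis unfolding arc(2)[OF i] corners_def by blast
  qed
qed

lemma not_corner_obtain:
  assumes "z \<in> frontier \<Omega> - corners m y"
  obtains i t where "i \<in> {1..m}" "t \<in> {0<..<1}" "z = \<gamma> i t"
proof -
  from assms obtain i t where it: "i \<in> {1..m}" "t \<in> {0..1}" "z = \<gamma> i t"
    unfolding frontier_eq by auto
  have "t \<noteq> 0" "t \<noteq> 1" using endpoints_corner[OF it(1)] assms it by auto
  then show thesis using that[of i t] it by auto
qed

text \<open>The parts of the arcs with parameters outside the sets \<open>U j\<close> form a compact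
  set that misses \<open>z\<close>, hence it misses a ball about \<open>z\<close>. An empty
  \<open>U j\<close> discards a whole arc.\<close>

lemma frontier_local:
  assumes op: "\<And>j. open (U j)"
    and U: "\<And>j t. j \<in> {1..m} \<Longrightarrow> t \<in> {0..1} \<Longrightarrow> \<gamma> j t = z \<Longrightarrow> t \<in> U j"
  shows "\<exists>\<rho>>0. frontier \<Omega> \<inter> ball z \<rho> \<subseteq> (\<Union>j\<in>{1..m}. \<gamma> j ` ({0..1} \<inter> U j))"
proof -
  define X where "X = (\<Union>j\<in>{1..m}. \<gamma> j ` ({0..1} - U j))"
  have "compact (\<gamma> j ` ({0..1} - U j))" if "j \<in> {1..m}" for j
    by (intro compact_continuous_image continuous_on_subset[OF cont_\<gamma>[OF that]] compact_diff op) auto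
  then have "compact X" unfolding X_def by (intro compact_UN) auto
  moreover have "z \<notin> X" using U unfolding X_def by auto
  ultimately obtain \<rho> where "\<rho> > 0" "ball z \<rho> \<subseteq> - X"
    by (metis ComplI compact_imp_closed open_Compl openE)
  moreover from this have "frontier \<Omega> \<inter> ball z \<rho> \<subseteq> (\<Union>j\<in>{1..m}. \<gamma> j ` ({0..1} \<inter> U j))"
    unfolding frontier_eq X_def by blast
  ultimately show ?thesis by blast
qed

lemma ext_sphere:
  assumes "z \<in> frontier \<Omega>"
  obtains r p where "r > 0" "dist p z = r" "ball p r \<inter> \<Omega> = {}"
proof -
  have "uniform_exterior_sphere \<Omega>" using pc unfolding piecewise_C2_no_concave_def by (rule conjunct1)
  with assms that show thesis unfolding uniform_exterior_sphere_def by fast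
qed

text \<open>The two conditions on \<open>v\<close> single out the correct one of the two unit
  normals, and later decide which rays enter \<Omega> and which leave it.\<close>

lemma arc_side:
  assumes i: "i \<in> {1..m}" and t0: "t0 \<in> {0<..<1}"
  shows "\<exists>N. (N = rot (T i t0) \<or> N = - rot (T i t0)) \<and>
    (\<forall>v. v \<bullet> N < 0 \<longrightarrow> (\<forall>\<^sub>F s in at_right 0. \<gamma> i t0 + s *\<^sub>R v \<in> \<Omega>)) \<and>
    (\<forall>v. v \<bullet> N > 0 \<longrightarrow> (\<forall>\<^sub>F s in at_right 0. \<gamma> i t0 + s *\<^sub>R v \<notin> \<Omega>))"
proof -
  define c where "c s = \<gamma> i (t0 + s)" for s
  define z where "z = \<gamma> i t0"
  have t01: "t0 \<in> {0..1}" using t0 by auto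
  have nT: "norm (T i t0) = 1" using norm_T[OF i t01] .
  have "D i t0 \<bullet> T i t0 > 0" using D_inner_T norm_D_pos[OF i t01] by simp
  from projection_strict_mono[OF has_D[OF i] cont_D[OF i] t01 this]
  obtain d where d: "d > 0" "\<And>s t. s \<in> {0..1} \<Longrightarrow> t \<in> {0..1} \<Longrightarrow> \<bar>s - t0\<bar> \<le> d \<Longrightarrow> \<bar>t - t0\<bar> \<le> d \<Longrightarrow>
      s < t \<Longrightarrow> \<gamma> i s \<bullet> T i t0 < \<gamma> i t \<bullet> T i t0" by blast
  define a where "a = min d (min t0 (1 - t0))"
  have a: "a > 0" "a \<le> d" "a \<le> t0" "a \<le> 1 - t0" using d t0 by (auto simp: a_def)
  \<comment> \<open>Only arc \<open>i\<close> passes through \<open>z\<close>, so the other arcs get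
    an empty parameter set.\<close>
  have *: "\<exists>\<rho>>0. frontier \<Omega> \<inter> ball z \<rho> \<subseteq>
     (\<Union>j\<in>{1..m}. \<gamma> j ` ({0..1} \<inter> (if j = i then {t0 - a<..<t0 + a} else {})))"
  proof (rule frontier_local)
    fix j t assume "j \<in> {1..m}" "t \<in> {0..1}" "\<gamma> j t = z"
    then have "j = i \<and> t = t0" using interior_unique[OF i _ t0, of j t] by (auto simp: z_def)
    then show "t \<in> (if j = i then {t0 - a<..<t0 + a} else {})" using a by auto
  qed auto
  obtain \<rho> where \<rho>: "\<rho> > 0" and "frontier \<Omega> \<inter> ball z \<rho> \<subseteq> \<gamma> i ` {t0 - a<..<t0 + a}"
  proof -
    from * obtain \<rho> where \<rho>: "\<rho> > 0" and "frontier \<Omega> \<inter> ball z \<rho> \<subseteq>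
      (\<Union>j\<in>{1..m}. \<gamma> j ` ({0..1} \<inter> (if j = i then {t0 - a<..<t0 + a} else {})))"
      by (elim exE conjE)
    moreover have "(\<Union>j\<in>{1..m}. \<gamma> j ` ({0..1} \<inter> (if j = i then {t0 - a<..<t0 + a} else {})))
      \<subseteq> \<gamma> i ` {t0 - a<..<t0 + a}" by (auto split: if_splits)
    ultimately have "frontier \<Omega> \<inter> ball z \<rho> \<subseteq> \<gamma> i ` {t0 - a<..<t0 + a}" by (meson order_trans)
    with \<rho> show ?thesis by (rule that)
  qed
  then have \<rho>2: "frontier \<Omega> \<inter> ball z \<rho> \<subseteq> c ` {-a..a}"
  proof -
    have "\<gamma> i ` {t0 - a<..<t0 + a} \<subseteq> c ` {-a..a}"
    proof
      fix x assume "x \<in> \<gamma> i ` {t0 - a<..<t0 + a}"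
      then obtain t where "x = \<gamma> i t" "t \<in> {t0 - a<..<t0 + a}" by blast
      then show "x \<in> c ` {-a..a}" by (intro image_eqI[of _ _ "t - t0"]) (auto simp: c_def)
    qed
    with \<open>frontier \<Omega> \<inter> ball z \<rho> \<subseteq> _\<close> show ?thesis by blast
  qed
  obtain r p where ext: "r > 0" "dist p z = r" "ball p r \<inter> \<Omega> = {}"
    unfolding z_def by (rule ext_sphere[OF in_frontier[OF i t01]])
  show ?thesis
  proof (rule local_side[OF _ opn nT a(1) _ _ _ _ \<rho> \<rho>2 _ ext(2,1,3)])
    show "z \<in> frontier \<Omega>" unfolding z_def by (rule in_frontier[OF i t01])
    show "continuous_on {- a..a} c" unfolding c_def
      by (rule continuous_on_compose2[OF cont_\<gamma>[OF i]]) (use a in \<open>auto intro!: continuous_intros\<close>)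
    show "c 0 = z" by (simp add: c_def z_def)
    show "c s \<bullet> T i t0 < c t \<bullet> T i t0" if "-a \<le> s" "s < t" "t \<le> a" for s t
      unfolding c_def by (rule d(2)) (use that a in auto)
    show "c ` {- a..a} \<subseteq> frontier \<Omega>" using a in_frontier[OF i] by (auto simp: c_def)
    show "\<exists>d>0. \<forall>t. \<bar>t\<bar> < d \<longrightarrow> \<bar>t\<bar> \<le> a \<longrightarrow> \<bar>(c t - z) \<bullet> rot (T i t0)\<bar> \<le> e * \<bar>(c t - z) \<bullet> T i t0\<bar>"
      if e: "e > 0" for e
    proof -
      obtain d where d: "d > 0" "\<And>t. t \<in> {0..1} \<Longrightarrow> \<bar>t - t0\<bar> < d \<Longrightarrow>
          \<bar>(\<gamma> i t - \<gamma> i t0) \<bullet> rot (T i t0)\<bar> \<le> e * \<bar>(\<gamma> i t - \<gamma> i t0) \<bullet> T i t0\<bar>"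
        using tangency[of "\<gamma> i" "norm (D i t0)" "T i t0" t0 "{0..1}" e] has_D[OF i t01] D_eq[of i t0]
          D_nz[OF i t01] nT e by auto
      have "\<bar>(c t - z) \<bullet> rot (T i t0)\<bar> \<le> e * \<bar>(c t - z) \<bullet> T i t0\<bar>" if "\<bar>t\<bar> < d" "\<bar>t\<bar> \<le> a" for t
        unfolding c_def z_def by (rule d(2)) (use that a in auto)
      then show ?thesis using d(1) by blast
    qed
  qed (unfold z_def, blast)
qed

end

section \<open>Normals, curvature and the Minkowski formula\<close>

text \<open>Differentiating the factor \<open>1 / norm (f t)\<close> removes exactly the component
  of \<open>f'\<close> along \<open>T\<close>, which leaves the one along
  \<open>rot T\<close>.\<close>

lemma sgn_has_vector_derivative:
  fixes f :: "real \<Rightarrow> real^2"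
  assumes f: "(f has_vector_derivative f') (at t within S)" and nz: "f t \<noteq> 0"
  defines "T \<equiv> sgn (f t)"
  shows "((\<lambda>t. sgn (f t)) has_vector_derivative ((f' \<bullet> rot T) / norm (f t)) *\<^sub>R rot T) (at t within S)"
proof -
  have nT: "norm T = 1" using nz by (simp add: T_def norm_sgn)
  have fT: "f t = norm (f t) *\<^sub>R T" using nz by (simp add: T_def sgn_div_norm)
  have "((\<lambda>t. norm (f t)) has_derivative (\<lambda>h. (h *\<^sub>R f') \<bullet> T)) (at t within S)"
    using has_derivative_compose[OF f[unfolded has_vector_derivative_def] has_derivative_norm[OF nz]]
    by (simp add: T_def inner_commute)
  then have n: "((\<lambda>t. norm (f t)) has_real_derivative f' \<bullet> T) (at t within S)"
    unfolding has_field_derivative_def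
    by (rule has_derivative_eq_rhs) (simp add: fun_eq_iff)
  have i: "((\<lambda>t. inverse (norm (f t))) has_real_derivative - (f' \<bullet> T) / (norm (f t))\<^sup>2) (at t within S)"
    using DERIV_inverse_fun[OF n] nz by (simp add: field_simps power2_eq_square)
  have "((\<lambda>t. inverse (norm (f t)) *\<^sub>R f t) has_vector_derivative
      inverse (norm (f t)) *\<^sub>R f' + (- (f' \<bullet> T) / (norm (f t))\<^sup>2) *\<^sub>R f t) (at t within S)"
    by (rule has_vector_derivative_scaleR[OF i f])
  moreover have "inverse (norm (f t)) *\<^sub>R f' + (- (f' \<bullet> T) / (norm (f t))\<^sup>2) *\<^sub>R f t
      = ((f' \<bullet> rot T) / norm (f t)) *\<^sub>R rot T"
  proof -
    have "(- (f' \<bullet> T) / (norm (f t))\<^sup>2) *\<^sub>R f t = (- (f' \<bullet> T) / norm (f t)) *\<^sub>R T"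
      by (subst (2) fT) (use nz in \<open>simp add: power2_eq_square\<close>)
    moreover have "inverse (norm (f t)) *\<^sub>R f' = ((f' \<bullet> T) / norm (f t)) *\<^sub>R T + ((f' \<bullet> rot T) / norm (f t)) *\<^sub>R rot T"
      by (subst rot_decomp[OF nT, of f']) (simp add: scaleR_add_right divide_inverse mult.commute)
    ultimately show ?thesis by simp
  qed
  ultimately show ?thesis by (simp add: sgn_div_norm)
qed

context piecewise_domain
begin

text \<open>The normal found in \<open>arc_side\<close> satisfies the defining predicate, and only
  its negative could compete; that one fails, since a ray cannot both stay in \<Omega> and leave it
  near its origin.\<close>

lemma outward_normal:
  assumes i: "i \<in> {1..m}" and t: "t \<in> {0<..<1}"
  defines "\<nu> \<equiv> outward_normal \<Omega> m \<gamma> (\<gamma> i t)"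
  shows normal_cases: "\<nu> = rot (T i t) \<or> \<nu> = - rot (T i t)"
    and normal_in: "\<And>v. v \<bullet> \<nu> < 0 \<Longrightarrow> \<forall>\<^sub>F s in at_right 0. \<gamma> i t + s *\<^sub>R v \<in> \<Omega>"
    and normal_out: "\<And>v. v \<bullet> \<nu> > 0 \<Longrightarrow> \<forall>\<^sub>F s in at_right 0. \<gamma> i t + s *\<^sub>R v \<notin> \<Omega>"
proof -
 obtain N where N: "N = rot (T i t) \<or> N = - rot (T i t)"
    "\<And>v. v \<bullet> N < 0 \<Longrightarrow> \<forall>\<^sub>F s in at_right 0. \<gamma> i t + s *\<^sub>R v \<in> \<Omega>"
    "\<And>v. v \<bullet> N > 0 \<Longrightarrow> \<forall>\<^sub>F s in at_right 0. \<gamma> i t + s *\<^sub>R v \<notin> \<Omega>"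
    using arc_side[OF i t] by (elim exE conjE) simp
  have t01: "t \<in> {0..1}" using t by auto
  have nT: "norm (T i t) = 1" by (rule norm_T[OF i t01])
  have nN: "norm N = 1" using N(1) nT by auto
  then have NN: "N \<bullet> N = 1" by (simp add: norm_eq_1)
  have ND: "N \<bullet> D i t = 0" using N(1) by (subst D_eq) auto
  let ?P = "\<lambda>n. \<exists>j\<in>{1..m}. \<exists>u\<in>{0<..<1}. \<gamma> j u = \<gamma> i t \<and>
       norm n = 1 \<and> n \<bullet> vector_derivative (\<gamma> j) (at u) = 0 \<and>
       (\<forall>\<^sub>F s in at_right 0. \<gamma> i t - s *\<^sub>R n \<in> \<Omega>)"
  have "(SOME n. ?P n) = N"
  proof (rule some_equality)
    have "\<forall>\<^sub>F s in at_right 0. \<gamma> i t + s *\<^sub>R (- N) \<in> \<Omega>" by (rule N(2)) (simp add: NN)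
    then show "?P N" using i t nN ND vd1[OF i t] by (intro bexI[of _ i] bexI[of _ t]) auto
  next
    fix n assume "?P n"
    then obtain j u where j: "j \<in> {1..m}" and u: "u \<in> {0<..<1}" and e: "\<gamma> j u = \<gamma> i t"
      and n1: "norm n = 1" and n0: "n \<bullet> vector_derivative (\<gamma> j) (at u) = 0" and
      ev: "\<forall>\<^sub>F s in at_right 0. \<gamma> i t - s *\<^sub>R n \<in> \<Omega>" by blast
    have "j = i \<and> t = u" using interior_unique[OF j i u t01 e] by auto
    then have "n \<bullet> D i t = 0" using n0 vd1[OF i t] by simp
    then have "n \<bullet> T i t = 0" using D_nz[OF i t01] by (simp add: T_def sgn_div_norm)
    then have "n = rot (T i t) \<or> n = - rot (T i t)" using unit_orth_cases[OF nT n1] by blast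
    then have "n = N \<or> n = - N" using N(1) by auto
    moreover have "n \<noteq> - N"
    proof
      assume "n = - N"
      then have "\<forall>\<^sub>F s in at_right 0. \<gamma> i t + s *\<^sub>R N \<in> \<Omega>" using ev by simp
      moreover have "\<forall>\<^sub>F s in at_right 0. \<gamma> i t + s *\<^sub>R N \<notin> \<Omega>" by (rule N(3)) (simp add: NN)
      ultimately have "\<forall>\<^sub>F s in at_right (0::real). False" by eventually_elim auto
      then show False by simp
    qed
    ultimately show "n = N" by blast
  qed
  then have "\<nu> = N" unfolding \<nu>_def outward_normal_def .
  then show "\<nu> = rot (T i t) \<or> \<nu> = - rot (T i t)"
    "\<And>v. v \<bullet> \<nu> < 0 \<Longrightarrow> \<forall>\<^sub>F s in at_right 0. \<gamma> i t + s *\<^sub>R v \<in> \<Omega>"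
    "\<And>v. v \<bullet> \<nu> > 0 \<Longrightarrow> \<forall>\<^sub>F s in at_right 0. \<gamma> i t + s *\<^sub>R v \<notin> \<Omega>"
    using N by auto
qed

lemma curvature_eq:
  assumes i: "i \<in> {1..m}" and t: "t \<in> {0<..<1}"
  shows "curvature \<Omega> m \<gamma> (\<gamma> i t) = - (DD i t \<bullet> outward_normal \<Omega> m \<gamma> (\<gamma> i t)) / (norm (D i t))\<^sup>2"
  unfolding curvature_def
proof (rule some_equality)
  show "\<exists>j\<in>{1..m}. \<exists>u\<in>{0<..<1}. \<gamma> j u = \<gamma> i t \<and>
      - (DD i t \<bullet> outward_normal \<Omega> m \<gamma> (\<gamma> i t)) / (norm (D i t))\<^sup>2 =
      - (vector_derivative (\<lambda>s. vector_derivative (\<gamma> j) (at s)) (at u) \<bullet> outward_normal \<Omega> m \<gamma> (\<gamma> i t)) /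
        (norm (vector_derivative (\<gamma> j) (at u)))\<^sup>2"
    using vd1[OF i t] vd2[OF i t] i t by (intro bexI[of _ i] bexI[of _ t]) auto
next
  fix k
  assume "\<exists>j\<in>{1..m}. \<exists>u\<in>{0<..<1}. \<gamma> j u = \<gamma> i t \<and>
      k = - (vector_derivative (\<lambda>s. vector_derivative (\<gamma> j) (at s)) (at u) \<bullet> outward_normal \<Omega> m \<gamma> (\<gamma> i t)) /
        (norm (vector_derivative (\<gamma> j) (at u)))\<^sup>2"
  then obtain j u where j: "j \<in> {1..m}" and u: "u \<in> {0<..<1}" and e: "\<gamma> j u = \<gamma> i t" and
     k: "k = - (vector_derivative (\<lambda>s. vector_derivative (\<gamma> j) (at s)) (at u) \<bullet> outward_normal \<Omega> m \<gamma> (\<gamma> i t)) /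
        (norm (vector_derivative (\<gamma> j) (at u)))\<^sup>2" by blast
  have "j = i \<and> t = u" using interior_unique[OF j i u _ e] t by auto
  then show "k = - (DD i t \<bullet> outward_normal \<Omega> m \<gamma> (\<gamma> i t)) / (norm (D i t))\<^sup>2"
    using k vd1[OF i t] vd2[OF i t] by simp
qed

text \<open>The two-sided derivatives in \<open>perimeter\<close> can differ from \<open>D\<close>
  only at the parameters 0 and 1, a null set.\<close>

lemma perimeter_eq: "perimeter m \<gamma> = (\<Sum>i=1..m. integral {0..1} (\<lambda>t. norm (D i t)))"
  unfolding perimeter_def
proof (rule sum.cong[OF refl])
  fix i assume i: "i \<in> {1..m}"
  show "integral {0..1} (\<lambda>t. norm (vector_derivative (\<gamma> i) (at t))) = integral {0..1} (\<lambda>t. norm (D i t))"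
    by (rule integral_spike[of "{0,1}"]) (use vd1[OF i] in \<open>auto simp: less_le\<close>)
qed

lemma T_deriv:
  assumes i: "i \<in> {1..m}" and t: "t \<in> {0..1}"
  shows "(T i has_vector_derivative ((DD i t \<bullet> rot (T i t)) / norm (D i t)) *\<^sub>R rot (T i t)) (at t within {0..1})"
  unfolding T_def[abs_def] by (rule sgn_has_vector_derivative[OF has_DD[OF i t] D_nz[OF i t]])

end

locale starshaped_domain = piecewise_domain +
  assumes star: "\<forall>z\<in>frontier \<Omega> - corners m y. z \<bullet> outward_normal \<Omega> m \<gamma> z > 0"
begin

text \<open>Starshapedness keeps \<open>\<langle>\<gamma>, rot T\<rangle>\<close> from vanishing inside an arc, so the outward normal is a fixed
  sign times \<open>rot T\<close>. This extends it, and the curvature, continuously to the endpoints.\<close>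
definition eps :: "nat \<Rightarrow> real" where
  "eps i = (if \<gamma> i (1/2) \<bullet> rot (T i (1/2)) > 0 then 1 else -1)"

definition nu :: "nat \<Rightarrow> real \<Rightarrow> real^2" where
  "nu i t = eps i *\<^sub>R rot (T i t)"

definition kappa :: "nat \<Rightarrow> real \<Rightarrow> real" where
  "kappa i t = - (DD i t \<bullet> nu i t) / (norm (D i t))\<^sup>2"

text \<open>The support function times the speed: the density of twice the area swept by the radius
  vector, and the weight of the curvature in the integral formula.\<close>

definition w :: "nat \<Rightarrow> real \<Rightarrow> real" where
  "w i t = (\<gamma> i t \<bullet> nu i t) * norm (D i t)"

lemma eps_cases: "eps i = 1 \<or> eps i = -1"
  by (simp add: eps_def)

lemma eps_eps [simp]: "eps i * eps i = 1"
  using eps_cases[of i] by auto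

lemma normal_eq:
  assumes i: "i \<in> {1..m}" and t: "t \<in> {0<..<1}"
  shows "outward_normal \<Omega> m \<gamma> (\<gamma> i t) = nu i t" and "\<gamma> i t \<bullet> nu i t > 0"
proof -
  have st: "\<gamma> i s \<bullet> outward_normal \<Omega> m \<gamma> (\<gamma> i s) > 0" if "s \<in> {0<..<1}" for s
    using star not_corner[OF i that] by blast
  define g where "g s = \<gamma> i s \<bullet> nu i s" for s
  have nz: "g s \<noteq> 0" if "s \<in> {0<..<1}" for s
    using st[OF that] normal_cases[OF i that] eps_cases[of i] by (auto simp: g_def nu_def)
  have cg: "continuous_on {0<..<1} g" unfolding g_def nu_def
    by (intro continuous_intros continuous_on_subset[OF cont_\<gamma>[OF i]] continuous_on_subset[OF cont_T[OF i]]) auto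
  have half: "(1/2::real) \<in> {0<..<1}" by simp
  have "g (1/2) \<ge> 0" by (auto simp: g_def nu_def eps_def)
  then have gh: "g (1/2) > 0" using nz[OF half] by simp
  have gt: "g t > 0"
  proof (rule ccontr)
    assume "\<not> g t > 0"
    then have "g t \<le> 0" by simp
    moreover have "connected (g ` {0<..<1})" by (intro connected_continuous_image cg) simp
    ultimately have "0 \<in> g ` {0<..<1}"
      using t half gh by (intro connectedD_interval[of _ "g t" "g (1/2)" 0]) auto
    then show False using nz by auto
  qed
  then show "\<gamma> i t \<bullet> nu i t > 0" by (simp add: g_def)
  then show "outward_normal \<Omega> m \<gamma> (\<gamma> i t) = nu i t"
    using st[OF t] normal_cases[OF i t] eps_cases[of i] by (auto simp: nu_def)
qed

lemma curvature_kappa: "i \<in> {1..m} \<Longrightarrow> t \<in> {0<..<1} \<Longrightarrow> curvature \<Omega> m \<gamma> (\<gamma> i t) = kappa i t"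
  by (simp only: curvature_eq normal_eq kappa_def)

lemma norm_nu: "i \<in> {1..m} \<Longrightarrow> t \<in> {0..1} \<Longrightarrow> norm (nu i t) = 1"
  using norm_T[of i t] eps_cases[of i] by (auto simp: nu_def)

lemma cont_nu: "i \<in> {1..m} \<Longrightarrow> continuous_on {0..1} (nu i)"
  unfolding nu_def[abs_def] by (intro continuous_intros cont_T)

lemma cont_kappa: "i \<in> {1..m} \<Longrightarrow> continuous_on {0..1} (kappa i)"
  unfolding kappa_def[abs_def] by (intro continuous_intros cont_DD cont_nu cont_D) (use D_nz in auto)

lemma cont_w: "i \<in> {1..m} \<Longrightarrow> continuous_on {0..1} (w i)"
  unfolding w_def[abs_def] by (intro continuous_intros cont_\<gamma> cont_nu cont_D)

lemma w_pos: "i \<in> {1..m} \<Longrightarrow> t \<in> {0<..<1} \<Longrightarrow> w i t > 0"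
  unfolding w_def using normal_eq(2)[of i t] norm_D_pos[of i t] by auto

lemma w_nonneg: 
  assumes "i \<in> {1..m}" "t \<in> {0..1}" 
  shows "w i t \<ge> 0"
  by (rule continuous_ge_on_Ioo[OF cont_w[OF assms(1)], of 0 t]) (use assms w_pos[OF assms(1)] in \<open>auto intro: less_imp_le\<close>)

text \<open>The Weingarten equation; the sign \<open>eps\<close> enters twice and squares away. Both
  the constancy of the centers of curvature and the Jacobian of the normal segments rest on
  it.\<close>

lemma nu_deriv:
  assumes i: "i \<in> {1..m}" and t: "t \<in> {0..1}"
  shows "(nu i has_vector_derivative kappa i t *\<^sub>R D i t) (at t within {0..1})"
proof -
  have "((\<lambda>t. eps i *\<^sub>R rot (T i t)) has_vector_derivative
      eps i *\<^sub>R rot (((DD i t \<bullet> rot (T i t)) / norm (D i t)) *\<^sub>R rot (T i t))) (at t within {0..1})"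
    by (intro bounded_linear.has_vector_derivative[OF bounded_linear_scaleR_right]
        bounded_linear.has_vector_derivative[OF rot_bounded_linear] T_deriv[OF i t])
  moreover have "eps i *\<^sub>R rot (((DD i t \<bullet> rot (T i t)) / norm (D i t)) *\<^sub>R rot (T i t)) = kappa i t *\<^sub>R D i t"
    using D_nz[OF i t] by (subst (2) D_eq) (simp add: kappa_def nu_def rot_scaleR power2_eq_square)
  ultimately show ?thesis unfolding nu_def[abs_def] by simp
qed

text \<open>The derivative of \<open>\<langle>\<gamma>, T\<rangle>\<close> with respect to arc length is \<open>1 - \<kappa> \<langle>\<gamma>, \<nu>\<rangle>\<close>.\<close>
lemma minkowski_arc:
  assumes i: "i \<in> {1..m}"
  shows "((\<lambda>t. norm (D i t) - kappa i t * w i t) has_integral (\<gamma> i 1 \<bullet> T i 1 - \<gamma> i 0 \<bullet> T i 0)) {0..1}"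
proof (rule fundamental_theorem_of_calculus)
  fix t :: real assume t: "t \<in> {0..1}"
  have "((\<lambda>t. \<gamma> i t \<bullet> T i t) has_vector_derivative
     (\<gamma> i t \<bullet> (((DD i t \<bullet> rot (T i t)) / norm (D i t)) *\<^sub>R rot (T i t)) + D i t \<bullet> T i t)) (at t within {0..1})"
    by (rule bounded_bilinear.has_vector_derivative[OF bounded_bilinear_inner has_D[OF i t] T_deriv[OF i t]])
  moreover have "\<gamma> i t \<bullet> (((DD i t \<bullet> rot (T i t)) / norm (D i t)) *\<^sub>R rot (T i t)) + D i t \<bullet> T i t
      = norm (D i t) - kappa i t * w i t"
  proof -
    have "kappa i t * w i t = - (eps i * eps i) * ((DD i t \<bullet> rot (T i t)) * (\<gamma> i t \<bullet> rot (T i t))) / norm (D i t)"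
      using D_nz[OF i t] by (simp add: kappa_def w_def nu_def power2_eq_square field_simps del: eps_eps)
    then show ?thesis by (simp add: D_inner_T)
  qed
  ultimately show "((\<lambda>t. \<gamma> i t \<bullet> T i t) has_vector_derivative norm (D i t) - kappa i t * w i t) (at t within {0..1})"
    by simp
qed simp

lemma sum_cyclic:
  fixes f :: "nat \<Rightarrow> real"
  shows "(\<Sum>i=1..m. f (csuc m i)) = (\<Sum>i=1..m. f i)"
proof -
  have "bij_betw (csuc m) {1..m} {1..m}"
  proof (rule bij_betw_byWitness[where f' = "\<lambda>i. if i = 1 then m else i - 1"])
    show "csuc m ` {1..m} \<subseteq> {1..m}" using csuc(1) by auto
  qed (use m_ge_3 in \<open>auto simp: csuc_def\<close>)
  then show ?thesis by (rule sum.reindex_bij_betw)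
qed

text \<open>Where the tangents agree at each corner, the boundary terms of consecutive arcs cancel
  around the cycle.\<close>

lemma minkowski:
  assumes C1: "\<And>i. i \<in> {1..m} \<Longrightarrow> T i 1 = T (csuc m i) 0"
  shows "(\<Sum>i=1..m. integral {0..1} (\<lambda>t. kappa i t * w i t)) = perimeter m \<gamma>"
proof -
  have kw: "(\<lambda>t. kappa i t * w i t) integrable_on {0..1}" if "i \<in> {1..m}" for i
    by (intro integrable_continuous_interval continuous_intros cont_kappa cont_w that)
  have nD: "(\<lambda>t. norm (D i t)) integrable_on {0..1}" if "i \<in> {1..m}" for i
    by (intro integrable_continuous_interval continuous_intros cont_D that)
  have "perimeter m \<gamma> - (\<Sum>i=1..m. integral {0..1} (\<lambda>t. kappa i t * w i t))
      = (\<Sum>i=1..m. integral {0..1} (\<lambda>t. norm (D i t) - kappa i t * w i t))"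
    unfolding perimeter_eq sum_subtractf[symmetric]
    by (intro sum.cong refl) (simp add: integral_diff[OF nD kw])
  also have "\<dots> = (\<Sum>i=1..m. \<gamma> i 1 \<bullet> T i 1 - \<gamma> i 0 \<bullet> T i 0)"
    by (intro sum.cong refl integral_unique minkowski_arc)
  also have "\<dots> = (\<Sum>i=1..m. \<gamma> (csuc m i) 0 \<bullet> T (csuc m i) 0) - (\<Sum>i=1..m. \<gamma> i 0 \<bullet> T i 0)"
    unfolding sum_subtractf using C1 csuc(3) arc(3) by simp
  also have "\<dots> = 0" using sum_cyclic[of "\<lambda>i. \<gamma> i 0 \<bullet> T i 0"] by simp
  finally show ?thesis by simp
qed

end

section \<open>Corners and constant curvature\<close>

text \<open>The outside of the closed ball and the open ball are connected and free of frontier, so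
  each lies in \<Omega> or misses it. Boundedness excludes the outside; the dimension enters because
  the outside has to be connected.\<close>

lemma frontier_subset_sphere_imp_ball:
  fixes \<Omega> :: "'a::euclidean_space set"
  assumes "open \<Omega>" "connected \<Omega>" "bounded \<Omega>" "\<Omega> \<noteq> {}" "DIM('a) \<ge> 2"
    and fr: "frontier \<Omega> \<subseteq> sphere p R"
  shows "\<Omega> = ball p R"
proof -
  have "connected (- cball p R)" by (intro connected_complement_bounded_convex) (use assms in auto)
  moreover have "- cball p R \<inter> frontier \<Omega> = {}" using fr by auto
  ultimately have "- cball p R \<subseteq> \<Omega> \<or> - cball p R \<inter> \<Omega> = {}" by (rule connected_frontier_free)
  moreover have "\<not> - cball p R \<subseteq> \<Omega>"
    using assms bounded_subset cobounded_imp_unbounded[of "cball p R"] bounded_cball by blast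
  ultimately have "\<Omega> \<subseteq> cball p R" by blast
  then have "\<Omega> \<subseteq> interior (cball p R)" using \<open>open \<Omega>\<close> by (rule interior_maximal)
  then have sub: "\<Omega> \<subseteq> ball p R" by simp
  have "ball p R \<inter> frontier \<Omega> = {}" using fr by auto
  then have "ball p R \<subseteq> \<Omega> \<or> ball p R \<inter> \<Omega> = {}" by (intro connected_frontier_free) auto
  then show ?thesis using sub \<open>\<Omega> \<noteq> {}\<close> by blast
qed

context piecewise_domain
begin

section \<open>The boundary near a corner\<close>

lemma corner_point_preimage:
  assumes i: "i \<in> {1..m}" and j: "j \<in> {1..m}" and t: "t \<in> {0..1}" and e: "\<gamma> j t = y i"
  shows "j = i \<and> t = 1 \<or> j = csuc m i \<and> t = 0"
proof (cases "j = i")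
  case True
  then have "\<gamma> i t = \<gamma> i 1" using e arc(3)[OF i] by simp
  then show ?thesis using inj_onD[OF arc(4)[OF i], of t 1] t True by auto
next
  case False
  have "\<gamma> i 1 = \<gamma> j t" using e arc(3)[OF i] by simp
  then show ?thesis using meet[OF i j, of 1 t] False t by auto
qed

lemma corner_frontier_local:
  assumes i: "i \<in> {1..m}" and "a > 0"
  shows "\<exists>\<rho>>0. frontier \<Omega> \<inter> ball (y i) \<rho> \<subseteq>
    \<gamma> i ` ({0..1} \<inter> {1-a<..}) \<union> \<gamma> (csuc m i) ` ({0..1} \<inter> {..<a})"
proof -
  let ?U = "\<lambda>j. if j = i then {1-a<..} else if j = csuc m i then {..<a} else {}"
  have "\<exists>\<rho>>0. frontier \<Omega> \<inter> ball (y i) \<rho> \<subseteq> (\<Union>j\<in>{1..m}. \<gamma> j ` ({0..1} \<inter> ?U j))"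
  proof (rule frontier_local)
    fix j t assume "j \<in> {1..m}" "t \<in> {0..1}" "\<gamma> j t = y i"
    then show "t \<in> ?U j" using corner_point_preimage[OF i, of j t] csuc(2)[OF i] \<open>a > 0\<close> by auto
  qed auto
  moreover have "(\<Union>j\<in>{1..m}. \<gamma> j ` ({0..1} \<inter> ?U j)) \<subseteq>
    \<gamma> i ` ({0..1} \<inter> {1-a<..}) \<union> \<gamma> (csuc m i) ` ({0..1} \<inter> {..<a})"
  proof
    fix x assume "x \<in> (\<Union>j\<in>{1..m}. \<gamma> j ` ({0..1} \<inter> ?U j))"
    then obtain j t where "x = \<gamma> j t" "t \<in> {0..1}" "t \<in> ?U j" by blast
    then show "x \<in> \<gamma> i ` ({0..1} \<inter> {1-a<..}) \<union> \<gamma> (csuc m i) ` ({0..1} \<inter> {..<a})"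
      by (auto split: if_splits)
  qed
  ultimately show ?thesis by (meson order_trans)
qed

lemma corner_in_frontier: "i \<in> {1..m} \<Longrightarrow> y i \<in> frontier \<Omega>"
  using in_frontier[of i 1] arc(3)[of i] by simp

text \<open>The weak inequality is what survives the passage to an end of an arc, where
  \<open>outward_normal\<close> is not determined.\<close>

lemma normal_inward:
  assumes i: "i \<in> {1..m}" and t: "t \<in> {0<..<1}"
    and "\<forall>\<^sub>F s in at_right 0. \<gamma> i t - s *\<^sub>R N \<in> \<Omega>"
  shows "N \<bullet> outward_normal \<Omega> m \<gamma> (\<gamma> i t) \<ge> 0"
proof (rule ccontr)
  assume "\<not> ?thesis"
  then have "\<forall>\<^sub>F s in at_right 0. \<gamma> i t + s *\<^sub>R (- N) \<notin> \<Omega>"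
    by (intro normal_out[OF i t]) simp
  with assms(3) have "\<forall>\<^sub>F s in at_right (0::real). False" by eventually_elim simp
  then show False by simp
qed

end

context starshaped_domain
begin

text \<open>Equal tangents leave the signs \<open>eps\<close> open. After the two arcs are joined
  into one curve through the corner, \<open>local_side\<close> supplies a single vector
  \<open>N\<close> whose negative points into \<Omega> along both arcs; comparison with
  \<open>N\<close> fixes both signs.\<close>

lemma corner_normal_eq:
  assumes i: "i \<in> {1..m}" and TT: "T i 1 = T (csuc m i) 0"
  shows "nu i 1 = nu (csuc m i) 0"
proof -
  define j where "j = csuc m i"
  have j: "j \<in> {1..m}" "\<gamma> j 0 = y i" using csuc[OF i] by (auto simp: j_def)
  define T1 where "T1 = T i 1"
  have T1: "T j 0 = T1" "T i 1 = T1" "norm T1 = 1" using TT norm_T[OF i, of 1] by (auto simp: T1_def j_def)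
  define c where "c t = (if t \<le> 0 then \<gamma> i (1 + t) else \<gamma> j t)" for t
  have yi: "\<gamma> i 1 = y i" by (rule arc(3)[OF i])
  have "D i 1 \<bullet> T1 > 0" "D j 0 \<bullet> T1 > 0"
    using D_inner_T[of i 1] D_inner_T[of j 0] norm_D_pos[OF i, of 1] norm_D_pos[OF j(1), of 0] T1 by auto
  then obtain d1 d2 where d1: "d1 > 0" "\<And>s t. s \<in> {0..1} \<Longrightarrow> t \<in> {0..1} \<Longrightarrow> \<bar>s - 1\<bar> \<le> d1 \<Longrightarrow> \<bar>t - 1\<bar> \<le> d1 \<Longrightarrow>
      s < t \<Longrightarrow> \<gamma> i s \<bullet> T1 < \<gamma> i t \<bullet> T1" and
    d2: "d2 > 0" "\<And>s t. s \<in> {0..1} \<Longrightarrow> t \<in> {0..1} \<Longrightarrow> \<bar>s - 0\<bar> \<le> d2 \<Longrightarrow> \<bar>t - 0\<bar> \<le> d2 \<Longrightarrow>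
      s < t \<Longrightarrow> \<gamma> j s \<bullet> T1 < \<gamma> j t \<bullet> T1"
    using projection_strict_mono[OF has_D[OF i] cont_D[OF i], of 1 T1]
      projection_strict_mono[OF has_D[OF j(1)] cont_D[OF j(1)], of 0 T1] by auto
  define a where "a = min 1 (min d1 d2)"
  have a: "a > 0" "a \<le> 1" "a \<le> d1" "a \<le> d2" using d1 d2 by (auto simp: a_def)
  obtain \<rho> where \<rho>: "\<rho> > 0" "frontier \<Omega> \<inter> ball (y i) \<rho> \<subseteq>
    \<gamma> i ` ({0..1} \<inter> {1-a<..}) \<union> \<gamma> j ` ({0..1} \<inter> {..<a})"
    using corner_frontier_local[OF i a(1)] unfolding j_def by blast
  have \<rho>2: "frontier \<Omega> \<inter> ball (y i) \<rho> \<subseteq> c ` {-a..a}"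
  proof -
    have "x \<in> c ` {-a..a}" if x: "x \<in> \<gamma> i ` ({0..1} \<inter> {1-a<..}) \<union> \<gamma> j ` ({0..1} \<inter> {..<a})" for x
      using x
    proof
      assume "x \<in> \<gamma> i ` ({0..1} \<inter> {1-a<..})"
      then obtain t where "x = \<gamma> i t" "t \<in> {0..1} \<inter> {1-a<..}" by blast
      then show ?thesis by (intro image_eqI[of _ _ "t - 1"]) (use a in \<open>auto simp: c_def\<close>)
    next
      assume "x \<in> \<gamma> j ` ({0..1} \<inter> {..<a})"
      then obtain t where "x = \<gamma> j t" "t \<in> {0..1} \<inter> {..<a}" by blast
      then show ?thesis by (intro image_eqI[of _ _ t]) (use a yi j in \<open>auto simp: c_def\<close>)
    qed
    then show ?thesis using \<rho>(2) by blast
  qed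
  obtain r p where ext: "r > 0" "dist p (y i) = r" "ball p r \<inter> \<Omega> = {}"
    by (rule ext_sphere[OF corner_in_frontier[OF i]])
  have "\<exists>N b. (N = rot T1 \<or> N = - rot T1) \<and> b > 0 \<and>
      (\<forall>t. \<bar>t\<bar> < b \<longrightarrow> (\<forall>\<^sub>F s in at_right 0. c t - s *\<^sub>R N \<in> \<Omega>))"
  proof (rule local_side[OF corner_in_frontier[OF i] opn T1(3) a(1) _ _ _ _ \<rho>(1) \<rho>2 _ ext(2,1,3)])
    have "continuous_on ({-a..0} \<union> {0..a}) c" unfolding c_def
    proof (rule continuous_on_cases)
      show "continuous_on {- a..0} (\<lambda>t. \<gamma> i (1 + t))"
        by (rule continuous_on_compose2[OF cont_\<gamma>[OF i]]) (use a in \<open>auto intro!: continuous_intros\<close>)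
      show "continuous_on {0..a} (\<gamma> j)"
        by (rule continuous_on_subset[OF cont_\<gamma>[OF j(1)]]) (use a in auto)
    qed (use yi j in auto)
    moreover have "{-a..0} \<union> {0..a} = {-a..a}" using a by auto
    ultimately show "continuous_on {- a..a} c" by simp
    show "c 0 = y i" by (simp add: c_def yi)
    show "c s \<bullet> T1 < c t \<bullet> T1" if st: "-a \<le> s" "s < t" "t \<le> a" for s t
    proof -
      have l: "\<gamma> i (1 + u) \<bullet> T1 < \<gamma> i (1 + v) \<bullet> T1" if "-a \<le> u" "u < v" "v \<le> 0" for u v
        by (rule d1(2)) (use that a in auto)
      have r: "\<gamma> j u \<bullet> T1 < \<gamma> j v \<bullet> T1" if "0 \<le> u" "u < v" "v \<le> a" for u v
        by (rule d2(2)) (use that a in auto)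
      consider "t \<le> 0" | "s \<ge> 0" | "s < 0" "t > 0" by linarith
      then show ?thesis
      proof cases
        case 1 then show ?thesis using l[of s t] st by (simp add: c_def)
      next
        case 2
        then have "c s = \<gamma> j s" using yi j by (auto simp: c_def)
        then show ?thesis using r[of s t] st 2 by (simp add: c_def)
      next
        case 3 then show ?thesis using l[of s 0] r[of 0 t] st yi j by (simp add: c_def)
      qed
    qed
    show "c ` {- a..a} \<subseteq> frontier \<Omega>" using a in_frontier[OF i] in_frontier[OF j(1)] by (auto simp: c_def)
    show "\<exists>d>0. \<forall>t. \<bar>t\<bar> < d \<longrightarrow> \<bar>t\<bar> \<le> a \<longrightarrow> \<bar>(c t - y i) \<bullet> rot T1\<bar> \<le> e * \<bar>(c t - y i) \<bullet> T1\<bar>"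
      if e: "e > 0" for e
    proof -
      obtain d where d: "d > 0" "\<And>t. t \<in> {0..1} \<Longrightarrow> \<bar>t - 1\<bar> < d \<Longrightarrow>
          \<bar>(\<gamma> i t - \<gamma> i 1) \<bullet> rot T1\<bar> \<le> e * \<bar>(\<gamma> i t - \<gamma> i 1) \<bullet> T1\<bar>"
        using tangency[of "\<gamma> i" "norm (D i 1)" T1 1 "{0..1}" e] has_D[OF i, of 1] D_eq[of i 1]
          D_nz[OF i, of 1] T1 e by auto
      obtain d' where d': "d' > 0" "\<And>t. t \<in> {0..1} \<Longrightarrow> \<bar>t - 0\<bar> < d' \<Longrightarrow>
          \<bar>(\<gamma> j t - \<gamma> j 0) \<bullet> rot T1\<bar> \<le> e * \<bar>(\<gamma> j t - \<gamma> j 0) \<bullet> T1\<bar>"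
        using tangency[of "\<gamma> j" "norm (D j 0)" T1 0 "{0..1}" e] has_D[OF j(1), of 0] D_eq[of j 0]
          D_nz[OF j(1), of 0] T1 e by auto
      have "\<bar>(c t - y i) \<bullet> rot T1\<bar> \<le> e * \<bar>(c t - y i) \<bullet> T1\<bar>" if "\<bar>t\<bar> < min d d'" "\<bar>t\<bar> \<le> a" for t
        using d(2)[of "1 + t"] d'(2)[of t] that a yi j by (auto simp: c_def)
      then show ?thesis using d(1) d'(1) by (intro exI[of _ "min d d'"]) auto
    qed
  qed blast
  then obtain N b where N: "N = rot T1 \<or> N = - rot T1" and b: "b > 0" and
    ev: "\<And>t. \<bar>t\<bar> < b \<Longrightarrow> \<forall>\<^sub>F s in at_right 0. c t - s *\<^sub>R N \<in> \<Omega>" by blast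
  define b' where "b' = min b 1 / 2"
  have b': "b' > 0" "b' < b" "b' < 1" using b by (auto simp: b'_def)
  \<comment> \<open>At the corner \<open>N\<close> and the limit normal are both
    \<open>rot T1\<close> up to sign, so the inequality becomes an equality of signs.\<close>
  have ge1: "N \<bullet> nu i 1 \<ge> 0"
  proof (rule continuous_ge_on_Ioo[where g = "\<lambda>t. N \<bullet> nu i t" and c = "1-b'" and d = 1])
    show "continuous_on {1-b'..1} (\<lambda>t. N \<bullet> nu i t)"
      by (intro continuous_intros continuous_on_subset[OF cont_nu[OF i]]) (use b' in auto)
    fix u assume u: "u \<in> {1-b'<..<1}"
    then have u01: "u \<in> {0<..<1}" using b' by auto
    have "\<forall>\<^sub>F s in at_right 0. \<gamma> i u - s *\<^sub>R N \<in> \<Omega>"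
      using ev[of "u - 1"] u b' by (simp add: c_def)
    from normal_inward[OF i u01 this] show "0 \<le> N \<bullet> nu i u" using normal_eq[OF i u01] by simp
  qed (use b' in auto)
  have ge2: "N \<bullet> nu j 0 \<ge> 0"
  proof (rule continuous_ge_on_Ioo[where g = "\<lambda>t. N \<bullet> nu j t" and c = 0 and d = b'])
    show "continuous_on {0..b'} (\<lambda>t. N \<bullet> nu j t)"
      by (intro continuous_intros continuous_on_subset[OF cont_nu[OF j(1)]]) (use b' in auto)
    fix u assume u: "u \<in> {0<..<b'}"
    then have u01: "u \<in> {0<..<1}" using b' by auto
    have "\<forall>\<^sub>F s in at_right 0. \<gamma> j u - s *\<^sub>R N \<in> \<Omega>"
      using ev[of "u"] u b' by (simp add: c_def)
    from normal_inward[OF j(1) u01 this] show "0 \<le> N \<bullet> nu j u" using normal_eq[OF j(1) u01] by simp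
  qed (use b' in auto)
  have 1: "T1 \<bullet> T1 = 1" using T1 by (simp add: norm_eq_1)
  have "eps i = eps j"
    using ge1 ge2 N eps_cases[of i] eps_cases[of j] by (auto simp: nu_def T1 1)
  then show ?thesis using TT by (simp add: nu_def j_def)
qed

lemma constant_curvature_imp_ball:
  assumes C1: "\<And>i. i \<in> {1..m} \<Longrightarrow> T i 1 = T (csuc m i) 0" and k: "k > 0"
    and kappa: "\<And>i t. i \<in> {1..m} \<Longrightarrow> t \<in> {0<..<1} \<Longrightarrow> kappa i t = k"
  shows "\<exists>c r. r > 0 \<and> \<Omega> = ball c r"
proof -
  define p where "p i t = \<gamma> i t - (1/k) *\<^sub>R nu i t" for i t
  have const: "p i t = p i 0" if i: "i \<in> {1..m}" and t: "t \<in> {0..1}" for i t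
  proof -
    \<comment> \<open>Continuity extends the value to the ends, so that the center of curvature is
      stationary on the closed arc.\<close>
    have "kappa i t = k" if "t \<in> {0..1}" for t
      using continuous_constant_on_closure[of "{0<..<1}" "kappa i" k t] that cont_kappa[OF i] kappa[OF i] by simp
    then have "(p i has_vector_derivative 0) (at t within {0..1})" if "t \<in> {0..1}" for t
      using has_vector_derivative_diff[OF has_D[OF i that]
          bounded_linear.has_vector_derivative[OF bounded_linear_scaleR_right[of "1/k"] nu_deriv[OF i that]]] that k
      unfolding p_def[abs_def] by simp
    from has_vector_derivative_zero_constant[OF _ this] obtain c where "\<And>t. t \<in> {0..1} \<Longrightarrow> p i t = c"
      by auto
    then show ?thesis using t by simp
  qed
  have step: "p (csuc m i) 0 = p i 0" if i: "i \<in> {1..m}" for i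
  proof -
    have "p (csuc m i) 0 = p i 1"
      using csuc(3)[OF i] arc(3)[OF i] corner_normal_eq[OF i C1[OF i]] by (simp add: p_def)
    then show ?thesis using const[OF i, of 1] by simp
  qed
  have all: "p (Suc n) 0 = p 1 0" if "Suc n \<le> m" for n
    using that
  proof (induction n)
    case (Suc n)
    then show ?case using step[of "Suc n"] by (simp add: csuc_def)
  qed simp
  have "frontier \<Omega> \<subseteq> sphere (p 1 0) (1/k)"
  proof
    fix x assume "x \<in> frontier \<Omega>"
    then obtain i t where i: "i \<in> {1..m}" and t: "t \<in> {0..1}" and x: "x = \<gamma> i t"
      unfolding frontier_eq by blast
    have "p i t = p 1 0" using const[OF i t] all[of "i - 1"] i by simp
    then have "x - p 1 0 = (1/k) *\<^sub>R nu i t" unfolding x by (simp add: p_def algebra_simps)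
    then have "norm (x - p 1 0) = 1/k" using norm_nu[OF i t] k by simp
    then show "x \<in> sphere (p 1 0) (1/k)" by (simp add: dist_norm norm_minus_commute)
  qed
  moreover have "\<Omega> \<noteq> {}" using in_frontier[of 1 0] m_ge_1 by auto
  ultimately have "\<Omega> = ball (p 1 0) (1/k)"
    by (intro frontier_subset_sphere_imp_ball opn conn bdd) simp_all
  then show ?thesis using k by (intro exI[of _ "p 1 0"] exI[of _ "1/k"]) simp
qed

end

section \<open>The radial area estimate\<close>

lemma Basis_real2: "(Basis :: (real^2) set) = {axis 1 1, axis 2 1}"
  by (auto simp: Basis_vec_def UNIV_2)

lemma pair_to_vec_measurable:
  "(\<lambda>(a, b). vector [a, b] :: real^2) \<in> borel_measurable (lborel \<Otimes>\<^sub>M lborel)"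
proof -
  have "continuous_on UNIV (\<lambda>p::real \<times> real. fst p *\<^sub>R axis 1 1 + snd p *\<^sub>R axis 2 1 :: real^2)"
    by (intro continuous_intros)
  then have "(\<lambda>p::real \<times> real. fst p *\<^sub>R axis 1 1 + snd p *\<^sub>R axis 2 1 :: real^2) \<in> borel_measurable borel"
    by (rule borel_measurable_continuous_onI)
  moreover have "(\<lambda>p::real \<times> real. fst p *\<^sub>R axis 1 1 + snd p *\<^sub>R axis 2 1 :: real^2) = (\<lambda>(a, b). vector [a, b])"
    by (auto simp: fun_eq_iff vec_eq_iff forall_2 axis_def)
  ultimately show ?thesis by (simp add: lborel_prod)
qed

text \<open>Lebesgue measure is determined by its values on boxes, and boxes pull back to products
  of intervals.\<close>

lemma lborel_real2: "lborel = distr (lborel \<Otimes>\<^sub>M lborel) borel (\<lambda>(a, b). vector [a, b] :: real^2)"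
proof (rule lborel_eqI)
  fix l u :: "real^2" assume lu: "\<And>b. b \<in> Basis \<Longrightarrow> l \<bullet> b \<le> u \<bullet> b"
  have l: "l$1 \<le> u$1" "l$2 \<le> u$2" using lu[of "axis 1 1"] lu[of "axis 2 1"] by (simp_all add: Basis_real2 inner_axis)
  have "emeasure (distr (lborel \<Otimes>\<^sub>M lborel) borel (\<lambda>(a, b). vector [a, b] :: real^2)) (box l u)
      = emeasure (lborel \<Otimes>\<^sub>M lborel) ({l$1<..<u$1} \<times> {l$2<..<u$2})"
    by (subst emeasure_distr[OF pair_to_vec_measurable])
       (auto intro!: arg_cong2[where f = emeasure] simp: space_pair_measure mem_box_cart forall_2)
  also have "\<dots> = emeasure lborel {l$1<..<u$1} * emeasure lborel {l$2<..<u$2}"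
    by (rule lborel.emeasure_pair_measure_Times) auto
  also have "\<dots> = ennreal (\<Prod>b\<in>Basis. (u - l) \<bullet> b)"
    using l by (simp add: Basis_real2 axis_eq_axis inner_axis ennreal_mult)
  finally show "emeasure (distr (lborel \<Otimes>\<^sub>M lborel) borel (\<lambda>(a, b). vector [a, b] :: real^2)) (box l u)
      = ennreal (\<Prod>b\<in>Basis. (u - l) \<bullet> b)" .
qed simp

lemma nn_integral_real2:
  fixes f :: "real^2 \<Rightarrow> ennreal"
  assumes f: "f \<in> borel_measurable borel"
  shows "(\<integral>\<^sup>+x. f x \<partial>lborel) = (\<integral>\<^sup>+a. \<integral>\<^sup>+b. f (vector [a, b]) \<partial>lborel \<partial>lborel)"
proof -
  have "(\<integral>\<^sup>+x. f x \<partial>lborel) = (\<integral>\<^sup>+p. f (case p of (a, b) \<Rightarrow> vector [a, b]) \<partial>(lborel \<Otimes>\<^sub>M lborel))"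
    by (subst lborel_real2) (rule nn_integral_distr[OF pair_to_vec_measurable], use f in simp)
  also have "\<dots> = (\<integral>\<^sup>+a. \<integral>\<^sup>+b. f (case (a, b) of (a, b) \<Rightarrow> vector [a, b]) \<partial>lborel \<partial>lborel)"
    by (rule lborel.nn_integral_fst[symmetric]) (rule measurable_compose[OF pair_to_vec_measurable f])
  finally show ?thesis by simp
qed

text \<open>A form of Tonelli's theorem: by nonnegativity, integrability of \<open>f\<close> comes
  along with the value, in the shape that the change of variables consumes.\<close>

lemma has_integral_iterated_real2:
  fixes f :: "real^2 \<Rightarrow> real"
  assumes f: "f \<in> borel_measurable borel" "\<And>x. 0 \<le> f x"
    and inner: "\<And>a. ((\<lambda>b. f (vector [a, b])) has_integral h a) UNIV"
    and outer: "(h has_integral I) UNIV"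
  shows "(f has_integral I) UNIV"
proof (rule nn_integral_has_integral[OF f])
  have h: "h a \<ge> 0" for a by (rule has_integral_nonneg[OF inner]) (simp add: f)
  show I: "I \<ge> 0" by (rule has_integral_nonneg[OF outer]) (simp add: h)
  have "(\<integral>\<^sup>+x. f x \<partial>lborel) = (\<integral>\<^sup>+a. \<integral>\<^sup>+b. f (vector [a, b]) \<partial>lborel \<partial>lborel)"
    using f by (intro nn_integral_real2) simp
  also have "\<dots> = (\<integral>\<^sup>+a. h a \<partial>lborel)"
    using nn_integral_has_integral_lebesgue'[OF _ inner] f by (intro nn_integral_cong) simp
  also have "\<dots> = ennreal I"
    using nn_integral_has_integral_lebesgue'[OF _ outer] h by simp
  finally show "(\<integral>\<^sup>+x. f x \<partial>lborel) = ennreal I" .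
qed

text \<open>The vectors \<open>u\<close> and \<open>v\<close> are the columns, and
  \<open>rot u \<bullet> v\<close> is their planar cross product.\<close>

lemma det_matrix_real2: "det (matrix (\<lambda>h::real^2. h$1 *\<^sub>R u + h$2 *\<^sub>R v)) = rot u \<bullet> (v::real^2)"
  by (simp add: det_2 matrix_def inner_2 axis_def)

lemma isolated_zero:
  fixes f :: "real \<Rightarrow> real"
  assumes "(f has_real_derivative d) (at t)" "d \<noteq> 0" "f t = 0"
  shows "\<exists>U. open U \<and> t \<in> U \<and> (\<forall>x\<in>U. f x = 0 \<longrightarrow> x = t)"
proof -
  have "((\<lambda>x. (f x - f t) / (x - t)) \<longlongrightarrow> d) (at t)"
    using assms(1) by (simp add: has_field_derivative_iff)
  then have "\<forall>\<^sub>F x in at t. (f x - f t) / (x - t) \<noteq> 0"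
    using assms(2) by (rule tendsto_imp_eventually_ne)
  then obtain U where U: "open U" "t \<in> U" "\<forall>x\<in>U. x \<noteq> t \<longrightarrow> (f x - f t) / (x - t) \<noteq> 0"
    unfolding eventually_at_topological by blast
  have "x = t" if "x \<in> U" "f x = 0" for x
    using bspec[OF U(3) that(1)] that(2) assms(3) by auto
  with U(1,2) show ?thesis by blast
qed

context starshaped_domain
begin

text \<open>A ray through a corner may graze the boundary there, so only rays avoiding the corners are
  known to lie in \<open>\<Omega>\<close>.\<close>
definition generic :: "nat \<Rightarrow> real set" where
  "generic i = {t \<in> {0<..<1}. \<forall>j\<in>{1..m}. y j \<noteq> 0 \<longrightarrow> \<gamma> i t \<bullet> rot (y j) \<noteq> 0}"

lemma open_generic:
  assumes i: "i \<in> {1..m}"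
  shows "open (generic i)"
proof -
  have "open ({0<..<1} \<inter> (\<lambda>t. \<gamma> i t \<bullet> rot (y j)) -` (- {0}))" for j
    by (intro continuous_open_preimage continuous_intros continuous_on_subset[OF cont_\<gamma>[OF i]]) auto
  then have "open ({0<..<1} \<inter> (\<Inter>j\<in>{j\<in>{1..m}. y j \<noteq> 0}. {0<..<1} \<inter> (\<lambda>t. \<gamma> i t \<bullet> rot (y j)) -` (- {0})))"
    by (intro open_Int open_INT) auto
  also have "{0<..<1} \<inter> (\<Inter>j\<in>{j\<in>{1..m}. y j \<noteq> 0}. {0<..<1} \<inter> (\<lambda>t. \<gamma> i t \<bullet> rot (y j)) -` (- {0})) = generic i"
    by (auto simp: generic_def)
  finally show ?thesis .
qed

lemma w_rot:
  assumes i: "i \<in> {1..m}" and t: "t \<in> {0<..<1}"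
  shows "w i t = \<bar>\<gamma> i t \<bullet> rot (D i t)\<bar>"
proof -
  have "\<gamma> i t \<bullet> rot (D i t) = norm (D i t) * (\<gamma> i t \<bullet> rot (T i t))"
    by (subst D_eq) (simp add: rot_scaleR)
  then have "w i t = eps i * (\<gamma> i t \<bullet> rot (D i t))" by (simp add: w_def nu_def)
  then have "\<bar>w i t\<bar> = \<bar>\<gamma> i t \<bullet> rot (D i t)\<bar>" using eps_cases[of i] by auto
  then show ?thesis using w_pos[OF i t] by simp
qed

text \<open>Where the radius vector is parallel to a corner, the derivative of
  \<open>\<gamma> i t \<bullet> rot (y j)\<close> cannot vanish: otherwise the tangent would be
  radial and \<open>w\<close> zero. So the excluded parameters are isolated.\<close>

lemma negligible_not_generic:
  assumes i: "i \<in> {1..m}"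
  shows "negligible ({0<..<1} - generic i)"
proof -
  define Z where "Z j = {t \<in> {0<..<1}. \<gamma> i t \<bullet> rot (y j) = 0}" for j
  have "negligible (Z j)" if yj: "y j \<noteq> 0" for j
  proof (rule locally_negligible_alt[THEN iffD2], rule ballI)
    fix t assume "t \<in> Z j"
    then have t: "t \<in> {0<..<1}" and z: "\<gamma> i t \<bullet> rot (y j) = 0" by (auto simp: Z_def)
    have "norm (sgn (y j)) = 1" using yj by (simp add: norm_sgn)
    from rot_decomp[OF this, of "\<gamma> i t"] z
    have "\<gamma> i t = (\<gamma> i t \<bullet> sgn (y j)) *\<^sub>R sgn (y j)" by (simp add: sgn_div_norm rot_scaleR)
    then obtain \<mu> where \<mu>: "\<gamma> i t = \<mu> *\<^sub>R y j" by (metis scaleR_scaleR sgn_div_norm)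
    have "D i t \<bullet> rot (y j) \<noteq> 0"
    proof
      assume "D i t \<bullet> rot (y j) = 0"
      then have "y j \<bullet> rot (D i t) = 0" by (metis add.inverse_inverse inner_commute inner_rot_swap neg_equal_0_iff_equal)
      then show False using w_rot[OF i t] w_pos[OF i t] by (simp add: \<mu>)
    qed
    moreover have "((\<lambda>t. \<gamma> i t \<bullet> rot (y j)) has_real_derivative D i t \<bullet> rot (y j)) (at t)"
      using has_D_at[OF i t] unfolding has_vector_derivative_def has_field_derivative_def
      by (auto intro!: derivative_eq_intros simp: fun_eq_iff)
    ultimately have "\<exists>U. open U \<and> t \<in> U \<and> (\<forall>x\<in>U. \<gamma> i x \<bullet> rot (y j) = 0 \<longrightarrow> x = t)"
      using z by (intro isolated_zero[where d = "D i t \<bullet> rot (y j)"]) auto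
    then obtain U where U: "open U" "t \<in> U" "\<And>x. x \<in> U \<Longrightarrow> \<gamma> i x \<bullet> rot (y j) = 0 \<Longrightarrow> x = t"
      by blast
    then have "Z j \<inter> U = {t}" using \<open>t \<in> Z j\<close> unfolding Z_def by blast
    then show "\<exists>V. openin (top_of_set (Z j)) V \<and> t \<in> V \<and> negligible V"
      using U(1,2) \<open>t \<in> Z j\<close> openin_open_Int[OF U(1), of "Z j"] negligible_sing[of t]
      by (intro exI[of _ "Z j \<inter> U"]) simp
  qed
  then have "negligible (\<Union>j\<in>{j\<in>{1..m}. y j \<noteq> 0}. Z j)" by (intro negligible_Union) auto
  then show ?thesis by (rule negligible_subset) (auto simp: generic_def Z_def)
qed

text \<open>If the ray left \<Omega>, its last point \<open>x\<close> outside \<Omega> before the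
  end would be a frontier point, by genericity not a corner. Moving on from \<open>x\<close> in the
  direction \<open>x\<close> enters \<Omega>, although starshapedness makes this an outward
  direction.\<close>

lemma ray_in:
  assumes i: "i \<in> {1..m}" and t: "t \<in> generic i" and s: "s \<in> {0<..<1}"
  shows "s *\<^sub>R \<gamma> i t \<in> \<Omega>"
proof (rule ccontr)
  assume out: "s *\<^sub>R \<gamma> i t \<notin> \<Omega>"
  define z where "z = \<gamma> i t"
  have t01: "t \<in> {0<..<1}" using t by (auto simp: generic_def)
  have zn: "z \<bullet> outward_normal \<Omega> m \<gamma> z > 0"
    using normal_eq[OF i t01] by (simp add: z_def)
  then have z0: "z \<noteq> 0" by auto
  have "\<forall>\<^sub>F u in at_right 0. z + u *\<^sub>R (- z) \<in> \<Omega>"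
    unfolding z_def by (rule normal_in[OF i t01]) (use zn in \<open>simp add: z_def\<close>)
  then obtain d where d: "d > 0" "\<And>u. 0 < u \<Longrightarrow> u < d \<Longrightarrow> (1 - u) *\<^sub>R z \<in> \<Omega>"
    unfolding eventually_at_right_field by (auto simp: algebra_simps)
  \<comment> \<open>The cut at \<open>1 - d/2\<close> keeps \<open>A\<close> away from the end of
    the ray, which lies on the frontier and would otherwise be the supremum.\<close>
  define A where "A = {u \<in> {s..1 - d/2}. u *\<^sub>R z \<notin> \<Omega>}"
  have in1: "u *\<^sub>R z \<in> \<Omega>" if "1 - d < u" "u < 1" for u
    using d(2)[of "1 - u"] that by simp
  have "s \<in> A" using in1[of s] out s d(1) by (cases "s \<le> 1 - d/2") (auto simp: A_def z_def)
  have "closed ({s..1 - d/2} \<inter> (\<lambda>u. u *\<^sub>R z) -` (- \<Omega>))"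
    by (rule continuous_closed_preimage) (auto intro!: continuous_intros simp: opn closed_def)
  moreover have "{s..1 - d/2} \<inter> (\<lambda>u. u *\<^sub>R z) -` (- \<Omega>) = A" by (auto simp: A_def)
  ultimately have clA: "closed A" by simp
  have bdA: "bdd_above A" by (auto simp: A_def intro!: bdd_aboveI[of _ "1 - d/2"])
  define u0 where "u0 = Sup A"
  have "u0 \<in> A" unfolding u0_def using closed_contains_Sup[OF _ bdA clA] \<open>s \<in> A\<close> by blast
  then have u0: "s \<le> u0" "u0 \<le> 1 - d/2" "u0 *\<^sub>R z \<notin> \<Omega>" by (auto simp: A_def)
  then have u01: "0 < u0" "u0 < 1" using s d(1) by auto
  have above: "u *\<^sub>R z \<in> \<Omega>" if u: "u0 < u" "u < 1" for u
  proof (rule ccontr)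
    assume n: "u *\<^sub>R z \<notin> \<Omega>"
    then have "u \<le> 1 - d" using in1[of u] u by linarith
    then have "u \<in> A" using n u u0 d(1) by (auto simp: A_def)
    then have "u \<le> u0" unfolding u0_def by (rule cSup_upper[OF _ bdA])
    then show False using u by simp
  qed
  define x where "x = u0 *\<^sub>R z"
  have ev: "\<forall>\<^sub>F e in at_right 0. x + e *\<^sub>R x \<in> \<Omega>"
  proof -
    have "x + e *\<^sub>R x \<in> \<Omega>" if "0 < e" "e < 1 / u0 - 1" for e
    proof -
      have "x + e *\<^sub>R x = ((1 + e) * u0) *\<^sub>R z" by (simp add: x_def algebra_simps)
      moreover have "u0 < (1 + e) * u0" using that u01 by simp
      moreover have "(1 + e) * u0 < 1" using that u01 by (simp add: field_simps)
      ultimately show ?thesis using above[of "(1 + e) * u0"] by simp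
    qed
    moreover have "1 / u0 - 1 > 0" using u01 by (simp add: field_simps)
    ultimately show ?thesis unfolding eventually_at_right_field by blast
  qed
  have "x \<in> closure \<Omega>"
  proof (rule Lim_in_closed_set[OF closed_closure])
    show "\<forall>\<^sub>F e in at_right 0. x + e *\<^sub>R x \<in> closure \<Omega>"
      using ev by eventually_elim (use closure_subset in auto)
    show "((\<lambda>e. x + e *\<^sub>R x) \<longlongrightarrow> x) (at_right 0)"
      by (auto intro!: tendsto_eq_intros)
  qed simp
  then have xf: "x \<in> frontier \<Omega>" using u0(3) opn by (simp add: frontier_def x_def interior_open)
  have "x \<notin> corners m y"
  proof
    assume "x \<in> corners m y"
    then obtain j where j: "j \<in> {1..m}" "x = y j" unfolding corners_def by blast
    \<comment> \<open>A corner at the origin is exempt from the condition in \<open>generic\<close>,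
      but \<open>x\<close> is a positive multiple of \<open>z \<noteq> 0\<close>.\<close>
    then have "y j \<noteq> 0" using u01 z0 by (auto simp: x_def)
    moreover have "\<gamma> i t \<bullet> rot (y j) = 0" unfolding j(2)[symmetric] x_def by (simp add: z_def rot_scaleR)
    ultimately show False using t j by (auto simp: generic_def)
  qed
  with xf obtain j v where j: "j \<in> {1..m}" and v: "v \<in> {0<..<1}" and xv: "x = \<gamma> j v"
    using not_corner_obtain by blast
  have "\<forall>\<^sub>F e in at_right 0. x + e *\<^sub>R x \<notin> \<Omega>"
    unfolding xv by (rule normal_out[OF j v]) (use normal_eq[OF j v] in simp)
  with ev have "\<forall>\<^sub>F e in at_right (0::real). False" by eventually_elim simp
  then show False by simp
qed

text \<open>With \<open>s < r\<close>, the frontier point \<open>\<gamma> j u\<close> would be a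
  proper fraction of \<open>\<gamma> i t\<close> and hence lie in \<Omega>.\<close>

lemma ray_unique:
  assumes i: "i \<in> {1..m}" "t \<in> generic i" "s \<in> {0<..<1}"
    and j: "j \<in> {1..m}" "u \<in> generic j" "r \<in> {0<..<1}"
    and e: "s *\<^sub>R \<gamma> i t = r *\<^sub>R \<gamma> j u"
  shows "i = j \<and> t = u \<and> s = r"
proof -
  have le: "r \<le> s"
    if i: "i \<in> {1..m}" "t \<in> generic i" "s \<in> {0<..<1}" and j: "j \<in> {1..m}" "u \<in> generic j" "r \<in> {0<..<1}"
    and e: "s *\<^sub>R \<gamma> i t = r *\<^sub>R \<gamma> j u" for i j t u s r
  proof (rule ccontr)
    assume "\<not> r \<le> s"
    then have "s / r \<in> {0<..<1}" using i j by auto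
    then have "(s / r) *\<^sub>R \<gamma> i t \<in> \<Omega>" by (rule ray_in[OF i(1,2)])
    moreover have "(s / r) *\<^sub>R \<gamma> i t = (1 / r) *\<^sub>R (s *\<^sub>R \<gamma> i t)" by simp
    then have "(s / r) *\<^sub>R \<gamma> i t = \<gamma> j u" unfolding e using j by simp
    moreover have "u \<in> {0..1}" using j(2) by (auto simp: generic_def)
    ultimately show False using in_frontier[OF j(1)] opn frontier_disjoint_eq by fastforce
  qed
  have "s = r" using le[OF i j e] le[OF j i e[symmetric]] by simp
  then have "\<gamma> i t = \<gamma> j u" using e i by simp
  moreover have "t \<in> {0<..<1}" "u \<in> {0..1}" using i j by (auto simp: generic_def)
  ultimately show ?thesis using interior_unique[OF i(1) j(1)] \<open>s = r\<close> by auto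
qed

text \<open>The arc parameter and the scaling factor are packed into one plane vector, so that the
  change of variables applies to a map of the plane to itself.\<close>

definition sector_dom :: "nat \<Rightarrow> (real^2) set" where
  "sector_dom i = {x. x$1 \<in> generic i \<and> x$2 \<in> {0<..<1}}"

definition sector_map :: "nat \<Rightarrow> real^2 \<Rightarrow> real^2" where
  "sector_map i x = x$2 *\<^sub>R \<gamma> i (x$1)"

text \<open>The map \<open>(t, s) \<mapsto> s \<gamma>(t)\<close> has Jacobian
  \<open>s * w i t\<close>, and integrating \<open>s\<close> over the unit interval gives the factor
  1/2. Injectivity makes the area formula an equality.\<close>

lemma sector_area:
  assumes i: "i \<in> {1..m}"
  shows "sector_map i ` sector_dom i \<in> lmeasurable"
    and "measure lebesgue (sector_map i ` sector_dom i) = integral {0..1} (w i) / 2"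
proof -
  let ?S = "sector_dom i"
  define F' where "F' x = (\<lambda>h::real^2. h$1 *\<^sub>R (x$2 *\<^sub>R D i (x$1)) + h$2 *\<^sub>R \<gamma> i (x$1))" for x :: "real^2"
  have g01: "t \<in> {0<..<1}" if "t \<in> generic i" for t using that by (auto simp: generic_def)
  have Sop: "open ?S"
  proof -
    have "open ((\<lambda>x::real^2. x$1) -` generic i \<inter> (\<lambda>x. x$2) -` {0<..<1})"
      by (intro open_Int open_vimage open_generic[OF i] continuous_intros open_greaterThanLessThan)
    also have "\<dots> = ?S" by (auto simp: sector_dom_def)
    finally show ?thesis .
  qed
  have der: "(sector_map i has_derivative F' x) (at x within ?S)" if x: "x \<in> ?S" for x
  proof -
    have t: "x$1 \<in> {0<..<1}" using x g01 by (auto simp: sector_dom_def)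
    have p1: "((\<lambda>x::real^2. x$1) has_derivative (\<lambda>h. h$1)) (at x within ?S)"
      by (rule bounded_linear_imp_has_derivative[OF bounded_linear_vec_nth])
    have p2: "((\<lambda>x::real^2. x$2) has_derivative (\<lambda>h. h$2)) (at x within ?S)"
      by (rule bounded_linear_imp_has_derivative[OF bounded_linear_vec_nth])
    have "((\<lambda>x. \<gamma> i (x$1)) has_derivative (\<lambda>h. (h$1) *\<^sub>R D i (x$1))) (at x within ?S)"
      by (rule has_derivative_compose[OF p1 has_D_at[OF i t, unfolded has_vector_derivative_def]])
    from has_derivative_scaleR[OF p2 this]
    have "((\<lambda>x. x$2 *\<^sub>R \<gamma> i (x$1)) has_derivative
       (\<lambda>h. x$2 *\<^sub>R ((h$1) *\<^sub>R D i (x$1)) + (h$2) *\<^sub>R \<gamma> i (x$1))) (at x within ?S)" .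
    then show ?thesis unfolding sector_map_def[abs_def] F'_def by (simp add: mult.commute)
  qed
  have inj: "inj_on (sector_map i) ?S"
  proof (rule inj_onI)
    fix x x' assume "x \<in> ?S" "x' \<in> ?S" "sector_map i x = sector_map i x'"
    then have "x$1 = x'$1 \<and> x$2 = x'$2"
      using ray_unique[OF i _ _ i] by (auto simp: sector_dom_def sector_map_def)
    then show "x = x'" by (simp add: vec_eq_iff forall_2)
  qed
  have det: "\<bar>det (matrix (F' x))\<bar> = x$2 * w i (x$1)" if x: "x \<in> ?S" for x
  proof -
    have t: "x$1 \<in> {0<..<1}" "x$2 > 0" using x g01 by (auto simp: sector_dom_def)
    show ?thesis unfolding F'_def det_matrix_real2 w_rot[OF i t(1)] using t(2)
      by (simp add: rot_scaleR abs_mult inner_commute)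
  qed
  define f where "f x = (if x \<in> ?S then x$2 * w i (x$1) else 0)" for x
  define h where "h a = (if a \<in> generic i then w i a / 2 else 0)" for a
  have hint: "(f has_integral (integral {0..1} (w i) / 2)) UNIV"
  proof (rule has_integral_iterated_real2)
    have "continuous_on ?S (\<lambda>x. w i (x$1))"
      by (rule continuous_on_compose2[OF cont_w[OF i]])
         (auto intro!: continuous_intros simp: sector_dom_def generic_def)
    then show "f \<in> borel_measurable borel" unfolding f_def
      by (intro borel_measurable_continuous_on_if continuous_intros) (use Sop in auto)
    show "f x \<ge> 0" for x using w_pos[OF i g01, of "x$1"] by (auto simp: f_def sector_dom_def less_imp_le)
    show "((\<lambda>b. f (vector [a, b])) has_integral h a) UNIV" for a
    proof (cases "a \<in> generic i")
      case True
      have "((\<lambda>b. b * w i a) has_integral ((1\<^sup>2 - 0\<^sup>2) / 2) * w i a) {0..1}"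
        by (intro has_integral_mult_left ident_has_integral zero_le_one)
      then have "((\<lambda>b. if b \<in> {0..1} then b * w i a else 0) has_integral w i a / 2) UNIV"
        unfolding has_integral_restrict_UNIV by simp
      then have "((\<lambda>b. if b \<in> {0<..<1} then b * w i a else 0) has_integral w i a / 2) UNIV"
        by (rule has_integral_spike[of "{0,1}", rotated 2]) auto
      then show ?thesis using True by (simp add: f_def h_def sector_dom_def cong: if_cong)
    next
      case False
      then show ?thesis by (simp add: f_def h_def sector_dom_def)
    qed
    have "(w i has_integral integral {0..1} (w i)) {0..1}"
      by (intro integrable_integral integrable_continuous_interval cont_w[OF i])
    from has_integral_mult_left[OF this, of "1/2"]
    have "((\<lambda>a. if a \<in> {0..1} then w i a / 2 else 0) has_integral integral {0..1} (w i) / 2) UNIV"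
      unfolding has_integral_restrict_UNIV by simp
    then show "(h has_integral integral {0..1} (w i) / 2) UNIV"
    proof (rule has_integral_spike[rotated 2])
      show "negligible (({0<..<1} - generic i) \<union> {0,1})"
        by (intro negligible_Un negligible_not_generic[OF i]) simp
      show "h a = (if a \<in> {0..1} then w i a / 2 else 0)" if "a \<in> UNIV - (({0<..<1} - generic i) \<union> {0,1})" for a
      proof -
        have "a \<in> {0<..<1} \<longleftrightarrow> a \<in> {0..1}" "a \<in> {0<..<1} \<longrightarrow> a \<in> generic i" using that by auto
        then show ?thesis using g01[of a] unfolding h_def by meson
      qed
    qed
  qed
  then have "((\<lambda>x. x$2 * w i (x$1)) has_integral integral {0..1} (w i) / 2) ?S"
    unfolding f_def has_integral_restrict_UNIV .
  then have hi: "((\<lambda>x. \<bar>det (matrix (F' x))\<bar>) has_integral integral {0..1} (w i) / 2) ?S"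
    by (rule has_integral_eq[rotated]) (simp add: det)
  have Sl: "?S \<in> sets lebesgue" using Sop by auto
  have int: "(\<lambda>x. \<bar>det (matrix (F' x))\<bar>) integrable_on ?S" using hi by (rule has_integral_integrable)
  show "sector_map i ` ?S \<in> lmeasurable" by (rule measurable_differentiable_image[OF Sl der int])
  show "measure lebesgue (sector_map i ` ?S) = integral {0..1} (w i) / 2"
    using measure_differentiable_image_eq[OF Sl der inj int] hi by (simp add: integral_unique)
qed

text \<open>The sectors are pairwise disjoint and lie in \<Omega>, which gives this inequality; that
  they exhaust \<Omega> is not claimed.\<close>

lemma sum_w_le: "(\<Sum>i=1..m. integral {0..1} (w i)) \<le> 2 * measure lebesgue \<Omega>"
proof -
  let ?A = "\<lambda>i. sector_map i ` sector_dom i"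
  have "disjoint_family_on ?A {1..m}"
    unfolding disjoint_family_on_def
  proof (intro ballI impI)
    fix i j assume ij: "i \<in> {1..m}" "j \<in> {1..m}" "i \<noteq> j"
    show "?A i \<inter> ?A j = {}"
      using ray_unique[OF ij(1) _ _ ij(2)] ij(3) by (force simp: sector_map_def sector_dom_def)
  qed
  then have "measure lebesgue (\<Union>i\<in>{1..m}. ?A i) = (\<Sum>i\<in>{1..m}. measure lebesgue (?A i))"
  proof (intro measure_finite_Union)
    show "?A ` {1..m} \<subseteq> sets lebesgue" using sector_area(1) by auto
    show "emeasure lebesgue (?A i) \<noteq> \<infinity>" if "i \<in> {1..m}" for i
      using fmeasurableD2[OF sector_area(1)[OF that]] by simp
  qed simp_all
  also have "\<dots> = (\<Sum>i=1..m. integral {0..1} (w i) / 2)"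
    by (intro sum.cong refl sector_area(2))
  finally have eq: "measure lebesgue (\<Union>i\<in>{1..m}. ?A i) = (\<Sum>i=1..m. integral {0..1} (w i)) / 2"
    by (simp add: sum_divide_distrib)
  have "measure lebesgue (\<Union>i\<in>{1..m}. ?A i) \<le> measure lebesgue \<Omega>"
  proof (rule measure_mono_fmeasurable)
    show "(\<Union>i\<in>{1..m}. ?A i) \<subseteq> \<Omega>" using ray_in by (auto simp: sector_map_def sector_dom_def)
    show "(\<Union>i\<in>{1..m}. ?A i) \<in> sets lebesgue" using sector_area(1) by (intro sets.finite_UN) auto
    show "\<Omega> \<in> lmeasurable" by (rule lmeasurable_open[OF bdd opn])
  qed
  then show ?thesis using eq by simp
qed

end

section \<open>Rigidity and the cut value\<close>

text \<open>Disjointness gives \<open>dist x p \<ge> d + r\<close>, so the triangle inequality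
  through \<open>z\<close> is an equality and \<open>z\<close> lies on the segment between the
  centers.\<close>

lemma touching_balls:
  fixes x z p :: "'a::real_inner"
  assumes "dist x z = d" "dist p z = r" "d > 0" "r > 0" and disj: "ball x d \<inter> ball p r = {}"
  shows "r *\<^sub>R (x - z) = d *\<^sub>R (z - p)"
proof -
  have "dist x p \<ge> d + r"
  proof (rule ccontr)
    assume l: "\<not> dist x p \<ge> d + r"
    have lt: "dist x p / (d + r) < 1" using l assms by simp
    \<comment> \<open>The point that divides the segment of the centers in the ratio of the radii;
      if the centers were too close, it would lie in both balls.\<close>
    define q where "q = x + (d / (d + r)) *\<^sub>R (p - x)"
    have "p - q = (r / (d + r)) *\<^sub>R (p - x)"
    proof -
      have "p - q = (1 - d / (d + r)) *\<^sub>R (p - x)" by (simp add: q_def algebra_simps)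
      moreover have "1 - d / (d + r) = r / (d + r)" using assms by (simp add: field_simps)
      ultimately show ?thesis by simp
    qed
    then have "dist p q = r / (d + r) * dist x p"
      using assms by (simp add: dist_norm norm_minus_commute)
    also have "\<dots> < r" using mult_strict_left_mono[OF lt, of r] assms by simp
    finally have "q \<in> ball p r" by simp
    have "dist x q = d / (d + r) * dist x p"
      using assms by (simp add: q_def dist_norm norm_minus_commute)
    also have "\<dots> < d" using mult_strict_left_mono[OF lt, of d] assms by simp
    finally have "q \<in> ball x d" by simp
    with \<open>q \<in> ball p r\<close> disj show False by blast
  qed
  then have "norm ((x - z) + (z - p)) = norm (x - z) + norm (z - p)"
    using assms norm_triangle_ineq[of "x - z" "z - p"] by (simp add: dist_norm norm_minus_commute)
  then have "norm (x - z) *\<^sub>R (z - p) = norm (z - p) *\<^sub>R (x - z)"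
    by (simp only: norm_triangle_eq)
  then show ?thesis using assms by (simp add: dist_norm norm_minus_commute)
qed

text \<open>If \<open>d\<close> were negative, \<open>g'\<close> would be negative just to the right
  of its zero \<open>t0\<close>, and \<open>g\<close> would drop below its minimum.\<close>

lemma second_derivative_min:
  fixes g g' :: "real \<Rightarrow> real"
  assumes S: "open S" "t0 \<in> S"
    and g: "\<And>t. t \<in> S \<Longrightarrow> (g has_real_derivative g' t) (at t)"
    and g': "(g' has_real_derivative d) (at t0)"
    and zero: "g' t0 = 0" and min: "\<And>t. t \<in> S \<Longrightarrow> g t0 \<le> g t"
  shows "d \<ge> 0"
proof (rule ccontr)
  assume "\<not> d \<ge> 0"
  then obtain e where e: "e > 0" "\<And>h. 0 < h \<Longrightarrow> h < e \<Longrightarrow> g' (t0 + h) < g' t0"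
    using DERIV_neg_dec_right[OF g'] by auto
  obtain e' where e': "e' > 0" "ball t0 e' \<subseteq> S" using S openE by blast
  define h where "h = min e e' / 2"
  have h: "h > 0" "h < e" "h < e'" using e e' by (auto simp: h_def)
  have inS: "x \<in> S" if "t0 \<le> x" "x \<le> t0 + h" for x
    using e'(2) that h by (auto simp: dist_real_def)
  have "g (t0 + h) < g t0"
  proof (rule DERIV_neg_imp_decreasing_open[where f = g])
    show "t0 < t0 + h" using h by simp
    show "\<exists>y. (g has_real_derivative y) (at x) \<and> y < 0" if "t0 < x" "x < t0 + h" for x
      using g[OF inS[of x]] e(2)[of "x - t0"] that h zero by (intro exI[of _ "g' x"]) auto
    show "continuous_on {t0..t0 + h} g"
      by (rule continuous_at_imp_continuous_on, rule ballI, rule DERIV_isCont, rule g, rule inS) auto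
  qed
  then show False using min[OF inS[of "t0 + h"]] h by simp
qed

context starshaped_domain
begin

section \<open>The squeeze that makes the curvature constant\<close>

lemma area_pos: "measure lebesgue \<Omega> > 0"
proof -
  have "\<Omega> \<noteq> {}" using in_frontier[of 1 0] m_ge_1 by auto
  then have "\<not> negligible \<Omega>" using open_not_negligible opn by blast
  then have "measure lebesgue \<Omega> \<noteq> 0"
    using lmeasurable_open[OF bdd opn] negligible_iff_measure by blast
  then show ?thesis by (simp add: less_le)
qed

lemma perimeter_pos: "perimeter m \<gamma> > 0"
proof -
  have "integral {0..1} (\<lambda>t. norm (D i t)) > 0" if i: "i \<in> {1..m}" for i
  proof -
    have c: "continuous_on {0..1} (\<lambda>t. norm (D i t))" by (intro continuous_intros cont_D i)
    have "integral {0..1} (\<lambda>t. norm (D i t)) \<noteq> 0"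
      using integral_eq_0_iff[OF c] D_nz[OF i, of 0] by force
    moreover have "integral {0..1} (\<lambda>t. norm (D i t)) \<ge> 0"
      by (intro integral_nonneg integrable_continuous_interval c) simp
    ultimately show ?thesis by simp
  qed
  then show ?thesis unfolding perimeter_eq using m_ge_1 by (intro sum_pos) auto
qed

lemma rigidity:
  assumes C1: "\<And>i. i \<in> {1..m} \<Longrightarrow> T i 1 = T (csuc m i) 0"
    and kappa: "\<And>i t. i \<in> {1..m} \<Longrightarrow> t \<in> {0<..<1} \<Longrightarrow> kappa i t \<le> k"
    and k: "2 * k * measure lebesgue \<Omega> \<le> perimeter m \<gamma>"
  shows "\<exists>c r. r > 0 \<and> \<Omega> = ball c r"
proof -
  have kappa': "kappa i t \<le> k" if i: "i \<in> {1..m}" and "t \<in> {0..1}" for i t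
    by (rule continuous_le_on_closure[of "{0<..<1}" "kappa i"]) (use that cont_kappa[OF i] kappa[OF i] in auto)
  have kw: "continuous_on {0..1} (\<lambda>t. (k - kappa i t) * w i t)" if "i \<in> {1..m}" for i
    by (intro continuous_intros cont_kappa cont_w that)
  have nonneg: "(k - kappa i t) * w i t \<ge> 0" if "i \<in> {1..m}" "t \<in> {0..1}" for i t
    using kappa'[OF that] w_nonneg[OF that] by simp
  have int_nonneg: "integral {0..1} (\<lambda>t. (k - kappa i t) * w i t) \<ge> 0" if "i \<in> {1..m}" for i
    by (intro integral_nonneg integrable_continuous_interval kw that nonneg)
  have mk: "(\<Sum>i=1..m. integral {0..1} (\<lambda>t. kappa i t * w i t)) = perimeter m \<gamma>"
    by (rule minkowski) (rule C1)
  define W where "W = (\<Sum>i=1..m. integral {0..1} (w i))"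
  have "W \<ge> 0" unfolding W_def
    by (intro sum_nonneg integral_nonneg integrable_continuous_interval cont_w w_nonneg)
  have "(\<Sum>i=1..m. integral {0..1} (\<lambda>t. (k - kappa i t) * w i t))
      = (\<Sum>i=1..m. k * integral {0..1} (w i) - integral {0..1} (\<lambda>t. kappa i t * w i t))"
  proof (rule sum.cong[OF refl])
    fix i assume i: "i \<in> {1..m}"
    have "(\<lambda>t. k * w i t) integrable_on {0..1}" "(\<lambda>t. kappa i t * w i t) integrable_on {0..1}"
      by (intro integrable_continuous_interval continuous_intros cont_kappa cont_w i)+
    from integral_diff[OF this] show "integral {0..1} (\<lambda>t. (k - kappa i t) * w i t)
        = k * integral {0..1} (w i) - integral {0..1} (\<lambda>t. kappa i t * w i t)"
      by (simp add: left_diff_distrib)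
  qed
  also have "\<dots> = k * W - perimeter m \<gamma>"
    unfolding sum_subtractf sum_distrib_left[symmetric] W_def mk ..
  finally have eq: "(\<Sum>i=1..m. integral {0..1} (\<lambda>t. (k - kappa i t) * w i t)) = k * W - perimeter m \<gamma>" .
  moreover have "(\<Sum>i=1..m. integral {0..1} (\<lambda>t. (k - kappa i t) * w i t)) \<ge> 0"
    by (intro sum_nonneg int_nonneg)
  \<comment> \<open>Positivity of \<open>k\<close> is obtained here; it allows the area estimate for
    \<open>W\<close> to be multiplied by \<open>k\<close>.\<close>
  ultimately have "k * W > 0" using perimeter_pos by linarith
  then have kpos: "k > 0" using \<open>W \<ge> 0\<close> by (simp add: zero_less_mult_iff)
  have "k * W \<le> k * (2 * measure lebesgue \<Omega>)"
    using sum_w_le kpos by (intro mult_left_mono) (simp_all add: W_def)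
  \<comment> \<open>The opposite inequality: a sum of nonnegative integrals is squeezed to zero, and
    so is each of them.\<close>
  then have "(\<Sum>i=1..m. integral {0..1} (\<lambda>t. (k - kappa i t) * w i t)) \<le> 0" using k eq by simp
  then have "(\<Sum>i=1..m. integral {0..1} (\<lambda>t. (k - kappa i t) * w i t)) = 0"
    using \<open>(\<Sum>i=1..m. integral {0..1} (\<lambda>t. (k - kappa i t) * w i t)) \<ge> 0\<close> by linarith
  then have z: "integral {0..1} (\<lambda>t. (k - kappa i t) * w i t) = 0" if "i \<in> {1..m}" for i
    using sum_nonneg_eq_0_iff[of "{1..m}" "\<lambda>i. integral {0..1} (\<lambda>t. (k - kappa i t) * w i t)"] int_nonneg that
    by blast
  have "kappa i t = k" if i: "i \<in> {1..m}" and t: "t \<in> {0<..<1}" for i t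
  proof -
    have "\<forall>t\<in>{0..1}. (k - kappa i t) * w i t = 0"
      using z[OF i] integral_eq_0_iff[OF kw[OF i] zero_less_one nonneg[OF i]] by blast
    then have "(k - kappa i t) * w i t = 0" using t by auto
    then show ?thesis using w_pos[OF i t] by simp
  qed
  with constant_curvature_imp_ball[OF C1 kpos] show ?thesis by blast
qed

text \<open>Twice the gap in this inequality is the square of 1 - \<lambda>\<kappa>, so equality
  means that the cut point is the center of curvature.\<close>

lemma phi_curvature_le: "phi \<Omega> m \<gamma> z * curvature \<Omega> m \<gamma> z \<le> 1/2"
proof -
  have "0 \<le> (1 - cut_value \<Omega> m \<gamma> z * curvature \<Omega> m \<gamma> z)\<^sup>2" by simp
  then show ?thesis unfolding phi_def by (simp add: power2_eq_square algebra_simps)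
qed

lemma ball_of_max_curvature:
  assumes C1: "C1_boundary m \<gamma>" and z0: "z0 \<in> frontier \<Omega> - corners m y"
    and max: "\<And>z. z \<in> frontier \<Omega> - corners m y \<Longrightarrow> curvature \<Omega> m \<gamma> z \<le> curvature \<Omega> m \<gamma> z0"
    and phi: "phi \<Omega> m \<gamma> z0 \<ge> measure lebesgue \<Omega> / perimeter m \<gamma>"
  shows "\<exists>c r. r > 0 \<and> \<Omega> = ball c r"
proof (rule rigidity)
  show "T i 1 = T (csuc m i) 0" if "i \<in> {1..m}" for i
    using C1 that unfolding C1_boundary_def T_def D_def by blast
  show "kappa i t \<le> curvature \<Omega> m \<gamma> z0" if "i \<in> {1..m}" "t \<in> {0<..<1}" for i t
    using max[OF not_corner[OF that]] curvature_kappa[OF that] by simp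
  let ?k = "curvature \<Omega> m \<gamma> z0"
  show "2 * ?k * measure lebesgue \<Omega> \<le> perimeter m \<gamma>"
  \<comment> \<open>The lower bound on \<open>phi\<close> may be multiplied by the curvature only if
    that is nonnegative; for a negative maximum the left side is at most 0.\<close>
  proof (cases "?k \<ge> 0")
    case True
    then have "?k * (measure lebesgue \<Omega> / perimeter m \<gamma>) \<le> 1/2"
      using mult_left_mono[OF phi, of ?k] phi_curvature_le[of z0] by (simp add: mult.commute)
    then show ?thesis using perimeter_pos by (simp add: field_simps)
  next
    case False
    then have "?k * measure lebesgue \<Omega> \<le> 0" using area_pos by (simp add: mult_le_0_iff)
    then show ?thesis using perimeter_pos by linarith
  qed
qed

text \<open>If the center were elsewhere, the difference \<open>v\<close> between its position and
  the expected one would have negative component along the normal, hence point into \<Omega>, and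
  also point into the exterior ball.\<close>

lemma exterior_center:
  assumes i: "i \<in> {1..m}" and t: "t \<in> {0<..<1}" and r: "r > 0"
    and p: "dist p (\<gamma> i t) = r" "ball p r \<inter> \<Omega> = {}"
  shows "p - \<gamma> i t = r *\<^sub>R nu i t"
proof (rule ccontr)
  assume neq: "p - \<gamma> i t \<noteq> r *\<^sub>R nu i t"
  define q where "q = p - \<gamma> i t"
  define n where "n = nu i t"
  have n1: "n \<bullet> n = 1" using norm_nu[OF i, of t] t by (simp add: n_def norm_eq_1)
  have qq: "q \<bullet> q = r * r" using p(1) by (simp add: q_def dist_norm power2_norm_eq_inner[symmetric] power2_eq_square)
  have "0 < (q - r *\<^sub>R n) \<bullet> (q - r *\<^sub>R n)" using neq by (simp add: q_def n_def)
  also have "\<dots> = 2 * r * (r - q \<bullet> n)"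
    by (simp add: inner_diff_left inner_diff_right qq n1 inner_commute algebra_simps)
  finally have lt: "q \<bullet> n < r" using r by (simp add: zero_less_mult_iff)
  define v where "v = q - r *\<^sub>R n"
  have "v \<bullet> n < 0" using lt by (simp add: v_def inner_diff_left n1)
  then have "\<forall>\<^sub>F s in at_right 0. \<gamma> i t + s *\<^sub>R v \<in> \<Omega>"
    using normal_in[OF i t, of v] normal_eq[OF i t] by (simp add: n_def)
  moreover have "v \<bullet> (p - \<gamma> i t) > 0"
  proof -
    have "v \<bullet> q = r * (r - q \<bullet> n)" by (simp add: v_def inner_diff_left qq inner_commute algebra_simps)
    then show ?thesis using lt r by (simp add: q_def)
  qed
  from eventually_in_ball_direction[OF p(1) this]
  have "\<forall>\<^sub>F s in at_right 0. \<gamma> i t + s *\<^sub>R v \<in> ball p r" .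
  ultimately have "\<forall>\<^sub>F s in at_right (0::real). False" by eventually_elim (use p in auto)
  then show False by simp
qed

text \<open>\<open>dist_bd\<close> is an unsigned distance and only shows that the ball is free of
  frontier. Short inner normal segments, which lie in the ball and in \<Omega>, decide the
  side.\<close>

lemma inner_ball_subset:
  assumes "i \<in> {1..m}" "t \<in> {0<..<1}" "s > 0" "dist_bd \<Omega> (\<gamma> i t - s *\<^sub>R nu i t) = s"
  shows "ball (\<gamma> i t - s *\<^sub>R nu i t) s \<subseteq> \<Omega>"
proof -
  define x where "x = \<gamma> i t - s *\<^sub>R nu i t"
  have n: "norm (nu i t) = 1" using norm_nu[of i t] assms by auto
  then have n1: "nu i t \<bullet> nu i t = 1" by (simp add: norm_eq_1)
  have "ball x s \<inter> frontier \<Omega> = {}"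
    using infdist_le[of _ "frontier \<Omega>" x] assms(4) by (force simp: dist_bd_def x_def)
  then have "ball x s \<subseteq> \<Omega> \<or> ball x s \<inter> \<Omega> = {}" by (intro connected_frontier_free) auto
  moreover have "ball x s \<inter> \<Omega> \<noteq> {}"
  proof -
    have "\<forall>\<^sub>F e in at_right 0. \<gamma> i t + e *\<^sub>R (- nu i t) \<in> ball x s"
      by (rule eventually_in_ball_direction) (use assms(3) n n1 in \<open>auto simp: x_def dist_norm\<close>)
    moreover have "\<forall>\<^sub>F e in at_right 0. \<gamma> i t + e *\<^sub>R (- nu i t) \<in> \<Omega>"
      by (rule normal_in[OF assms(1,2)]) (use normal_eq[OF assms(1,2)] n1 in simp)
    ultimately have "\<forall>\<^sub>F e in at_right 0. \<gamma> i t + e *\<^sub>R (- nu i t) \<in> ball x s \<inter> \<Omega>"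
      by eventually_elim simp
    then show ?thesis using eventually_happens[of _ "at_right (0::real)"] trivial_limit_at_right_real by blast
  qed
  ultimately show ?thesis unfolding x_def by blast
qed

text \<open>The squared distance to the center of the touching interior ball is minimal at the point of
  contact, where its second derivative is \<open>2\<bar>\<gamma>'\<bar>\<^sup>2(1 - s\<kappa>)\<close>.\<close>
lemma cut_curvature_le:
  assumes i: "i \<in> {1..m}" and t0: "t0 \<in> {0<..<1}" and s: "s \<ge> 0" "dist_bd \<Omega> (\<gamma> i t0 - s *\<^sub>R nu i t0) = s"
  shows "s * kappa i t0 \<le> 1"
proof -
  define x where "x = \<gamma> i t0 - s *\<^sub>R nu i t0"
  have n: "norm (nu i t0) = 1" using norm_nu[OF i, of t0] t0 by auto
  have nD: "nu i t0 \<bullet> D i t0 = 0" by (subst D_eq) (simp add: nu_def)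
  have Dn: "D i t0 \<noteq> 0" using D_nz[OF i, of t0] t0 by auto
  have "2 * (D i t0 \<bullet> D i t0 + (\<gamma> i t0 - x) \<bullet> DD i t0) \<ge> 0"
  proof (rule second_derivative_min[where g' = "\<lambda>t. 2 * ((\<gamma> i t - x) \<bullet> D i t)"])
    show "open {0<..<1::real}" "t0 \<in> {0<..<1}" using t0 by auto
    show "((\<lambda>t. (\<gamma> i t - x) \<bullet> (\<gamma> i t - x)) has_real_derivative 2 * ((\<gamma> i t - x) \<bullet> D i t)) (at t)"
      if "t \<in> {0<..<1}" for t
      using has_D_at[OF i that] unfolding has_vector_derivative_def has_field_derivative_def
      by (auto intro!: derivative_eq_intros simp: fun_eq_iff inner_commute algebra_simps)
    show "((\<lambda>t. 2 * ((\<gamma> i t - x) \<bullet> D i t)) has_real_derivative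
        2 * (D i t0 \<bullet> D i t0 + (\<gamma> i t0 - x) \<bullet> DD i t0)) (at t0)"
      using has_D_at[OF i t0] has_DD_at[OF i t0] unfolding has_vector_derivative_def has_field_derivative_def
      by (auto intro!: derivative_eq_intros simp: fun_eq_iff inner_commute algebra_simps)
    show "2 * ((\<gamma> i t0 - x) \<bullet> D i t0) = 0" by (simp add: x_def nD)
    show "(\<gamma> i t0 - x) \<bullet> (\<gamma> i t0 - x) \<le> (\<gamma> i t - x) \<bullet> (\<gamma> i t - x)" if t: "t \<in> {0<..<1}" for t
    proof -
      have "s \<le> dist x (\<gamma> i t)"
        using infdist_le[OF in_frontier[OF i], of t x] t s(2) by (auto simp: dist_bd_def x_def)
      then have "norm (\<gamma> i t0 - x) \<le> norm (\<gamma> i t - x)"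
        using s(1) n by (simp add: x_def dist_norm norm_minus_commute)
      then show ?thesis by (simp add: power2_norm_eq_inner[symmetric] power_mono)
    qed
  qed
  then have "0 \<le> (norm (D i t0))\<^sup>2 + s * (nu i t0 \<bullet> DD i t0)"
    by (simp add: x_def power2_norm_eq_inner)
  moreover have "nu i t0 \<bullet> DD i t0 = - kappa i t0 * (norm (D i t0))\<^sup>2"
    using Dn by (simp add: kappa_def inner_commute)
  ultimately have "0 \<le> (1 - s * kappa i t0) * (norm (D i t0))\<^sup>2" by (simp add: algebra_simps)
  then show ?thesis using Dn by (simp add: zero_le_mult_iff)
qed

text \<open>The set is closed, and it is bounded because a positive value puts the center into the
  bounded set \<Omega>; hence the supremum in \<open>cut_value\<close> is attained.\<close>

lemma cut_segment:
  assumes i: "i \<in> {1..m}" and t: "t \<in> {0<..<1}"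
  shows "{s. s \<ge> 0 \<and> dist_bd \<Omega> (\<gamma> i t - s *\<^sub>R nu i t) = s} = {0..cut_value \<Omega> m \<gamma> (\<gamma> i t)}"
    and "cut_value \<Omega> m \<gamma> (\<gamma> i t) \<ge> 0"
proof -
  define C where "C = {s. s \<ge> 0 \<and> dist_bd \<Omega> (\<gamma> i t - s *\<^sub>R nu i t) = s}"
  have cv: "cut_value \<Omega> m \<gamma> (\<gamma> i t) = Sup C"
    unfolding cut_value_def normal_eq(1)[OF i t] C_def ..
  have n: "norm (nu i t) = 1" using norm_nu[OF i, of t] t by auto
  have f: "\<gamma> i t \<in> frontier \<Omega>" using in_frontier[OF i, of t] t by auto
  have zero: "0 \<in> C" using f by (simp add: C_def dist_bd_def)
  obtain M where M: "\<And>x. x \<in> closure \<Omega> \<Longrightarrow> norm x \<le> M"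
    using bdd bounded_closure bounded_iff by metis
  have bd: "s \<le> 2 * M" if "s \<in> C" for s
  proof (cases "s = 0")
    case True
    then show ?thesis using order_trans[OF norm_ge_zero M[of "\<gamma> i t"]] f unfolding frontier_def by auto
  next
    case False
    then have s: "s > 0" "dist_bd \<Omega> (\<gamma> i t - s *\<^sub>R nu i t) = s" using that by (auto simp: C_def)
    then have "\<gamma> i t - s *\<^sub>R nu i t \<in> \<Omega>" using inner_ball_subset[OF i t s] by auto
    then have "norm (\<gamma> i t - s *\<^sub>R nu i t) \<le> M" "norm (\<gamma> i t) \<le> M"
      using M f closure_subset[of \<Omega>] unfolding frontier_def by auto
    moreover have "s = norm (\<gamma> i t - (\<gamma> i t - s *\<^sub>R nu i t))" using n s by simp
    ultimately show ?thesis using norm_triangle_ineq4[of "\<gamma> i t" "\<gamma> i t - s *\<^sub>R nu i t"] by linarith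
  qed
  then have bda: "bdd_above C" by (rule bdd_aboveI)
  have "closed ({0..} \<inter> (\<lambda>s. dist_bd \<Omega> (\<gamma> i t - s *\<^sub>R nu i t) - s) -` {0})"
    unfolding dist_bd_def by (intro continuous_closed_preimage continuous_intros closed_atLeast closed_singleton)
  also have "{0..} \<inter> (\<lambda>s. dist_bd \<Omega> (\<gamma> i t - s *\<^sub>R nu i t) - s) -` {0} = C" by (auto simp: C_def)
  finally have SC: "Sup C \<in> C" using closed_contains_Sup[OF _ bda] zero by blast
  then show ge: "cut_value \<Omega> m \<gamma> (\<gamma> i t) \<ge> 0" by (simp add: cv C_def)
  have "s \<in> C" if s: "0 \<le> s" "s \<le> Sup C" for s
  proof -
    define L where "L = Sup C"
    \<comment> \<open>The distance to the frontier is 1-Lipschitz: being \<open>L\<close> at depth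
      \<open>L\<close>, it is at least \<open>s\<close> at depth \<open>s\<close>.\<close>
    have "infdist (\<gamma> i t - L *\<^sub>R nu i t) (frontier \<Omega>)
      \<le> infdist (\<gamma> i t - s *\<^sub>R nu i t) (frontier \<Omega>) + dist (\<gamma> i t - L *\<^sub>R nu i t) (\<gamma> i t - s *\<^sub>R nu i t)"
      by (rule infdist_triangle)
    moreover have "dist (\<gamma> i t - L *\<^sub>R nu i t) (\<gamma> i t - s *\<^sub>R nu i t) = L - s"
    proof -
      have "dist (\<gamma> i t - L *\<^sub>R nu i t) (\<gamma> i t - s *\<^sub>R nu i t) = norm ((s - L) *\<^sub>R nu i t)"
        by (simp add: dist_norm algebra_simps)
      then show ?thesis using n s by (simp add: L_def)
    qed
    moreover have "infdist (\<gamma> i t - L *\<^sub>R nu i t) (frontier \<Omega>) = L" using SC by (simp add: C_def L_def dist_bd_def)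
    ultimately have "s \<le> infdist (\<gamma> i t - s *\<^sub>R nu i t) (frontier \<Omega>)" by linarith
    moreover have "infdist (\<gamma> i t - s *\<^sub>R nu i t) (frontier \<Omega>) \<le> s"
      using infdist_le[OF f, of "\<gamma> i t - s *\<^sub>R nu i t"] n s by (simp add: dist_norm)
    ultimately show ?thesis using s by (simp add: C_def dist_bd_def)
  qed
  moreover have "0 \<le> s \<and> s \<le> Sup C" if "s \<in> C" for s
    using cSup_upper[OF that bda] that by (simp add: C_def)
  ultimately have "s \<in> C \<longleftrightarrow> s \<in> {0..Sup C}" for s unfolding atLeastAtMost_iff by blast
  then have "C = {0..Sup C}" by (rule set_eqI)
  then show "{s. s \<ge> 0 \<and> dist_bd \<Omega> (\<gamma> i t - s *\<^sub>R nu i t) = s} = {0..cut_value \<Omega> m \<gamma> (\<gamma> i t)}"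
    unfolding C_def[symmetric] cv .
qed

end

section \<open>The area swept by inner normals\<close>

context starshaped_domain
begin

definition collar_map :: "nat \<Rightarrow> real^2 \<Rightarrow> real^2" where
  "collar_map i x = \<gamma> i (x$1) - x$2 *\<^sub>R nu i (x$1)"

text \<open>Phrased by the distance rather than by \<open>cut_value\<close>, so that measurability
  follows from continuity alone.\<close>

definition collar_dom :: "nat \<Rightarrow> (real^2) set" where
  "collar_dom i = {x. x$1 \<in> {0<..<1} \<and> x$2 \<ge> 0 \<and> dist_bd \<Omega> (collar_map i x) = x$2}"

lemma collar_dom_cut:
  assumes i: "i \<in> {1..m}" and x: "x$1 \<in> {0<..<1}"
  shows "x \<in> collar_dom i \<longleftrightarrow> x$2 \<in> {0..cut_value \<Omega> m \<gamma> (\<gamma> i (x$1))}"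
  using cut_segment(1)[OF i x] x unfolding collar_dom_def collar_map_def by blast

lemma collar_dom_borel:
  assumes i: "i \<in> {1..m}"
  shows "collar_dom i \<in> sets borel"
proof -
  define U where "U = (\<lambda>x::real^2. x$1) -` {0<..<1}"
  have U: "open U" unfolding U_def by (intro open_vimage continuous_intros open_greaterThanLessThan)
  have "continuous_on U (\<lambda>x. \<gamma> i (x$1))" "continuous_on U (\<lambda>x. nu i (x$1))"
    by (rule continuous_on_compose2[OF cont_\<gamma>[OF i]] continuous_on_compose2[OF cont_nu[OF i]];
        auto intro!: continuous_intros simp: U_def)+
  then have "continuous_on U (\<lambda>x. dist_bd \<Omega> (collar_map i x) - x$2)"
    unfolding dist_bd_def collar_map_def by (intro continuous_intros)
  then have "closedin (top_of_set U) (U \<inter> (\<lambda>x. dist_bd \<Omega> (collar_map i x) - x$2) -` {0})"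
    by (intro continuous_closedin_preimage) simp_all
  then obtain K where K: "closed K" "U \<inter> (\<lambda>x. dist_bd \<Omega> (collar_map i x) - x$2) -` {0} = U \<inter> K"
    unfolding closedin_closed by blast
  have "closed ((\<lambda>x::real^2. x$2) -` {0..})" by (intro closed_vimage continuous_intros closed_atLeast)
  then have "U \<inter> K \<inter> (\<lambda>x. x$2) -` {0..} \<in> sets borel" using U K by auto
  also have "U \<inter> K \<inter> (\<lambda>x. x$2) -` {0..} = collar_dom i"
    unfolding K(2)[symmetric] by (auto simp: collar_dom_def U_def)
  finally show ?thesis .
qed

text \<open>The Jacobian is \<open>(1 - s \<kappa>)\<close> times the speed, nonnegative up to the
  cut value, and its integral over the normal segment is \<phi> times the speed by definition of
  \<phi>. The area formula is used as an inequality, so injectivity of the map is not at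
  issue.\<close>

lemma collar_area:
  assumes i: "i \<in> {1..m}"
    and phi: "\<And>t. t \<in> {0<..<1} \<Longrightarrow> phi \<Omega> m \<gamma> (\<gamma> i t) = c"
  shows "collar_map i ` collar_dom i \<in> lmeasurable"
    and "measure lebesgue (collar_map i ` collar_dom i) \<le> c * integral {0..1} (\<lambda>t. norm (D i t))"
proof -
  let ?S = "collar_dom i"
  define F' where "F' x = (\<lambda>h::real^2. h$1 *\<^sub>R ((1 - x$2 * kappa i (x$1)) *\<^sub>R D i (x$1)) + h$2 *\<^sub>R (- nu i (x$1)))" for x :: "real^2"
  have S01: "x$1 \<in> {0<..<1}" if "x \<in> ?S" for x using that by (simp add: collar_dom_def)
  have le1: "x$2 * kappa i (x$1) \<le> 1" if x: "x \<in> ?S" for x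
    using cut_curvature_le[OF i S01[OF x], of "x$2"] x by (simp add: collar_dom_def collar_map_def)
  have der: "(collar_map i has_derivative F' x) (at x within ?S)" if x: "x \<in> ?S" for x
  proof -
    have t: "x$1 \<in> {0<..<1}" by (rule S01[OF x])
    have p1: "((\<lambda>x::real^2. x$1) has_derivative (\<lambda>h. h$1)) (at x within ?S)"
      by (rule bounded_linear_imp_has_derivative[OF bounded_linear_vec_nth])
    have p2: "((\<lambda>x::real^2. x$2) has_derivative (\<lambda>h. h$2)) (at x within ?S)"
      by (rule bounded_linear_imp_has_derivative[OF bounded_linear_vec_nth])
    have nd: "(nu i has_vector_derivative kappa i (x$1) *\<^sub>R D i (x$1)) (at (x$1))"
      using nu_deriv[OF i, of "x$1"] t by (auto simp: at_within_Icc_at)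
    have d1: "((\<lambda>x. \<gamma> i (x$1)) has_derivative (\<lambda>h. (h$1) *\<^sub>R D i (x$1))) (at x within ?S)"
      by (rule has_derivative_compose[OF p1 has_D_at[OF i t, unfolded has_vector_derivative_def]])
    have d2: "((\<lambda>x. nu i (x$1)) has_derivative (\<lambda>h. (h$1) *\<^sub>R (kappa i (x$1) *\<^sub>R D i (x$1)))) (at x within ?S)"
      by (rule has_derivative_compose[OF p1 nd[unfolded has_vector_derivative_def]])
    have "((\<lambda>x. \<gamma> i (x$1) - x$2 *\<^sub>R nu i (x$1)) has_derivative
       (\<lambda>h. (h$1) *\<^sub>R D i (x$1) - (x$2 *\<^sub>R ((h$1) *\<^sub>R (kappa i (x$1) *\<^sub>R D i (x$1))) + (h$2) *\<^sub>R nu i (x$1)))) (at x within ?S)"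
      by (rule has_derivative_diff[OF d1 has_derivative_scaleR[OF p2 d2]])
    then show ?thesis unfolding collar_map_def[abs_def] F'_def
      by (rule has_derivative_eq_rhs) (simp add: fun_eq_iff algebra_simps)
  qed
  define q where "q x = (1 - x$2 * kappa i (x$1)) * norm (D i (x$1))" for x :: "real^2"
  have det: "\<bar>det (matrix (F' x))\<bar> = q x" if x: "x \<in> ?S" for x
  proof -
    have t: "x$1 \<in> {0..1}" using S01[OF x] by simp
    have "T i (x$1) \<bullet> T i (x$1) = 1" using norm_T[OF i t] by (simp add: norm_eq_1)
    then have "rot (D i (x$1)) \<bullet> nu i (x$1) = eps i * norm (D i (x$1))"
      by (subst D_eq) (simp add: nu_def rot_scaleR)
    then show ?thesis unfolding F'_def det_matrix_real2 q_def
      using le1[OF x] eps_cases[of i] by (auto simp: rot_scaleR abs_mult)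
  qed
  have q0: "q x \<ge> 0" if "x \<in> ?S" for x using le1[OF that] by (simp add: q_def)
  define f where "f x = (if x \<in> ?S then q x else 0)" for x
  define h where "h a = (if a \<in> {0<..<1} then c * norm (D i a) else 0)" for a
  define I where "I = c * integral {0..1} (\<lambda>t. norm (D i t))"
  have "(f has_integral I) UNIV"
  proof (rule has_integral_iterated_real2)
    have c1: "continuous_on ?S (\<lambda>x. kappa i (x$1))"
      by (rule continuous_on_compose2[OF cont_kappa[OF i]]) (auto intro!: continuous_intros simp: collar_dom_def)
    have c2: "continuous_on ?S (\<lambda>x. D i (x$1))"
      by (rule continuous_on_compose2[OF cont_D[OF i]]) (auto intro!: continuous_intros simp: collar_dom_def)
    have "continuous_on ?S q" unfolding q_def by (intro continuous_intros c1 c2)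
    then show "f \<in> borel_measurable borel" unfolding f_def
      by (intro borel_measurable_continuous_on_if collar_dom_borel[OF i] continuous_on_const)
    show "f x \<ge> 0" for x using q0 by (simp add: f_def)
    show "((\<lambda>b. f (vector [a, b])) has_integral h a) UNIV" for a
    proof (cases "a \<in> {0<..<1}")
      case True
      define l where "l = cut_value \<Omega> m \<gamma> (\<gamma> i a)"
      have l: "l \<ge> 0" unfolding l_def by (rule cut_segment(2)[OF i True])
      have "((\<lambda>b. 1 - b * kappa i a) has_integral (l - 0) - (l\<^sup>2 - 0\<^sup>2) / 2 * kappa i a) {0..l}"
        using has_integral_diff[OF has_integral_const_real[of 1 0 l] has_integral_mult_left[OF ident_has_integral[OF l]]] l
        by simp
      from has_integral_mult_left[OF this, of "norm (D i a)"]
      have "((\<lambda>b. (1 - b * kappa i a) * norm (D i a)) has_integral phi \<Omega> m \<gamma> (\<gamma> i a) * norm (D i a)) {0..l}"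
        by (simp add: phi_def l_def curvature_kappa[OF i True])
      then have "((\<lambda>b. if b \<in> {0..l} then (1 - b * kappa i a) * norm (D i a) else 0) has_integral h a) UNIV"
        unfolding has_integral_restrict_UNIV phi[OF True] using True by (simp add: h_def)
      moreover have "f (vector [a, b]) = (if b \<in> {0..l} then (1 - b * kappa i a) * norm (D i a) else 0)" for b
        using collar_dom_cut[OF i, of "vector [a, b]"] True by (simp add: f_def q_def l_def)
      ultimately show ?thesis by simp
    next
      case False
      then have "vector [a, b] \<notin> ?S" for b by (auto simp: collar_dom_def)
      moreover have "h a = 0" unfolding h_def using False by (rule if_not_P)
      ultimately show ?thesis by (simp add: f_def)
    qed
    have "((\<lambda>t. norm (D i t)) has_integral integral {0..1} (\<lambda>t. norm (D i t))) {0..1}"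
      by (intro integrable_integral integrable_continuous_interval continuous_intros cont_D[OF i])
    from has_integral_mult_right[OF this, of c]
    have "((\<lambda>a. if a \<in> {0..1} then c * norm (D i a) else 0) has_integral I) UNIV"
      unfolding has_integral_restrict_UNIV I_def .
    then show "(h has_integral I) UNIV"
      by (rule has_integral_spike[of "{0,1}", rotated 2]) (auto simp: h_def)
  qed
  then have "(q has_integral I) ?S" unfolding f_def has_integral_restrict_UNIV .
  then have hi: "((\<lambda>x. \<bar>det (matrix (F' x))\<bar>) has_integral I) ?S"
    by (rule has_integral_eq[rotated]) (simp add: det)
  have Sl: "?S \<in> sets lebesgue" using collar_dom_borel[OF i] by simp
  have int: "(\<lambda>x. \<bar>det (matrix (F' x))\<bar>) integrable_on ?S" using hi by (rule has_integral_integrable)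
  show "collar_map i ` ?S \<in> lmeasurable" by (rule measurable_differentiable_image[OF Sl der int])
  show "measure lebesgue (collar_map i ` ?S) \<le> c * integral {0..1} (\<lambda>t. norm (D i t))"
    using measure_differentiable_image[OF Sl der int] hi by (simp add: integral_unique I_def)
qed

text \<open>By the exterior sphere condition, the points of \<open>\<Omega>\<close> nearest to a given corner lie on a line,
  so the normal segments of the arcs cover \<open>\<Omega>\<close> up to a null set.\<close>
lemma collar_cover:
  obtains N where "negligible N" "\<Omega> \<subseteq> (\<Union>i\<in>{1..m}. collar_map i ` collar_dom i) \<union> N"
proof -
  have "\<exists>p. \<exists>r>0. dist p (y i) = r \<and> ball p r \<inter> \<Omega> = {}" if "i \<in> {1..m}" for i
    using ext_sphere[OF corner_in_frontier[OF that]] by metis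
  then obtain p where p: "\<And>i. i \<in> {1..m} \<Longrightarrow> \<exists>r>0. dist (p i) (y i) = r \<and> ball (p i) r \<inter> \<Omega> = {}"
    by metis
  \<comment> \<open>The line through the corner and the center of one exterior ball chosen for
    it.\<close>
  define H where "H i = {x. rot (y i - p i) \<bullet> x = rot (y i - p i) \<bullet> y i}" for i
  have "negligible (H i)" if i: "i \<in> {1..m}" for i
  proof -
    have "y i \<noteq> p i" using p[OF i] by auto
    then have "norm (rot (y i - p i)) \<noteq> 0" by simp
    then have "rot (y i - p i) \<noteq> 0" by (metis norm_zero)
    then show ?thesis unfolding H_def by (intro negligible_hyperplane) simp
  qed
  then have "negligible (\<Union>i\<in>{1..m}. H i)" by (intro negligible_Union) auto
  moreover have "\<Omega> \<subseteq> (\<Union>i\<in>{1..m}. collar_map i ` collar_dom i) \<union> (\<Union>i\<in>{1..m}. H i)"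
  proof
    fix x assume x: "x \<in> \<Omega>"
    have ne: "frontier \<Omega> \<noteq> {}" using in_frontier[of 1 0] m_ge_1 by auto
    have xf: "x \<notin> frontier \<Omega>" using x opn frontier_disjoint_eq by blast
    obtain z where z: "z \<in> frontier \<Omega>" "infdist x (frontier \<Omega>) = dist x z"
      using infdist_attains_inf[OF frontier_closed ne] by blast
    define d where "d = dist x z"
    have d: "d > 0" using xf z by (auto simp: d_def)
    have "ball x d \<inter> frontier \<Omega> = {}"
      using infdist_le[of _ "frontier \<Omega>" x] z by (force simp: d_def)
    then have "ball x d \<subseteq> \<Omega> \<or> ball x d \<inter> \<Omega> = {}" by (intro connected_frontier_free) auto
    \<comment> \<open>An interior ball that reaches the frontier at \<open>z\<close>. Touching an
      exterior ball there, it fixes the direction in which \<open>x\<close> lies as seen from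
      \<open>z\<close>.\<close>
    then have sub: "ball x d \<subseteq> \<Omega>" using x d centre_in_ball[of x d] by blast
    show "x \<in> (\<Union>i\<in>{1..m}. collar_map i ` collar_dom i) \<union> (\<Union>i\<in>{1..m}. H i)"
    proof (cases "z \<in> corners m y")
      case True
      then obtain i where i: "i \<in> {1..m}" "z = y i" unfolding corners_def by blast
      obtain r where r: "r > 0" "dist (p i) (y i) = r" "ball (p i) r \<inter> \<Omega> = {}" using p[OF i(1)] by blast
      have "r *\<^sub>R (x - y i) = d *\<^sub>R (y i - p i)"
        by (rule touching_balls) (use r d i sub in \<open>auto simp: d_def\<close>)
      then have "r * (rot (y i - p i) \<bullet> (x - y i)) = d * (rot (y i - p i) \<bullet> (y i - p i))"
        by (metis inner_scaleR_right)
      then have "rot (y i - p i) \<bullet> (x - y i) = 0" using r by simp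
      then have "x \<in> H i" by (simp add: H_def inner_diff_right)
      then show ?thesis using i by blast
    next
      case False
      then obtain i t where i: "i \<in> {1..m}" and t: "t \<in> {0<..<1}" and zt: "z = \<gamma> i t"
        using not_corner_obtain z(1) by blast
      obtain r p where r: "r > 0" "dist p z = r" "ball p r \<inter> \<Omega> = {}" by (rule ext_sphere[OF z(1)])
      have "r *\<^sub>R (x - z) = d *\<^sub>R (z - p)"
        by (rule touching_balls) (use r d sub in \<open>auto simp: d_def\<close>)
      moreover have "p - z = r *\<^sub>R nu i t"
        using exterior_center[OF i t r(1)] r zt by blast
      then have "z - p = - (r *\<^sub>R nu i t)" by (metis minus_diff_eq)
      ultimately have "r *\<^sub>R (x - z) = r *\<^sub>R (- (d *\<^sub>R nu i t))" by (simp add: mult.commute)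
      then have "x - z = - (d *\<^sub>R nu i t)" unfolding scaleR_cancel_left using r(1) by blast
      then have xe: "x = \<gamma> i t - d *\<^sub>R nu i t" unfolding zt by (simp add: algebra_simps)
      have "x = collar_map i (vector [t, d])" using xe by (simp add: collar_map_def)
      moreover have "vector [t, d] \<in> collar_dom i"
      proof -
        have "infdist x (frontier \<Omega>) = d" using z(2) by (simp add: d_def)
        then have "infdist (\<gamma> i t - d *\<^sub>R nu i t) (frontier \<Omega>) = d" using xe by simp
        then show ?thesis using t d by (simp add: collar_dom_def collar_map_def dist_bd_def)
      qed
      ultimately show ?thesis using i by blast
    qed
  qed
  ultimately show thesis by (rule that)
qed

section \<open>Consequences of a constant \<phi>\<close>

lemma area_le:
  assumes phi: "\<And>z. z \<in> frontier \<Omega> - corners m y \<Longrightarrow> phi \<Omega> m \<gamma> z = c"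
  shows "measure lebesgue \<Omega> \<le> c * perimeter m \<gamma>"
proof -
  obtain N where N: "negligible N" "\<Omega> \<subseteq> (\<Union>i\<in>{1..m}. collar_map i ` collar_dom i) \<union> N"
    by (rule collar_cover)
  have phi': "phi \<Omega> m \<gamma> (\<gamma> i t) = c" if "i \<in> {1..m}" "t \<in> {0<..<1}" for i t
    using phi not_corner[OF that] by blast
  note A = collar_area[OF _ phi']
  have U: "(\<Union>i\<in>{1..m}. collar_map i ` collar_dom i) \<in> lmeasurable"
    using A(1) by (intro fmeasurable.finite_UN) auto
  have Nl: "N \<in> lmeasurable" "measure lebesgue N = 0" using N(1) negligible_iff_measure by auto
  have "measure lebesgue \<Omega> \<le> measure lebesgue ((\<Union>i\<in>{1..m}. collar_map i ` collar_dom i) \<union> N)"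
    by (rule measure_mono_fmeasurable[OF N(2)]) (use U Nl opn in auto)
  also have "\<dots> \<le> measure lebesgue (\<Union>i\<in>{1..m}. collar_map i ` collar_dom i) + measure lebesgue N"
    by (rule measure_Un_le) (use U Nl in auto)
  also have "\<dots> = measure lebesgue (\<Union>i\<in>{1..m}. collar_map i ` collar_dom i)" using Nl by simp
  also have "\<dots> \<le> (\<Sum>i\<in>{1..m}. measure lebesgue (collar_map i ` collar_dom i))"
    by (rule measure_UNION_le) (use A(1) in auto)
  also have "\<dots> \<le> (\<Sum>i=1..m. c * integral {0..1} (\<lambda>t. norm (D i t)))"
    by (intro sum_mono A(2))
  also have "\<dots> = c * perimeter m \<gamma>" by (simp add: perimeter_eq sum_distrib_left)
  finally show ?thesis .
qed

text \<open>A small cut value would make \<phi> small, since the curvature is bounded on the closed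
  arc. So the cut value has a positive lower bound, and the resulting interior balls persist in the
  limit at the ends.\<close>

lemma interior_ball_closed_arc:
  assumes i: "i \<in> {1..m}" and phi: "\<And>t. t \<in> {0<..<1} \<Longrightarrow> phi \<Omega> m \<gamma> (\<gamma> i t) = c" and c: "c > 0"
  shows "\<exists>\<delta>>0. \<forall>t\<in>{0..1}. ball (\<gamma> i t - \<delta> *\<^sub>R nu i t) \<delta> \<subseteq> \<Omega>"
proof -
  have "bounded (kappa i ` {0..1})"
    by (intro compact_imp_bounded compact_continuous_image cont_kappa[OF i]) simp
  then obtain K where K: "K > 0" "\<And>t. t \<in> {0..1} \<Longrightarrow> \<bar>kappa i t\<bar> \<le> K"
    unfolding bounded_pos by auto
  \<comment> \<open>A cut value \<open>l \<le> 1\<close> satisfies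
    \<open>c \<le> l + l\<^sup>2 * K \<le> l * (1 + K)\<close>, so it is at least
    \<open>c / (1 + K)\<close>; the bound 1 serves to replace \<open>l\<^sup>2\<close> by
    \<open>l\<close>.\<close>
  define \<delta> where "\<delta> = min 1 (c / (1 + K))"
  have \<delta>: "\<delta> > 0" "\<delta> \<le> 1" using c K(1) by (auto simp: \<delta>_def)
  have "\<delta> \<le> c / (1 + K)" by (simp add: \<delta>_def)
  then have \<delta>c: "\<delta> * (1 + K) \<le> c" using K(1) by (simp add: pos_le_divide_eq)
  have ge: "cut_value \<Omega> m \<gamma> (\<gamma> i t) \<ge> \<delta>" if t: "t \<in> {0<..<1}" for t
  proof (rule ccontr)
    define l where "l = cut_value \<Omega> m \<gamma> (\<gamma> i t)"
    assume "\<not> ?thesis"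
    then have l: "l < \<delta>" "l \<ge> 0" using cut_segment(2)[OF i t] by (auto simp: l_def)
    have "c = l - l\<^sup>2 * kappa i t / 2"
      using phi[OF t] by (simp add: phi_def l_def curvature_kappa[OF i t])
    also have "- (l\<^sup>2 * kappa i t) \<le> l\<^sup>2 * K"
      using K(2)[of t] t mult_left_mono[of "- kappa i t" K "l\<^sup>2"] by auto
    then have "l - l\<^sup>2 * kappa i t / 2 \<le> l + l\<^sup>2 * K"
    proof -
      have "0 \<le> l\<^sup>2 * K" using K(1) by simp
      with \<open>- (l\<^sup>2 * kappa i t) \<le> l\<^sup>2 * K\<close> show ?thesis by linarith
    qed
    also have "l\<^sup>2 * K \<le> l * K"
      using l \<delta>(2) K(1) by (intro mult_right_mono) (auto simp: power2_eq_square mult_left_le)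
    then have "l + l\<^sup>2 * K \<le> l * (1 + K)" by (simp add: algebra_simps)
    also have "\<dots> < \<delta> * (1 + K)" using l K(1) by (intro mult_strict_right_mono) auto
    finally show False using \<delta>c by simp
  qed
  have sub: "ball (\<gamma> i t - \<delta> *\<^sub>R nu i t) \<delta> \<subseteq> \<Omega>" if t: "t \<in> {0<..<1}" for t
  proof (rule inner_ball_subset[OF i t \<delta>(1)])
    have "\<delta> \<in> {0..cut_value \<Omega> m \<gamma> (\<gamma> i t)}" using ge[OF t] \<delta>(1) by simp
    then show "dist_bd \<Omega> (\<gamma> i t - \<delta> *\<^sub>R nu i t) = \<delta>" unfolding cut_segment(1)[OF i t, symmetric] by blast
  qed
  have "ball (\<gamma> i t - \<delta> *\<^sub>R nu i t) \<delta> \<subseteq> \<Omega>" if t: "t \<in> {0..1}" for t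
  proof (rule ccontr)
    assume "\<not> ?thesis"
    then obtain x where x: "x \<notin> \<Omega>" "x \<in> ball (\<gamma> i t - \<delta> *\<^sub>R nu i t) \<delta>" by blast
    \<comment> \<open>For a fixed point outside \<Omega> the distance to the moving center is
      continuous, so its lower bound passes to the ends.\<close>
    have "\<delta> \<le> dist (\<gamma> i t - \<delta> *\<^sub>R nu i t) x"
    proof (rule continuous_ge_on_Ioo[where g = "\<lambda>t. dist (\<gamma> i t - \<delta> *\<^sub>R nu i t) x" and c = 0 and d = 1])
      show "continuous_on {0..1} (\<lambda>t. dist (\<gamma> i t - \<delta> *\<^sub>R nu i t) x)"
        by (intro continuous_intros cont_\<gamma>[OF i] cont_nu[OF i])
      show "\<delta> \<le> dist (\<gamma> i s - \<delta> *\<^sub>R nu i s) x" if "s \<in> {0<..<1}" for s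
        using sub[OF that] x(1) by (meson in_mono mem_ball not_le)
    qed (use t in auto)
    then show False using x by simp
  qed
  with \<delta>(1) show ?thesis by blast
qed

text \<open>A cusp, i.e. opposite tangents with equal normals, is impossible: a half disc at the corner
  would miss the frontier and meet both the interior and the exterior ball.\<close>
lemma corner_tangent_eq:
  assumes phi: "\<And>z. z \<in> frontier \<Omega> - corners m y \<Longrightarrow> phi \<Omega> m \<gamma> z = c" and c: "c > 0"
    and i: "i \<in> {1..m}"
  shows "T i 1 = T (csuc m i) 0"
proof -
  define j where "j = csuc m i"
  have j: "j \<in> {1..m}" "\<gamma> j 0 = y i" using csuc[OF i] by (auto simp: j_def)
  have yi: "\<gamma> i 1 = y i" by (rule arc(3)[OF i])
  have phi': "phi \<Omega> m \<gamma> (\<gamma> k t) = c" if "k \<in> {1..m}" "t \<in> {0<..<1}" for k t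
    using phi not_corner[OF that] by blast
  obtain r p where r: "r > 0" "dist p (y i) = r" "ball p r \<inter> \<Omega> = {}"
    by (rule ext_sphere[OF corner_in_frontier[OF i]])
  \<comment> \<open>An interior ball touching the fixed exterior ball at the corner has its normal
    along the exterior radius. Applied to both arcs, this makes their limit normals equal.\<close>
  have nrm: "p - y i = r *\<^sub>R n" if "\<delta> > 0" "norm n = 1" "ball (y i - \<delta> *\<^sub>R n) \<delta> \<subseteq> \<Omega>" for n \<delta>
  proof -
    have "r *\<^sub>R ((y i - \<delta> *\<^sub>R n) - y i) = \<delta> *\<^sub>R (y i - p)"
      by (rule touching_balls) (use that r in \<open>auto simp: dist_norm\<close>)
    then have "\<delta> *\<^sub>R (p - y i) = \<delta> *\<^sub>R (r *\<^sub>R n)" by (simp add: algebra_simps)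
    then show ?thesis unfolding scaleR_cancel_left using that(1) by blast
  qed
  obtain \<delta> where \<delta>: "\<delta> > 0" "ball (\<gamma> i 1 - \<delta> *\<^sub>R nu i 1) \<delta> \<subseteq> \<Omega>"
    using interior_ball_closed_arc[OF i phi'[OF i] c] by auto
  obtain \<delta>' where \<delta>': "\<delta>' > 0" "ball (\<gamma> j 0 - \<delta>' *\<^sub>R nu j 0) \<delta>' \<subseteq> \<Omega>"
    using interior_ball_closed_arc[OF j(1) phi'[OF j(1)] c] by auto
  define n where "n = nu i 1"
  have n: "norm n = 1" "n \<bullet> n = 1" using norm_nu[OF i, of 1] by (auto simp: n_def norm_eq_1)
  have pn: "p - y i = r *\<^sub>R n" using nrm[OF \<delta>(1) n(1)] \<delta>(2) by (simp add: n_def yi)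
  have "p - y i = r *\<^sub>R nu j 0" using nrm[OF \<delta>'(1) _] \<delta>'(2) norm_nu[OF j(1), of 0] by (simp add: j)
  then have nu: "nu j 0 = n" using pn r(1) by simp
  define T1 where "T1 = T i 1"
  have T1: "norm T1 = 1" "T1 \<bullet> T1 = 1" "T1 \<bullet> n = 0" "n \<bullet> T1 = 0"
    using norm_T[OF i, of 1] by (auto simp: T1_def norm_eq_1 n_def nu_def)
  have "rot (nu j 0) = rot n" using nu by simp
  then have "eps j *\<^sub>R T j 0 = eps i *\<^sub>R T1" by (simp add: n_def nu_def rot_scaleR T1_def)
  \<comment> \<open>The signs \<open>eps\<close> of the two arcs may differ, so equal normals leave
    a sign of the tangent open.\<close>
  then have "T j 0 = T1 \<or> T j 0 = - T1"
    using eps_cases[of i] eps_cases[of j] by auto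
  moreover have "T j 0 \<noteq> - T1"
  proof
    assume opp: "T j 0 = - T1"
    have "D i 1 \<bullet> T1 > 0" "D j 0 \<bullet> (- T1) > 0"
      using D_inner_T[of i 1] D_inner_T[of j 0] norm_D_pos[OF i, of 1] norm_D_pos[OF j(1), of 0] opp
      by (auto simp: T1_def)
    then obtain d1 d2 where d1: "d1 > 0" "\<And>s t. s \<in> {0..1} \<Longrightarrow> t \<in> {0..1} \<Longrightarrow> \<bar>s - 1\<bar> \<le> d1 \<Longrightarrow> \<bar>t - 1\<bar> \<le> d1 \<Longrightarrow>
        s < t \<Longrightarrow> \<gamma> i s \<bullet> T1 < \<gamma> i t \<bullet> T1" and
      d2: "d2 > 0" "\<And>s t. s \<in> {0..1} \<Longrightarrow> t \<in> {0..1} \<Longrightarrow> \<bar>s - 0\<bar> \<le> d2 \<Longrightarrow> \<bar>t - 0\<bar> \<le> d2 \<Longrightarrow>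
        s < t \<Longrightarrow> \<gamma> j s \<bullet> (- T1) < \<gamma> j t \<bullet> (- T1)"
      using projection_strict_mono[OF has_D[OF i] cont_D[OF i], of 1 T1]
        projection_strict_mono[OF has_D[OF j(1)] cont_D[OF j(1)], of 0 "- T1"] by auto
    define a where "a = min d1 d2"
    have a: "a > 0" "a \<le> d1" "a \<le> d2" using d1 d2 by (auto simp: a_def)
    obtain \<rho> where \<rho>: "\<rho> > 0" "frontier \<Omega> \<inter> ball (y i) \<rho> \<subseteq>
      \<gamma> i ` ({0..1} \<inter> {1-a<..}) \<union> \<gamma> j ` ({0..1} \<inter> {..<a})"
      using corner_frontier_local[OF i a(1)] unfolding j_def by blast
    have le1: "\<gamma> i t \<bullet> T1 \<le> y i \<bullet> T1" if "t \<in> {0..1} \<inter> {1-a<..}" for t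
      using d1(2)[of t 1] that a yi by (cases "t = 1") auto
    have le2: "\<gamma> j t \<bullet> T1 \<le> y i \<bullet> T1" if "t \<in> {0..1} \<inter> {..<a}" for t
      using d2(2)[of 0 t] that a j by (cases "t = 0") auto
    define H where "H = ball (y i) \<rho> \<inter> {x. T1 \<bullet> x > T1 \<bullet> y i}"
    have "H \<inter> frontier \<Omega> = {}"
    proof -
      have False if x: "x \<in> H" "x \<in> frontier \<Omega>" for x
      proof -
        have "x \<in> \<gamma> i ` ({0..1} \<inter> {1-a<..}) \<union> \<gamma> j ` ({0..1} \<inter> {..<a})" using x \<rho>(2) by (auto simp: H_def)
        then have "x \<bullet> T1 \<le> y i \<bullet> T1" using le1 le2 by auto
        then show False using x(1) by (simp add: H_def inner_commute)
      qed
      then show ?thesis by blast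
    qed
    moreover have "connected H" unfolding H_def
      by (intro convex_connected convex_Int convex_ball convex_halfspace_gt)
    ultimately have H: "H \<subseteq> \<Omega> \<or> H \<inter> \<Omega> = {}" by (intro connected_frontier_free)
    \<comment> \<open>To be used for \<open>T1 - n\<close>, which points into the interior ball, and
      for \<open>T1 + n\<close>, which points into the exterior one; both have component 1 along
      \<open>T1\<close>.\<close>
    have inH: "\<forall>\<^sub>F s in at_right 0. y i + s *\<^sub>R v \<in> H" if v: "T1 \<bullet> v = 1" for v
    proof -
      have "((\<lambda>s. y i + s *\<^sub>R v) \<longlongrightarrow> y i) (at_right 0)" by (auto intro!: tendsto_eq_intros)
      then have "\<forall>\<^sub>F s in at_right 0. y i + s *\<^sub>R v \<in> ball (y i) \<rho>"
        by (rule topological_tendstoD) (use \<rho> in auto)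
      moreover have "\<forall>\<^sub>F s in at_right (0::real). s > 0" by (rule eventually_at_right_less)
      ultimately show ?thesis by eventually_elim (use v in \<open>auto simp: H_def inner_add_right\<close>)
    qed
    have "\<forall>\<^sub>F s in at_right 0. y i + s *\<^sub>R (T1 - n) \<in> ball (y i - \<delta> *\<^sub>R n) \<delta>"
      by (rule eventually_in_ball_direction)
         (use \<delta>(1) n T1 in \<open>auto simp: dist_norm inner_diff_left\<close>)
    moreover have "\<forall>\<^sub>F s in at_right 0. y i + s *\<^sub>R (T1 - n) \<in> H"
      by (rule inH) (simp add: inner_diff_right T1)
    ultimately have "\<forall>\<^sub>F s in at_right 0. y i + s *\<^sub>R (T1 - n) \<in> H \<inter> \<Omega>"
      by eventually_elim (use \<delta>(2) in \<open>auto simp: n_def yi\<close>)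
    then have "H \<inter> \<Omega> \<noteq> {}"
      using eventually_happens[of _ "at_right (0::real)"] trivial_limit_at_right_real by blast
    have "\<forall>\<^sub>F s in at_right 0. y i + s *\<^sub>R (T1 + n) \<in> ball p r"
      by (rule eventually_in_ball_direction)
         (use r pn n T1 in \<open>auto simp: inner_add_left\<close>)
    moreover have "\<forall>\<^sub>F s in at_right 0. y i + s *\<^sub>R (T1 + n) \<in> H"
      by (rule inH) (simp add: inner_add_right T1)
    ultimately have "\<forall>\<^sub>F s in at_right 0. y i + s *\<^sub>R (T1 + n) \<in> ball p r \<inter> H"
      by eventually_elim simp
    then have "ball p r \<inter> H \<noteq> {}"
      using eventually_happens[of _ "at_right (0::real)"] trivial_limit_at_right_real by blast
    then show False using H \<open>H \<inter> \<Omega> \<noteq> {}\<close> r(3) by blast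
  qed
  ultimately show ?thesis by (simp add: T1_def j_def)
qed

lemma ball_of_constant_phi:
  assumes phi: "\<And>z. z \<in> frontier \<Omega> - corners m y \<Longrightarrow> phi \<Omega> m \<gamma> z = c"
  shows "\<exists>c r. r > 0 \<and> \<Omega> = ball c r"
proof (rule rigidity)
  have le: "measure lebesgue \<Omega> \<le> c * perimeter m \<gamma>" by (rule area_le[OF phi])
  then have "c * perimeter m \<gamma> > 0" using area_pos by linarith
  then have c: "c > 0" using perimeter_pos by (simp add: zero_less_mult_iff)
  show "T i 1 = T (csuc m i) 0" if "i \<in> {1..m}" for i
    by (rule corner_tangent_eq[OF phi c that])
  show "kappa i t \<le> 1 / (2 * c)" if "i \<in> {1..m}" "t \<in> {0<..<1}" for i t
  proof -
    have "c * kappa i t \<le> 1/2"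
      using phi_curvature_le[of "\<gamma> i t"] phi[OF not_corner[OF that]] curvature_kappa[OF that] by simp
    then show ?thesis using c by (simp add: field_simps)
  qed
  \<comment> \<open>For \<open>k = 1 / (2 * c)\<close> this is the area bound divided by
    \<open>c\<close>.\<close>
  show "2 * (1 / (2 * c)) * measure lebesgue \<Omega> \<le> perimeter m \<gamma>"
    using le c by (simp add: field_simps)
qed

end

theorem theorem3p1:
  fixes \<Omega> :: "(real^2) set" and m :: nat
    and \<gamma> :: "nat \<Rightarrow> real \<Rightarrow> real^2" and y :: "nat \<Rightarrow> real^2"
  assumes "bounded \<Omega>" and "connected \<Omega>" and "open \<Omega>"
    and "piecewise_C2_no_concave \<Omega> m \<gamma> y"
    and starshaped: "\<forall>z\<in>frontier \<Omega> - corners m y. z \<bullet> outward_normal \<Omega> m \<gamma> z > 0"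
    and cases:
      "(C1_boundary m \<gamma> \<and>
        (\<exists>y0\<in>frontier \<Omega> - corners m y.
           (\<forall>z\<in>frontier \<Omega> - corners m y. curvature \<Omega> m \<gamma> z \<le> curvature \<Omega> m \<gamma> y0) \<and>
           phi \<Omega> m \<gamma> y0 \<ge> measure lebesgue \<Omega> / perimeter m \<gamma>))
       \<or> (\<exists>c. \<forall>z\<in>frontier \<Omega> - corners m y. phi \<Omega> m \<gamma> z = c)"
  shows "\<exists>c r. r > 0 \<and> \<Omega> = ball c r"
proof -
  interpret starshaped_domain \<Omega> m \<gamma> y
    by unfold_locales (fact assms)+
  from cases show ?thesis
  proof (elim disjE conjE exE bexE)
    fix z0 assume "C1_boundary m \<gamma>" "z0 \<in> frontier \<Omega> - corners m y"
      "\<forall>z\<in>frontier \<Omega> - corners m y. curvature \<Omega> m \<gamma> z \<le> curvature \<Omega> m \<gamma> z0"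
      "phi \<Omega> m \<gamma> z0 \<ge> measure lebesgue \<Omega> / perimeter m \<gamma>"
    then show ?thesis by (intro ball_of_max_curvature) blast+
  next
    fix c assume "\<forall>z\<in>frontier \<Omega> - corners m y. phi \<Omega> m \<gamma> z = c"
    then show ?thesis by (intro ball_of_constant_phi) blast
  qed
qed

end
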